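(* For any planar operad $P$ in sets, with symmetrization $\mathrm{Sym}(P)$, the functor $\mathrm{Tw}_{\mathrm{pOp}}(P)\to\mathrm{Tw}_{\mathrm{sOp}}(\mathrm{Sym}(P))$ is an equivalence of categories. In particular, the category $\mathrm{Tw}_{\mathrm{sOp}}(\mathrm{uAs})$, i.e. the category $\mathrm{Tw}_{\mathrm{sOp}}(\mathrm{Sym}(\mathrm{uAs}_{pl}))$, is equivalent to the category $\mathrm{Tw}_{\mathrm{pOp}}(\mathrm{uAs}_{pl})=\Delta$.
   Context: **Planar case.** For a planar operad $P$ (no symmetric group actions) $\mathrm{Tw}_{\mathrm{pOp}}(P)$ has the operations of $P$ as objects. A morphism with source $p\in P(c_1,\dots,c_n;c_0)$ is a tuple $(q_0,i;q_1,\dots,q_n)$, where the $i$-th input colour of $q_0\in P$ is $c_0$ and $q_j\in P$ has output colour $c_j$; its target is $q_0\circ_i p(q_1,\dots,q_n)$. Composition is grafting of trees around the source vertex followed by composition in $P$ of all edges not adjacent to $p$. **Symmetric case.** For a symmetric operad $R$, $\mathrm{Tw}_{\mathrm{sOp}}(R)$ has the operations of $R$ as objects. A morphism with source $p\in R(c_1,\dots,c_n;c_0)$ is (uniquely) a tuple $f=(q_0;q_1,\dots,q_n;\lambda)$, where $q_0\in R$ has arity $m_0\ge 1$ and first input colour $c_0$, $q_i\in R$ has arity $m_i\ge 0$ and output colour $c_i$, and $\lambda$ is a bijection from $\{(i,k):1\le i\le n,1\le k\le m_i\}\cup\{(0,k):2\le k\le m_0\}$ onto $\{1,\dots,N\}$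 with $k\mapsto\lambda(i,k)$ increasing for each fixed $i$. The target is $t$ with $t(x_1,\dots,x_N)=q_0\bigl(p(q_1(x_{\lambda(1,1)},\dots),\dots,q_n(x_{\lambda(n,1)},\dots)),x_{\lambda(0,2)},\dots,x_{\lambda(0,m_0)}\bigr)$. The composite of $f:p\to t$ with $g=(r_0;r_1,\dots,r_N;\mu)$ has upper vertices $q_i(r_{\lambda(i,1)},\dots,r_{\lambda(i,m_i)})$ and lower vertex $r_0\circ_1 q_0(\mathrm{id},r_{\lambda(0,2)},\dots,r_{\lambda(0,m_0)})$, with leaves numbered by $\mu$, and with inputs of each vertex (other than the first input of the lower one) then permuted so that the numbers increase. **The functor.** $\mathrm{Sym}$ is the left adjoint of the forgetful functor from symmetric to planar operads: operations of $\mathrm{Sym}(P)$ are uniquely of the form $p^\sigma$ with $p$ in $P$ and $\sigma$ a permutation. The functor sends $p$ to $p$ and $(q_0,i;q_1,\dots,q_n)$ to the morphism represented by the same planar tree with leaves numbered in planar order from left to right (so the lower vertex of the canonical representative is $q_0$ with its $i$-th input moved to the first place). $\mathrm{uAs}_{pl}$ is the terminal single-coloured planar operad (one operation of each arity $n\ge0$), and $\mathrm{uAs}=\mathrm{Sym}(\mathrm{uAs}_{pl})$ is the symmetric operad of monoids. $\Delta$ is the simplex category; $\mathrm{Tw}_{\mathrm{pOp}}(\mathrm{uAs}_{pl})$ is identified with $\Delta$ via an isomorphism sending the arity-$n$ operation to $[n]$. *)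

theory Defs
  imports "HOL-Combinatorics.Multiset_Permutations" "HOL-Library.FuncSet"
begin

section \<open>Categories, functors, equivalences\<close>

text \<open>\<open>Cmp C g f\<close> is the composite \<open>g \<circ> f\<close>.\<close>

record ('a, 'm) cat =
  Ob :: "'a set"
  Ar :: "'m set"
  Dom :: "'m \<Rightarrow> 'a"
  Cod :: "'m \<Rightarrow> 'a"
  Idt :: "'a \<Rightarrow> 'm"
  Cmp :: "'m \<Rightarrow> 'm \<Rightarrow> 'm"

locale category =
  fixes C :: "('a, 'm) cat"
  assumes dom_ob: "f \<in> Ar C \<Longrightarrow> Dom C f \<in> Ob C"
    and cod_ob: "f \<in> Ar C \<Longrightarrow> Cod C f \<in> Ob C"
    and idt_ar: "x \<in> Ob C \<Longrightarrow> Idt C x \<in> Ar C"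
    and dom_idt: "x \<in> Ob C \<Longrightarrow> Dom C (Idt C x) = x"
    and cod_idt: "x \<in> Ob C \<Longrightarrow> Cod C (Idt C x) = x"
    and cmp_ar: "\<lbrakk>f \<in> Ar C; g \<in> Ar C; Dom C g = Cod C f\<rbrakk> \<Longrightarrow> Cmp C g f \<in> Ar C"
    and dom_cmp: "\<lbrakk>f \<in> Ar C; g \<in> Ar C; Dom C g = Cod C f\<rbrakk> \<Longrightarrow> Dom C (Cmp C g f) = Dom C f"
    and cod_cmp: "\<lbrakk>f \<in> Ar C; g \<in> Ar C; Dom C g = Cod C f\<rbrakk> \<Longrightarrow> Cod C (Cmp C g f) = Cod C g"
    and cmp_idt_right: "f \<in> Ar C \<Longrightarrow> Cmp C f (Idt C (Dom C f)) = f"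
    and cmp_idt_left: "f \<in> Ar C \<Longrightarrow> Cmp C (Idt C (Cod C f)) f = f"
    and cmp_assoc: "\<lbrakk>f \<in> Ar C; g \<in> Ar C; h \<in> Ar C; Dom C g = Cod C f; Dom C h = Cod C g\<rbrakk>
        \<Longrightarrow> Cmp C h (Cmp C g f) = Cmp C (Cmp C h g) f"

locale cat_functor = source: category C + target: category D
  for C :: "('a, 'm) cat" and D :: "('b, 'n) cat" +
  fixes Fo :: "'a \<Rightarrow> 'b" and Fm :: "'m \<Rightarrow> 'n"
  assumes map_ob: "x \<in> Ob C \<Longrightarrow> Fo x \<in> Ob D"
    and map_ar: "f \<in> Ar C \<Longrightarrow> Fm f \<in> Ar D"
    and map_dom: "f \<in> Ar C \<Longrightarrow> Dom D (Fm f) = Fo (Dom C f)"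
    and map_cod: "f \<in> Ar C \<Longrightarrow> Cod D (Fm f) = Fo (Cod C f)"
    and map_idt: "x \<in> Ob C \<Longrightarrow> Fm (Idt C x) = Idt D (Fo x)"
    and map_cmp: "\<lbrakk>f \<in> Ar C; g \<in> Ar C; Dom C g = Cod C f\<rbrakk>
        \<Longrightarrow> Fm (Cmp C g f) = Cmp D (Fm g) (Fm f)"

definition iso_arrow :: "('a, 'm) cat \<Rightarrow> 'a \<Rightarrow> 'a \<Rightarrow> 'm \<Rightarrow> bool" where
  "iso_arrow C x y f \<longleftrightarrow> f \<in> Ar C \<and> Dom C f = x \<and> Cod C f = y \<and>
     (\<exists>g \<in> Ar C. Dom C g = y \<and> Cod C g = x \<and>
        Cmp C g f = Idt C x \<and> Cmp C f g = Idt C y)"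

definition natural_iso ::
  "('a, 'm) cat \<Rightarrow> ('b, 'n) cat \<Rightarrow> ('a \<Rightarrow> 'b) \<Rightarrow> ('m \<Rightarrow> 'n) \<Rightarrow> ('a \<Rightarrow> 'b) \<Rightarrow> ('m \<Rightarrow> 'n)
     \<Rightarrow> ('a \<Rightarrow> 'n) \<Rightarrow> bool" where
  "natural_iso C D Fo Fm Go Gm \<eta> \<longleftrightarrow>
     (\<forall>x \<in> Ob C. iso_arrow D (Fo x) (Go x) (\<eta> x)) \<and>
     (\<forall>f \<in> Ar C. Cmp D (\<eta> (Cod C f)) (Fm f) = Cmp D (Gm f) (\<eta> (Dom C f)))"

definition equivalence_functor ::
  "('a, 'm) cat \<Rightarrow> ('b, 'n) cat \<Rightarrow> ('a \<Rightarrow> 'b) \<Rightarrow> ('m \<Rightarrow> 'n) \<Rightarrow> bool" where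
  "equivalence_functor C D Fo Fm \<longleftrightarrow> cat_functor C D Fo Fm \<and>
     (\<exists>Go Gm. cat_functor D C Go Gm \<and>
        (\<exists>\<eta>. natural_iso C C id id (Go \<circ> Fo) (Gm \<circ> Fm) \<eta>) \<and>
        (\<exists>\<epsilon>. natural_iso D D (Fo \<circ> Go) (Fm \<circ> Gm) id id \<epsilon>))"

definition equivalent_categories :: "('a, 'm) cat \<Rightarrow> ('b, 'n) cat \<Rightarrow> bool" where
  "equivalent_categories C D \<longleftrightarrow> (\<exists>Fo Fm. equivalence_functor C D Fo Fm)"

definition isomorphism_functor ::
  "('a, 'm) cat \<Rightarrow> ('b, 'n) cat \<Rightarrow> ('a \<Rightarrow> 'b) \<Rightarrow> ('m \<Rightarrow> 'n) \<Rightarrow> bool" where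
  "isomorphism_functor C D Fo Fm \<longleftrightarrow> cat_functor C D Fo Fm \<and>
     bij_betw Fo (Ob C) (Ob D) \<and> bij_betw Fm (Ar C) (Ar D)"

text \<open>The object \<open>n\<close> of the simplex category stands for the ordinal \<open>[n] = {0 < \<dots> < n}\<close>.\<close>

definition Delta :: "(nat, nat \<times> nat \<times> (nat \<Rightarrow> nat)) cat" where
  "Delta = \<lparr> Ob = UNIV,
     Ar = {(m, n, f). f \<in> {..m} \<rightarrow>\<^sub>E {..n} \<and> mono_on {..m} f},
     Dom = (\<lambda>(m, n, f). m),
     Cod = (\<lambda>(m, n, f). n),
     Idt = (\<lambda>m. (m, m, restrict id {..m})),
     Cmp = (\<lambda>(n', k, g) (m, n, f). (m, k, compose {..m} g f)) \<rparr>"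


section \<open>Planar operads\<close>

text \<open>
  Coloured operads in sets. The operations form one set, each carrying its list of input colours
  and its output colour, and \<open>compo P p [q\<^sub>1, \<dots>, q\<^sub>n]\<close> is the total composite
  \<open>p(q\<^sub>1, \<dots>, q\<^sub>n)\<close>. Inputs are numbered from 0 throughout.
\<close>

record ('c, 'o) operad =
  colours :: "'c set"
  opers :: "'o set"
  ins :: "'o \<Rightarrow> 'c list"
  outc :: "'o \<Rightarrow> 'c"
  ident :: "'c \<Rightarrow> 'o"
  compo :: "'o \<Rightarrow> 'o list \<Rightarrow> 'o"

definition arity :: "('c, 'o, 'z) operad_scheme \<Rightarrow> 'o \<Rightarrow> nat" where
  "arity P p = length (ins P p)"

definition composable :: "('c, 'o, 'z) operad_scheme \<Rightarrow> 'o \<Rightarrow> 'o list \<Rightarrow> bool" where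
  "composable P p qs \<longleftrightarrow> p \<in> opers P \<and> set qs \<subseteq> opers P \<and> map (outc P) qs = ins P p"

locale planar_operad =
  fixes P :: "('c, 'o, 'z) operad_scheme"
  assumes ins_colours: "p \<in> opers P \<Longrightarrow> set (ins P p) \<subseteq> colours P"
    and outc_colours: "p \<in> opers P \<Longrightarrow> outc P p \<in> colours P"
    and ident_oper: "c \<in> colours P \<Longrightarrow> ident P c \<in> opers P"
    and ins_ident: "c \<in> colours P \<Longrightarrow> ins P (ident P c) = [c]"
    and outc_ident: "c \<in> colours P \<Longrightarrow> outc P (ident P c) = c"
    and compo_oper: "composable P p qs \<Longrightarrow> compo P p qs \<in> opers P"
    and ins_compo: "composable P p qs \<Longrightarrow> ins P (compo P p qs) = concat (map (ins P) qs)"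
    and outc_compo: "composable P p qs \<Longrightarrow> outc P (compo P p qs) = outc P p"
    and compo_ident_right: "p \<in> opers P \<Longrightarrow> compo P p (map (ident P) (ins P p)) = p"
    and compo_ident_left: "p \<in> opers P \<Longrightarrow> compo P (ident P (outc P p)) [p] = p"
    and compo_assoc: "\<lbrakk>composable P p qs; list_all2 (composable P) qs rss\<rbrakk>
        \<Longrightarrow> compo P (compo P p qs) (concat rss) = compo P p (map2 (compo P) qs rss)"

definition operad_morphism ::
  "('c, 'o, 'y) operad_scheme \<Rightarrow> ('d, 'p, 'z) operad_scheme \<Rightarrow> ('c \<Rightarrow> 'd) \<Rightarrow> ('o \<Rightarrow> 'p) \<Rightarrow> bool" where
  "operad_morphism P Q fc fo \<longleftrightarrow>
     (\<forall>c \<in> colours P. fc c \<in> colours Q) \<and>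
     (\<forall>p \<in> opers P. fo p \<in> opers Q \<and> ins Q (fo p) = map fc (ins P p) \<and> outc Q (fo p) = fc (outc P p)) \<and>
     (\<forall>c \<in> colours P. fo (ident P c) = ident Q (fc c)) \<and>
     (\<forall>p qs. composable P p qs \<longrightarrow> fo (compo P p qs) = compo Q (fo p) (map fo qs))"

text \<open>The partial composite \<open>q \<circ>\<^sub>i p\<close>.\<close>

definition partial_compo :: "('c, 'o, 'z) operad_scheme \<Rightarrow> 'o \<Rightarrow> nat \<Rightarrow> 'o \<Rightarrow> 'o" where
  "partial_compo P q i p = compo P q ((map (ident P) (ins P q))[i := p])"

text \<open>\<open>blocks [m\<^sub>1, \<dots>, m\<^sub>n] xs\<close> cuts \<open>xs\<close> into consecutive pieces of lengths \<open>m\<^sub>1, \<dots>, m\<^sub>n\<close>.\<close>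

fun blocks :: "nat list \<Rightarrow> 'a list \<Rightarrow> 'a list list" where
  "blocks [] xs = []"
| "blocks (m # ms) xs = take m xs # blocks ms (drop m xs)"

definition uAs_pl :: "(unit, nat) operad" where
  "uAs_pl = \<lparr> colours = UNIV, opers = UNIV, ins = (\<lambda>n. replicate n ()), outc = (\<lambda>n. ()),
     ident = (\<lambda>c. 1), compo = (\<lambda>n ms. sum_list ms) \<rparr>"


section \<open>Symmetric operads\<close>

text \<open>
  A permutation of \<open>{..<n}\<close> is written in one-line notation, as a list
  \<open>\<sigma> \<in> permutations_of_set {..<n}\<close>. The convention for the action is
  \<open>(act R p \<sigma>)(x\<^sub>0, \<dots>, x\<^sub>n\<^sub>-\<^sub>1) = p(x\<^bsub>\<sigma>!0\<^esub>, \<dots>, x\<^bsub>\<sigma>!(n-1)\<^esub>)\<close>: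
  the leaves of \<open>p\<close>, read from left to right, get the numbers \<open>\<sigma>!0, \<dots>, \<sigma>!(n-1)\<close>.
  The right action of the symmetric groups found elsewhere is obtained by inverting \<open>\<sigma>\<close>.
\<close>

record ('c, 'o) sym_operad = "('c, 'o) operad" +
  act :: "'o \<Rightarrow> nat list \<Rightarrow> 'o"

text \<open>\<open>unpermute \<sigma> xs\<close> has \<open>xs ! k\<close> at position \<open>\<sigma> ! k\<close>.\<close>

definition unpermute :: "nat list \<Rightarrow> 'a list \<Rightarrow> 'a list" where
  "unpermute \<sigma> xs = map (\<lambda>j. the (map_of (zip \<sigma> xs) j)) [0..<length xs]"

text \<open>
  In the two equivariance axioms, the entries of the \<open>i\<close>-th block are the numbers of the
  variables that are fed into \<open>qs ! i\<close>.
\<close>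

locale symmetric_operad = planar_operad R for R :: "('c, 'o, 'z) sym_operad_scheme" +
  assumes act_oper: "\<lbrakk>p \<in> opers R; \<sigma> \<in> permutations_of_set {..<arity R p}\<rbrakk>
        \<Longrightarrow> act R p \<sigma> \<in> opers R"
    and ins_act: "\<lbrakk>p \<in> opers R; \<sigma> \<in> permutations_of_set {..<arity R p}\<rbrakk>
        \<Longrightarrow> ins R (act R p \<sigma>) = unpermute \<sigma> (ins R p)"
    and outc_act: "\<lbrakk>p \<in> opers R; \<sigma> \<in> permutations_of_set {..<arity R p}\<rbrakk>
        \<Longrightarrow> outc R (act R p \<sigma>) = outc R p"
    and act_id: "p \<in> opers R \<Longrightarrow> act R p [0..<arity R p] = p"
    and act_act: "\<lbrakk>p \<in> opers R; \<sigma> \<in> permutations_of_set {..<arity R p};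
        \<tau> \<in> permutations_of_set {..<arity R p}\<rbrakk>
        \<Longrightarrow> act R (act R p \<sigma>) \<tau> = act R p (map ((!) \<tau>) \<sigma>)"
    and compo_act_left: "\<lbrakk>p \<in> opers R; \<sigma> \<in> permutations_of_set {..<arity R p};
        composable R (act R p \<sigma>) qs; bs = blocks (map (arity R) qs) [0..<sum_list (map (arity R) qs)]\<rbrakk>
        \<Longrightarrow> compo R (act R p \<sigma>) qs = act R (compo R p (map ((!) qs) \<sigma>)) (concat (map ((!) bs) \<sigma>))"
    and compo_act_right: "\<lbrakk>composable R p qs;
        list_all2 (\<lambda>q \<tau>. \<tau> \<in> permutations_of_set {..<arity R q}) qs \<tau>s;
        bs = blocks (map (arity R) qs) [0..<sum_list (map (arity R) qs)]\<rbrakk>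
        \<Longrightarrow> compo R p (map2 (act R) qs \<tau>s)
            = act R (compo R p qs) (concat (map2 (\<lambda>b \<tau>. map ((!) b) \<tau>) bs \<tau>s))"

definition sym_operad_morphism ::
  "('c, 'o, 'y) sym_operad_scheme \<Rightarrow> ('d, 'p, 'z) sym_operad_scheme \<Rightarrow> ('c \<Rightarrow> 'd) \<Rightarrow> ('o \<Rightarrow> 'p) \<Rightarrow> bool" where
  "sym_operad_morphism R S fc fo \<longleftrightarrow> operad_morphism R S fc fo \<and>
     (\<forall>p \<in> opers R. \<forall>\<sigma> \<in> permutations_of_set {..<arity R p}. fo (act R p \<sigma>) = act S (fo p) \<sigma>)"

text \<open>
  The symmetrization; the pair \<open>(p, \<sigma>)\<close> is \<open>act p \<sigma>\<close>, and the formula for \<open>compo\<close> is the one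
  forced by equivariance.
\<close>

definition Sym :: "('c, 'o) operad \<Rightarrow> ('c, 'o \<times> nat list) sym_operad" where
  "Sym P = \<lparr>
     colours = colours P,
     opers = {(p, \<sigma>). p \<in> opers P \<and> \<sigma> \<in> permutations_of_set {..<arity P p}},
     ins = (\<lambda>(p, \<sigma>). unpermute \<sigma> (ins P p)),
     outc = (\<lambda>(p, \<sigma>). outc P p),
     ident = (\<lambda>c. (ident P c, [0])),
     compo = (\<lambda>(p, \<sigma>) qs.
       let ms = map (\<lambda>(q, \<tau>). arity P q) qs; bs = blocks ms [0..<sum_list ms]
       in (compo P p (map (\<lambda>i. fst (qs ! i)) \<sigma>),
           concat (map (\<lambda>i. map ((!) (bs ! i)) (snd (qs ! i))) \<sigma>))),
     act = (\<lambda>(p, \<sigma>) \<tau>. (p, map ((!) \<tau>) \<sigma>)) \<rparr>"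

definition Sym_unit :: "('c, 'o) operad \<Rightarrow> 'o \<Rightarrow> 'o \<times> nat list" where
  "Sym_unit P p = (p, [0..<arity P p])"

definition uAs :: "(unit, nat \<times> nat list) sym_operad" where
  "uAs = Sym uAs_pl"


section \<open>Twisted arrow categories\<close>

subsection \<open>Planar case\<close>

text \<open>The arrow \<open>(p, q\<^sub>0, i, qs)\<close> is the morphism \<open>(q\<^sub>0, i; qs)\<close> with source \<open>p\<close>.\<close>

type_synonym 'o pl_arrow = "'o \<times> 'o \<times> nat \<times> 'o list"

definition pTw_arrows :: "('c, 'o, 'z) operad_scheme \<Rightarrow> 'o pl_arrow set" where
  "pTw_arrows P = {(p, q0, i, qs). composable P p qs \<and> q0 \<in> opers P \<and>
     i < arity P q0 \<and> ins P q0 ! i = outc P p}"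

definition pTw_cod :: "('c, 'o, 'z) operad_scheme \<Rightarrow> 'o pl_arrow \<Rightarrow> 'o" where
  "pTw_cod P = (\<lambda>(p, q0, i, qs). partial_compo P q0 i (compo P p qs))"

text \<open>
  The inputs of the target of \<open>(q0, i; qs)\<close> are, in this order: the first \<open>i\<close> inputs of \<open>q0\<close>,
  the inputs of the \<open>qs\<close>, and the remaining inputs of \<open>q0\<close>.
\<close>

definition pTw_cmp :: "('c, 'o, 'z) operad_scheme \<Rightarrow> 'o pl_arrow \<Rightarrow> 'o pl_arrow \<Rightarrow> 'o pl_arrow" where
  "pTw_cmp P = (\<lambda>(t, r0, j, rs) (p, q0, i, qs).
     let ms = map (arity P) qs in
     (p,
      partial_compo P r0 j
        (compo P q0 (take i rs @ [ident P (outc P p)] @ drop (i + sum_list ms) rs)),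
      j + sum_list (map (arity P) (take i rs)),
      map2 (compo P) qs (blocks ms (drop i rs))))"

definition Tw_pOp :: "('c, 'o, 'z) operad_scheme \<Rightarrow> ('o, 'o pl_arrow) cat" where
  "Tw_pOp P = \<lparr> Ob = opers P, Ar = pTw_arrows P, Dom = fst, Cod = pTw_cod P,
     Idt = (\<lambda>p. (p, ident P (outc P p), 0, map (ident P) (ins P p))),
     Cmp = pTw_cmp P \<rparr>"

subsection \<open>Symmetric case\<close>

text \<open>
  The arrow \<open>(p, q\<^sub>0, qs, low, up)\<close> is the morphism \<open>(q\<^sub>0; qs; \<lambda>)\<close> with source \<open>p\<close>, where \<open>\<lambda>\<close>
  is given by its rows: \<open>low = [\<lambda>(0,2), \<dots>, \<lambda>(0,m\<^sub>0)]\<close> and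
  \<open>up ! (i-1) = [\<lambda>(i,1), \<dots>, \<lambda>(i,m\<^sub>i)]\<close> for \<open>i = 1, \<dots>, n\<close>, with values in \<open>{..<N}\<close> rather
  than \<open>{1, \<dots>, N}\<close>.
\<close>

type_synonym 'o sym_arrow = "'o \<times> 'o \<times> 'o list \<times> nat list \<times> nat list list"

definition sTw_arrows :: "('c, 'o, 'z) sym_operad_scheme \<Rightarrow> 'o sym_arrow set" where
  "sTw_arrows R = {(p, q0, qs, low, up). composable R p qs \<and> q0 \<in> opers R \<and>
     1 \<le> arity R q0 \<and> ins R q0 ! 0 = outc R p \<and>
     length low = arity R q0 - 1 \<and> map length up = map (arity R) qs \<and>
     (\<forall>l \<in> set (low # up). sorted_wrt (<) l) \<and>
     concat up @ low \<in> permutations_of_set {..<length (concat up @ low)}}"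

definition sTw_cod :: "('c, 'o, 'z) sym_operad_scheme \<Rightarrow> 'o sym_arrow \<Rightarrow> 'o" where
  "sTw_cod R = (\<lambda>(p, q0, qs, low, up).
     act R (partial_compo R q0 0 (compo R p qs)) (concat up @ low))"

text \<open>
  If the inputs of \<open>q\<close> carry the numbers \<open>l\<close>, then the inputs of \<open>act q (ranks l)\<close> carry the
  numbers \<open>sort l\<close>.
\<close>

definition ranks :: "nat list \<Rightarrow> nat list" where
  "ranks l = map (\<lambda>x. length (filter (\<lambda>y. y < x) l)) l"

definition sTw_cmp ::
  "('c, 'o, 'z) sym_operad_scheme \<Rightarrow> 'o sym_arrow \<Rightarrow> 'o sym_arrow \<Rightarrow> 'o sym_arrow" where
  "sTw_cmp R = (\<lambda>(t, r0, rs, low', up') (p, q0, qs, low, up).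
     let v = partial_compo R r0 0 (compo R q0 (ident R (outc R p) # map ((!) rs) low));
         vl = concat (map ((!) up') low) @ low';
         us = map2 (\<lambda>q l. compo R q (map ((!) rs) l)) qs up;
         uls = map (\<lambda>l. concat (map ((!) up') l)) up
     in (p, act R v (0 # map Suc (ranks vl)), map2 (\<lambda>u l. act R u (ranks l)) us uls,
         sort vl, map sort uls))"

definition Tw_sOp :: "('c, 'o, 'z) sym_operad_scheme \<Rightarrow> ('o, 'o sym_arrow) cat" where
  "Tw_sOp R = \<lparr> Ob = opers R, Ar = sTw_arrows R, Dom = fst, Cod = sTw_cod R,
     Idt = (\<lambda>p. (p, ident R (outc R p), map (ident R) (ins R p), [], map (\<lambda>k. [k]) [0..<arity R p])),
     Cmp = sTw_cmp R \<rparr>"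

subsection \<open>The comparison functor\<close>

text \<open>
  In the lower vertex, the distinguished input \<open>i\<close> gets the number 0 and the order of the other
  inputs is kept.
\<close>

definition Tw_Sym_arrow :: "('c, 'o) operad \<Rightarrow> 'o pl_arrow \<Rightarrow> ('o \<times> nat list) sym_arrow" where
  "Tw_Sym_arrow P = (\<lambda>(p, q0, i, qs).
     let m = arity P q0; ms = map (arity P) qs; s = sum_list ms in
     (Sym_unit P p,
      act (Sym P) (Sym_unit P q0) ([1..<Suc i] @ [0] @ [Suc i..<m]),
      map (Sym_unit P) qs,
      [0..<i] @ [i + s..<m - 1 + s],
      blocks ms [i..<i + s]))"


section \<open>The symmetrization is the free symmetric operad\<close>

lemma sum_list_concat': "sum_list (concat xss) = sum_list (map sum_list (xss :: nat list list))"
  by (induction xss) auto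

lemma planar_operad_uAs_pl: "planar_operad uAs_pl"
proof
  fix p qs rss
  assume a: "composable uAs_pl p qs" "list_all2 (composable uAs_pl) qs rss"
  have "map sum_list rss = map2 (compo uAs_pl) qs rss"
    using a(2) by (induction rule: list_all2_induct) (auto simp: uAs_pl_def)
  then show "compo uAs_pl (compo uAs_pl p qs) (concat rss) = compo uAs_pl p (map2 (compo uAs_pl) qs rss)"
    by (simp add: uAs_pl_def sum_list_concat')
next
  fix p qs
  assume "composable uAs_pl p qs"
  show "ins uAs_pl (compo uAs_pl p qs) = concat (map (ins uAs_pl) qs)"
    by (induction qs) (auto simp: uAs_pl_def replicate_add)
qed (auto simp: uAs_pl_def sum_list_replicate)

lemma mem_permutations_lessThan_iff:
  "\<sigma> \<in> permutations_of_set {..<n} \<longleftrightarrow> mset \<sigma> = mset [0..<n]"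
proof
  assume "\<sigma> \<in> permutations_of_set {..<n}"
  from permutations_of_setD[OF this] have "set \<sigma> = set [0..<n]" "distinct \<sigma>"
    by (simp_all add: atLeast0LessThan)
  then show "mset \<sigma> = mset [0..<n]" by (subst set_eq_iff_mset_eq_distinct[symmetric]) simp_all
next
  assume "mset \<sigma> = mset [0..<n]"
  then have "set \<sigma> = set [0..<n]" "distinct \<sigma>"
    by (metis set_mset_mset, metis distinct_upt mset_eq_imp_distinct_iff)
  then show "\<sigma> \<in> permutations_of_set {..<n}"
    by (intro permutations_of_setI) (simp_all add: atLeast0LessThan)
qed

lemma permutation_facts:
  assumes "\<sigma> \<in> permutations_of_set {..<n}"
  shows "length \<sigma> = n" "set \<sigma> = {..<n}" "distinct \<sigma>"
  using permutations_of_setD[OF assms] length_finite_permutations_of_set[OF assms] by simp_all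

lemma mset_map_nth_permutation:
  "\<sigma> \<in> permutations_of_set {..<length xs} \<Longrightarrow> mset (map ((!) xs) \<sigma>) = mset xs"
  by (metis mem_permutations_lessThan_iff map_nth mset_map)

lemma map_nth_permutation:
  "\<lbrakk>\<sigma> \<in> permutations_of_set {..<n}; \<tau> \<in> permutations_of_set {..<n}\<rbrakk>
    \<Longrightarrow> map ((!) \<tau>) \<sigma> \<in> permutations_of_set {..<n}"
  using mset_map_nth_permutation[of \<sigma> \<tau>] permutation_facts(1)[of \<tau> n]
  by (simp add: mem_permutations_lessThan_iff)

lemma length_unpermute [simp]: "length (unpermute \<sigma> xs) = length xs"
  by (simp add: unpermute_def)

lemma map_nth_unpermute:
  assumes "\<sigma> \<in> permutations_of_set {..<length xs}"
  shows "map ((!) (unpermute \<sigma> xs)) \<sigma> = xs"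
proof (rule nth_equalityI)
  note s = permutation_facts[OF assms]
  show "length (map ((!) (unpermute \<sigma> xs)) \<sigma>) = length xs" using s by simp
  fix k assume "k < length (map ((!) (unpermute \<sigma> xs)) \<sigma>)"
  then have k: "k < length \<sigma>" "k < length xs" using s by auto
  have "\<sigma> ! k < length xs" using s k nth_mem by fastforce
  then show "map ((!) (unpermute \<sigma> xs)) \<sigma> ! k = xs ! k"
    using k s by (simp add: unpermute_def map_of_zip_nth)
qed

lemma unpermute_eqI:
  assumes s: "\<sigma> \<in> permutations_of_set {..<length xs}"
    and ys: "length ys = length xs" "map ((!) ys) \<sigma> = xs"
  shows "unpermute \<sigma> xs = ys"
proof (rule nth_equalityI)
  show "length (unpermute \<sigma> xs) = length ys" using ys by simp
  fix j assume "j < length (unpermute \<sigma> xs)"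
  then have "j \<in> set \<sigma>" using permutation_facts[OF s] by simp
  moreover have "map ((!) (unpermute \<sigma> xs)) \<sigma> = map ((!) ys) \<sigma>"
    using map_nth_unpermute[OF s] ys by simp
  ultimately show "unpermute \<sigma> xs ! j = ys ! j" by (simp add: map_eq_conv)
qed

lemma length_blocks [simp]: "length (blocks ms xs) = length ms"
  by (induction ms xs rule: blocks.induct) auto

lemma map_length_blocks: "length xs = sum_list ms \<Longrightarrow> map length (blocks ms xs) = ms"
  by (induction ms xs rule: blocks.induct) auto

lemma concat_blocks: "length xs = sum_list ms \<Longrightarrow> concat (blocks ms xs) = xs"
  by (induction ms xs rule: blocks.induct) auto

lemma map_blocks: "map (map f) (blocks ms xs) = blocks ms (map f xs)"
  by (induction ms xs rule: blocks.induct) (auto simp: take_map drop_map)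

lemma blocks_concat: "blocks (map length xss) (concat xss) = xss"
  by (induction xss) auto

lemma length_nth_blocks:
  "\<lbrakk>length xs = sum_list ms; i < length ms\<rbrakk> \<Longrightarrow> length (blocks ms xs ! i) = ms ! i"
  by (metis length_blocks map_length_blocks nth_map)

text \<open>The entries of the \<open>i\<close>-th block are the positions of \<open>xss ! i\<close> in \<open>concat xss\<close>.\<close>

lemma map_nth_concat_block:
  assumes "i < length xss" "ms = map length xss" "n = sum_list ms"
  shows "map ((!) (concat xss)) (blocks ms [0..<n] ! i) = xss ! i"
proof -
  have "map (map ((!) (concat xss))) (blocks ms [0..<n]) = blocks ms (map ((!) (concat xss)) [0..<n])"
    by (rule map_blocks)
  also have "map ((!) (concat xss)) [0..<n] = concat xss"
    using assms(2,3) map_nth[of "concat xss"] by (simp add: length_concat)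
  also have "blocks ms (concat xss) = xss" using assms(2) blocks_concat by blast
  finally show ?thesis using assms by (metis length_blocks length_map nth_map)
qed

lemma mset_concat_cong:
  "mset (map mset xss) = mset (map mset yss) \<Longrightarrow> mset (concat xss) = mset (concat yss)"
  by (simp only: mset_concat sum_mset_sum_list[symmetric])

lemma labels_permutation:
  assumes \<sigma>: "\<sigma> \<in> permutations_of_set {..<length ms}" and \<tau>s: "length \<tau>s = length ms"
    and \<tau>: "\<And>i. i < length ms \<Longrightarrow> \<tau>s ! i \<in> permutations_of_set {..<ms ! i}"
    and bs: "bs = blocks ms [0..<sum_list ms]"
  shows "concat (map (\<lambda>i. map ((!) (bs ! i)) (\<tau>s ! i)) \<sigma>) \<in> permutations_of_set {..<sum_list ms}"
proof -
  have 1: "mset (map ((!) (bs ! i)) (\<tau>s ! i)) = mset (bs ! i)" if "i < length ms" for i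
    using that \<tau>[OF that] by (intro mset_map_nth_permutation) (simp add: bs length_nth_blocks)
  have "map mset (map (\<lambda>i. map ((!) (bs ! i)) (\<tau>s ! i)) \<sigma>) = map ((!) (map mset bs)) \<sigma>"
    using permutation_facts[OF \<sigma>] 1 by (auto simp: bs)
  also have "mset \<dots> = mset (map mset bs)"
    by (rule mset_map_nth_permutation) (use \<sigma> in \<open>simp add: bs\<close>)
  finally have "mset (concat (map (\<lambda>i. map ((!) (bs ! i)) (\<tau>s ! i)) \<sigma>)) = mset (concat bs)"
    by (rule mset_concat_cong)
  then show ?thesis by (simp add: mem_permutations_lessThan_iff bs concat_blocks)
qed

lemma Sym_simps [simp]:
  "colours (Sym P) = colours P"
  "opers (Sym P) = {(p, \<sigma>). p \<in> opers P \<and> \<sigma> \<in> permutations_of_set {..<arity P p}}"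
  "ins (Sym P) (p, \<sigma>) = unpermute \<sigma> (ins P p)"
  "outc (Sym P) (p, \<sigma>) = outc P p"
  "ident (Sym P) c = (ident P c, [0])"
  "act (Sym P) (p, \<sigma>) \<tau> = (p, map ((!) \<tau>) \<sigma>)"
  by (simp_all add: Sym_def)

lemma fst_act_Sym [simp]: "fst (act (Sym P) q \<tau>) = fst q"
  by (cases q) simp

lemma Sym_arity [simp]: "arity (Sym P) = (\<lambda>q. arity P (fst q))"
  by (auto simp: arity_def fun_eq_iff)

lemma Sym_outc: "outc (Sym P) = (\<lambda>q. outc P (fst q))"
  by (auto simp: fun_eq_iff)

lemma Sym_compo:
  "compo (Sym P) (p, \<sigma>) qs =
     (compo P p (map (\<lambda>i. fst (qs ! i)) \<sigma>),
      concat (map (\<lambda>i. map ((!) (blocks (map (\<lambda>q. arity P (fst q)) qs)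
         [0..<sum_list (map (\<lambda>q. arity P (fst q)) qs)] ! i)) (snd (qs ! i))) \<sigma>))"
  by (simp add: Sym_def Let_def case_prod_unfold)

lemma nested_blocks:
  fixes kss :: "nat list list"
  assumes i: "i < length kss" and k: "k < length (kss ! i)" and ms: "ms = map length kss"
  shows "map ((!) (blocks (map sum_list kss) [0..<sum_list (concat kss)] ! i))
            (blocks (kss ! i) [0..<sum_list (kss ! i)] ! k)
         = blocks (concat kss) [0..<sum_list (concat kss)] ! (blocks ms [0..<sum_list ms] ! i ! k)"
proof -
  define B where "B = blocks (concat kss) [0..<sum_list (concat kss)]"
  define G where "G = blocks ms B"
  have lenB: "length B = sum_list ms" by (simp add: B_def ms length_concat)
  have mapB: "map length B = concat kss" by (simp add: B_def map_length_blocks)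
  have lenG: "length G = length kss" by (simp add: G_def ms)
  have "map (map length) G = blocks ms (concat kss)" by (simp add: G_def map_blocks mapB)
  then have mapG: "map (map length) G = kss" by (simp only: ms blocks_concat)
  have lens: "map length (G ! j) = kss ! j" if "j < length kss" for j
    using arg_cong[OF mapG, of "\<lambda>l. l ! j"] that lenG by simp
  have "concat G = B" using lenB by (simp add: G_def concat_blocks)
  moreover have "concat (map concat G) = concat (concat G)" by (induction G) simp_all
  ultimately have cc: "concat (map concat G) = [0..<sum_list (concat kss)]"
    by (simp add: B_def concat_blocks)
  have "map length (map concat G) = map sum_list kss"
    using lens lenG by (auto intro!: nth_equalityI simp: length_concat)
  with cc blocks_concat[of "map concat G"]
  have D: "blocks (map sum_list kss) [0..<sum_list (concat kss)] = map concat G" by simp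
  have "map (map ((!) B)) (blocks ms [0..<sum_list ms]) = G"
    using map_nth[of B] by (simp add: map_blocks G_def lenB)
  then have "map ((!) B) (blocks ms [0..<sum_list ms] ! i) = G ! i"
    using i by (metis length_blocks length_map ms nth_map)
  moreover have "length (blocks ms [0..<sum_list ms] ! i) = length (kss ! i)"
    using i by (simp add: length_nth_blocks ms)
  ultimately have GB: "G ! i ! k = B ! (blocks ms [0..<sum_list ms] ! i ! k)"
    using k by (metis nth_map)
  have "map ((!) (concat (G ! i))) (blocks (kss ! i) [0..<sum_list (kss ! i)] ! k) = G ! i ! k"
    using k lens[OF i, symmetric] by (intro map_nth_concat_block) simp_all
  then show ?thesis using i lenG by (simp add: D GB flip: B_def)
qed

lemma blocks_ones: "blocks (map (\<lambda>_. Suc 0) xs) [k..<k + length xs] = map (\<lambda>i. [i]) [k..<k + length xs]"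
proof (induction xs arbitrary: k)
  case (Cons x xs)
  have "[k..<k + length (x # xs)] = k # [Suc k..<Suc k + length xs]"
    by (subst upt_conv_Cons) simp_all
  moreover have "map (\<lambda>i. [i]) (k # ks) = [k] # map (\<lambda>i. [i]) ks"
    "blocks (map (\<lambda>_. Suc 0) (x # xs)) (k # ks) = [k] # blocks (map (\<lambda>_. Suc 0) xs) ks" for k :: nat and ks
    by simp_all
  ultimately show ?case using Cons[of "Suc k"] by (simp only:)
qed simp

context
  fixes P :: "('c, 'o) operad"
  assumes P: "planar_operad P"
begin

interpretation planar_operad P by (rule P)

lemma Sym_composableD:
  assumes "composable (Sym P) (p, \<sigma>) qs"
  shows "p \<in> opers P" "\<sigma> \<in> permutations_of_set {..<arity P p}" "length qs = arity P p"
    "\<And>i. i < length qs \<Longrightarrow> fst (qs ! i) \<in> opers P"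
    "\<And>i. i < length qs \<Longrightarrow> snd (qs ! i) \<in> permutations_of_set {..<arity P (fst (qs ! i))}"
    "composable P p (map (\<lambda>i. fst (qs ! i)) \<sigma>)"
proof -
  have qs: "set qs \<subseteq> opers (Sym P)" and out: "map (outc (Sym P)) qs = unpermute \<sigma> (ins P p)"
    using assms by (simp_all add: composable_def)
  show p: "p \<in> opers P" and \<sigma>: "\<sigma> \<in> permutations_of_set {..<arity P p}"
    using assms by (auto simp: composable_def)
  show len: "length qs = arity P p" using arg_cong[OF out, of length] by (simp add: arity_def)
  show f: "fst (qs ! i) \<in> opers P" and "snd (qs ! i) \<in> permutations_of_set {..<arity P (fst (qs ! i))}"
    if "i < length qs" for i
    using qs nth_mem[OF that] by fastforce+
  have "map ((!) (map (outc (Sym P)) qs)) \<sigma> = ins P p"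
    using map_nth_unpermute[of \<sigma> "ins P p"] \<sigma> by (simp only: out arity_def)
  moreover have "map ((!) (map (outc (Sym P)) qs)) \<sigma> = map (outc P) (map (\<lambda>i. fst (qs ! i)) \<sigma>)"
    using permutation_facts[OF \<sigma>] len by (auto simp: Sym_outc)
  ultimately show "composable P p (map (\<lambda>i. fst (qs ! i)) \<sigma>)"
    using p f permutation_facts[OF \<sigma>] len by (auto simp: composable_def)
qed

lemma Sym_arity_compo:
  assumes "composable (Sym P) (p, \<sigma>) qs"
  shows "arity P (compo P p (map (\<lambda>i. fst (qs ! i)) \<sigma>)) = sum_list (map (\<lambda>q. arity P (fst q)) qs)"
proof -
  note c = Sym_composableD[OF assms]
  have "arity P (compo P p (map (\<lambda>i. fst (qs ! i)) \<sigma>)) = sum_list (map ((!) (map (\<lambda>q. arity P (fst q)) qs)) \<sigma>)"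
  proof -
    have "arity P (compo P p (map (\<lambda>i. fst (qs ! i)) \<sigma>)) = sum_list (map (\<lambda>i. arity P (fst (qs ! i))) \<sigma>)"
      by (simp add: arity_def ins_compo[OF c(6)] length_concat o_def)
    moreover have "map (\<lambda>i. arity P (fst (qs ! i))) \<sigma> = map ((!) (map (\<lambda>q. arity P (fst q)) qs)) \<sigma>"
      using c(3) permutation_facts(2)[OF c(2)] by (simp add: map_eq_conv)
    ultimately show ?thesis by (simp only:)
  qed
  also have "\<dots> = sum_list (map (\<lambda>q. arity P (fst q)) qs)"
    using mset_map_nth_permutation[of \<sigma> "map (\<lambda>q. arity P (fst q)) qs"] c(2,3)
    by (metis length_map sum_mset_sum_list)
  finally show ?thesis .
qed


lemma Sym_compo_oper:
  assumes "composable (Sym P) pp qs"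
  shows "compo (Sym P) pp qs \<in> opers (Sym P)"
proof -
  obtain p \<sigma> where pp: "pp = (p, \<sigma>)" by fastforce
  note c = Sym_composableD[OF assms[unfolded pp]]
  have "concat (map (\<lambda>i. map ((!) (blocks (map (\<lambda>q. arity P (fst q)) qs)
         [0..<sum_list (map (\<lambda>q. arity P (fst q)) qs)] ! i)) (map snd qs ! i)) \<sigma>)
     \<in> permutations_of_set {..<sum_list (map (\<lambda>q. arity P (fst q)) qs)}"
    by (rule labels_permutation) (use c in \<open>simp_all\<close>)
  moreover have "map (\<lambda>i. map ((!) (bs i)) (map snd qs ! i)) \<sigma> = map (\<lambda>i. map ((!) (bs i)) (snd (qs ! i))) \<sigma>"
    for bs :: "nat \<Rightarrow> nat list"
    using permutation_facts(2)[OF c(2)] c(3) by (auto simp: map_eq_conv)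
  ultimately show ?thesis
    using compo_oper[OF c(6)] Sym_arity_compo[OF assms[unfolded pp]]
    by (simp add: pp Sym_compo)
qed

lemma Sym_ins_compo:
  assumes "composable (Sym P) pp qs"
  shows "ins (Sym P) (compo (Sym P) pp qs) = concat (map (ins (Sym P)) qs)"
proof -
  obtain p \<sigma> where pp: "pp = (p, \<sigma>)" by fastforce
  note c = Sym_composableD[OF assms[unfolded pp]]
  let ?ms = "map (\<lambda>q. arity P (fst q)) qs"
  let ?bs = "blocks ?ms [0..<sum_list ?ms]"
  let ?C = "concat (map (ins (Sym P)) qs)"
  have ms: "?ms = map length (map (ins (Sym P)) qs)"
    by (auto simp: Sym_def arity_def)
  have oper: "compo (Sym P) pp qs \<in> opers (Sym P)" by (rule Sym_compo_oper[OF assms])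
  have blk: "map ((!) ?C) (map ((!) (?bs ! i)) (snd (qs ! i))) = ins P (fst (qs ! i))" if "i < length qs" for i
  proof -
    have e: "map ((!) ?C) (?bs ! i) = ins (Sym P) (qs ! i)"
      using map_nth_concat_block[OF _ ms refl, of i] that by simp
    have q: "ins (Sym P) (qs ! i) = unpermute (snd (qs ! i)) (ins P (fst (qs ! i)))"
      by (cases "qs ! i") simp
    note t = permutation_facts[OF c(5)[OF that]]
    have "map ((!) ?C) (map ((!) (?bs ! i)) (snd (qs ! i))) = map ((!) (map ((!) ?C) (?bs ! i))) (snd (qs ! i))"
      using t that by (auto simp: length_nth_blocks)
    also have "\<dots> = ins P (fst (qs ! i))"
      unfolding e q using c(5)[OF that] by (intro map_nth_unpermute) (simp add: arity_def)
    finally show ?thesis .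
  qed
  have "map ((!) ?C) (snd (compo (Sym P) pp qs)) = concat (map (\<lambda>i. ins P (fst (qs ! i))) \<sigma>)"
  proof -
    have "map (\<lambda>i. map ((!) ?C) (map ((!) (?bs ! i)) (snd (qs ! i)))) \<sigma> = map (\<lambda>i. ins P (fst (qs ! i))) \<sigma>"
      using permutation_facts(2)[OF c(2)] c(3) blk by (intro map_cong refl) simp
    then show ?thesis by (simp only: pp Sym_compo snd_conv map_concat map_map o_def)
  qed
  also have "\<dots> = ins P (fst (compo (Sym P) pp qs))"
    by (simp add: pp Sym_compo ins_compo[OF c(6)] o_def)
  finally have 1: "map ((!) ?C) (snd (compo (Sym P) pp qs)) = ins P (fst (compo (Sym P) pp qs))" .
  have 2: "length ?C = length (ins P (fst (compo (Sym P) pp qs)))"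
    using Sym_arity_compo[OF assms[unfolded pp]] ms
    by (simp only: pp Sym_compo length_concat arity_def[symmetric] fst_conv)
  show ?thesis
  proof (cases "compo (Sym P) pp qs")
    case (Pair r \<rho>)
    then show ?thesis using unpermute_eqI[of \<rho> "ins P r" ?C] 1 2 oper
      by (simp only: Sym_simps fst_conv snd_conv arity_def mem_Collect_eq case_prod_conv)
  qed
qed


lemma Sym_assoc:
  assumes comp: "composable (Sym P) pp qs" "list_all2 (composable (Sym P)) qs rss"
  shows "compo (Sym P) (compo (Sym P) pp qs) (concat rss) = compo (Sym P) pp (map2 (compo (Sym P)) qs rss)"
proof -
  obtain p \<sigma> where pp: "pp = (p, \<sigma>)" by fastforce
  note c = Sym_composableD[OF comp(1)[unfolded pp]]
  define a where "a = (\<lambda>q :: 'o \<times> nat list. arity P (fst q))"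
  define ms where "ms = map a qs"
  define bs where "bs = blocks ms [0..<sum_list ms]"
  define kss where "kss = map (map a) rss"
  define B where "B = blocks (concat kss) [0..<sum_list (concat kss)]"
  define D where "D = blocks (map sum_list kss) [0..<sum_list (concat kss)]"
  define X where "X = map2 (compo (Sym P)) qs rss"
  define L where "L = concat (map (\<lambda>i. map ((!) (bs ! i)) (snd (qs ! i))) \<sigma>)"
  have len: "length rss = length qs" using comp(2) list_all2_lengthD by metis
  have ci: "composable (Sym P) (fst (qs ! i), snd (qs ! i)) (rss ! i)" if "i < length qs" for i
    using comp(2) that by (simp add: list_all2_nthD)
  note d = Sym_composableD[OF ci]
  have \<sigma>: "i < length qs" if "i \<in> set \<sigma>" for i using that permutation_facts(2)[OF c(2)] c(3) by simp
  have \<tau>: "k < length (rss ! i)" if "i < length qs" "k \<in> set (snd (qs ! i))" for i k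
    using that permutation_facts(2)[OF d(2)] d(3) by auto
  have ms: "ms = map length rss"
    using d(3) len by (auto intro!: nth_equalityI simp: ms_def a_def)
  have mk: "map a (concat rss) = concat kss" by (simp add: kss_def map_concat)
  have R: "concat rss ! (bs ! i ! k) = rss ! i ! k" if "i < length qs" "k < length (rss ! i)" for i k
  proof -
    have "map ((!) (concat rss)) (bs ! i) = rss ! i"
      unfolding bs_def by (rule map_nth_concat_block) (use that len ms in auto)
    moreover have "length (bs ! i) = length (rss ! i)"
      using that len by (simp add: bs_def length_nth_blocks ms)
    ultimately show ?thesis using that by (metis nth_map)
  qed
  have X: "X ! i = (compo P (fst (qs ! i)) (map (\<lambda>k. fst (rss ! i ! k)) (snd (qs ! i))),
     concat (map (\<lambda>k. map ((!) (blocks (kss ! i) [0..<sum_list (kss ! i)] ! k)) (snd (rss ! i ! k))) (snd (qs ! i))))"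
    if "i < length qs" for i
    using that len Sym_compo[of P "fst (qs ! i)" "snd (qs ! i)" "rss ! i"]
    by (simp add: X_def kss_def a_def[abs_def])
  have aX: "map a X = map sum_list kss"
  proof (rule nth_equalityI)
    show l: "length (map a X) = length (map sum_list kss)" using len by (simp add: X_def kss_def)
    fix i assume "i < length (map a X)"
    then have i: "i < length qs" by (simp add: X_def)
    have "a (X ! i) = sum_list (map a (rss ! i))"
      using Sym_arity_compo[OF ci[OF i]] by (simp add: X[OF i] a_def[abs_def])
    then show "map a X ! i = map sum_list kss ! i" using i len by (simp add: X_def kss_def)
  qed
  have sa: "sum_list (map sum_list kss) = sum_list (concat kss)" by (simp add: sum_list_concat')
  have lhs0: "compo (Sym P) pp qs = (compo P p (map (\<lambda>i. fst (qs ! i)) \<sigma>), L)"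
    by (simp add: pp Sym_compo L_def bs_def ms_def a_def[abs_def])
  have lhs: "compo (Sym P) (compo (Sym P) pp qs) (concat rss)
    = (compo P (compo P p (map (\<lambda>i. fst (qs ! i)) \<sigma>)) (map (\<lambda>j. fst (concat rss ! j)) L),
       concat (map (\<lambda>j. map ((!) (B ! j)) (snd (concat rss ! j))) L))"
    by (simp add: lhs0 Sym_compo B_def flip: mk) (simp add: a_def[abs_def])
  have rhs: "compo (Sym P) pp X
    = (compo P p (map (\<lambda>i. fst (X ! i)) \<sigma>), concat (map (\<lambda>i. map ((!) (D ! i)) (snd (X ! i))) \<sigma>))"
    unfolding pp Sym_compo a_def[symmetric] aX sa D_def ..
  have mapL: "map f L = concat (map (\<lambda>i. map (\<lambda>k. f (bs ! i ! k)) (snd (qs ! i))) \<sigma>)" for f :: "nat \<Rightarrow> 'z"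
    by (simp add: L_def map_concat o_def)
  have fst_eq: "compo P (compo P p (map (\<lambda>i. fst (qs ! i)) \<sigma>)) (map (\<lambda>j. fst (concat rss ! j)) L)
     = compo P p (map (\<lambda>i. fst (X ! i)) \<sigma>)"
  proof -
    define rss' where "rss' = map (\<lambda>i. map (\<lambda>k. fst (rss ! i ! k)) (snd (qs ! i))) \<sigma>"
    have 1: "map (\<lambda>j. fst (concat rss ! j)) L = concat rss'"
      unfolding mapL rss'_def
      by (intro arg_cong[of _ _ concat] map_cong refl) (simp add: R \<sigma> \<tau>)
    have 2: "list_all2 (composable P) (map (\<lambda>i. fst (qs ! i)) \<sigma>) rss'"
      unfolding rss'_def list_all2_map1 list_all2_map2 using d(6) \<sigma> by (auto simp: list_all2_same)
    have 3: "map2 (compo P) (map (\<lambda>i. fst (qs ! i)) \<sigma>) rss' = map (\<lambda>i. fst (X ! i)) \<sigma>"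
      unfolding rss'_def map2_map_map by (intro map_cong refl) (simp add: X \<sigma>)
    show ?thesis unfolding 1 compo_assoc[OF c(6) 2] 3 ..
  qed
  have snd_eq: "concat (map (\<lambda>j. map ((!) (B ! j)) (snd (concat rss ! j))) L)
     = concat (map (\<lambda>i. map ((!) (D ! i)) (snd (X ! i))) \<sigma>)"
  proof -
    have "concat (map (\<lambda>k. map ((!) (B ! (bs ! i ! k))) (snd (concat rss ! (bs ! i ! k)))) (snd (qs ! i)))
        = map ((!) (D ! i)) (snd (X ! i))" if i: "i < length qs" for i
    proof -
      have "map ((!) (B ! (bs ! i ! k))) (snd (concat rss ! (bs ! i ! k)))
        = map ((!) (D ! i)) (map ((!) (blocks (kss ! i) [0..<sum_list (kss ! i)] ! k)) (snd (rss ! i ! k)))"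
        if k: "k \<in> set (snd (qs ! i))" for k
      proof -
        have k': "k < length (rss ! i)" using \<tau>[OF i k] .
        have e: "map ((!) (D ! i)) (blocks (kss ! i) [0..<sum_list (kss ! i)] ! k) = B ! (bs ! i ! k)"
          unfolding D_def B_def bs_def
          by (rule nested_blocks) (use i k' len in \<open>simp_all add: kss_def ms o_def\<close>)
        have l: "length (blocks (kss ! i) [0..<sum_list (kss ! i)] ! k) = a (rss ! i ! k)"
          using i k' len by (simp add: length_nth_blocks kss_def)
        have "B ! (bs ! i ! k) ! l = D ! i ! (blocks (kss ! i) [0..<sum_list (kss ! i)] ! k ! l)"
          if "l \<in> set (snd (rss ! i ! k))" for l
        proof -
          have "l < a (rss ! i ! k)"
            using that permutation_facts(2)[OF d(5)[OF i k']] by (simp add: a_def)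
          then show ?thesis using e l by (metis nth_map)
        qed
        then show ?thesis by (simp add: R[OF i k'])
      qed
      then show ?thesis by (simp add: X[OF i] map_concat o_def cong: map_cong)
    qed
    then have "map (\<lambda>i. concat (map (\<lambda>k. map ((!) (B ! (bs ! i ! k))) (snd (concat rss ! (bs ! i ! k)))) (snd (qs ! i)))) \<sigma>
        = map (\<lambda>i. map ((!) (D ! i)) (snd (X ! i))) \<sigma>"
      using \<sigma> by (intro map_cong refl) blast
    moreover have "concat (map (\<lambda>j. map ((!) (B ! j)) (snd (concat rss ! j))) L)
      = concat (map (\<lambda>i. concat (map (\<lambda>k. map ((!) (B ! (bs ! i ! k))) (snd (concat rss ! (bs ! i ! k)))) (snd (qs ! i)))) \<sigma>)"
      unfolding mapL by (induction \<sigma>) simp_all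
    ultimately show ?thesis by (simp only:)
  qed
  show ?thesis unfolding lhs rhs[unfolded X_def] using fst_eq snd_eq by (simp only: X_def)
qed


lemma Sym_act_left:
  assumes pp: "pp \<in> opers (Sym P)" and \<sigma>: "\<sigma> \<in> permutations_of_set {..<arity (Sym P) pp}"
    and comp: "composable (Sym P) (act (Sym P) pp \<sigma>) qs"
    and bs: "bs = blocks (map (arity (Sym P)) qs) [0..<sum_list (map (arity (Sym P)) qs)]"
  shows "compo (Sym P) (act (Sym P) pp \<sigma>) qs
    = act (Sym P) (compo (Sym P) pp (map ((!) qs) \<sigma>)) (concat (map ((!) bs) \<sigma>))"
proof -
  obtain p \<sigma>0 where eq: "pp = (p, \<sigma>0)" by fastforce
  define a where "a = (\<lambda>q :: 'o \<times> nat list. arity P (fst q))"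
  note c = Sym_composableD[OF comp[unfolded eq Sym_simps]]
  have \<sigma>0: "\<sigma>0 \<in> permutations_of_set {..<arity P p}" using pp eq by simp
  have \<sigma>: "\<sigma> \<in> permutations_of_set {..<arity P p}" using \<sigma> eq by simp
  have \<sigma>0': "i < length \<sigma>" if "i \<in> set \<sigma>0" for i
    using that permutation_facts(2)[OF \<sigma>0] permutation_facts(1)[OF \<sigma>] by simp
  have \<sigma>': "i < length qs" if "i \<in> set \<sigma>" for i
    using that permutation_facts(2)[OF \<sigma>] c(3) by simp
  have bs: "bs = blocks (map a qs) [0..<sum_list (map a qs)]" by (simp add: bs a_def[abs_def])
  have lbs: "length bs = length qs" by (simp add: bs)
  define cs where "cs = blocks (map a (map ((!) qs) \<sigma>)) [0..<sum_list (map a (map ((!) qs) \<sigma>))]"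
  have cs: "concat (map ((!) bs) \<sigma>) ! (cs ! k ! j) = bs ! (\<sigma> ! k) ! j"
    if k: "k < length \<sigma>" and j: "j \<in> set (snd (qs ! (\<sigma> ! k)))" for k j
  proof -
    have *: "\<sigma> ! k < length qs" using \<sigma>' k by simp
    have ms: "map a (map ((!) qs) \<sigma>) = map length (map ((!) bs) \<sigma>)"
      using \<sigma>' by (simp add: bs length_nth_blocks)
    have "map ((!) (concat (map ((!) bs) \<sigma>))) (cs ! k) = map ((!) bs) \<sigma> ! k"
      unfolding cs_def by (rule map_nth_concat_block[OF _ ms refl]) (use k in simp)
    moreover have "length (cs ! k) = a (qs ! (\<sigma> ! k))"
      using k by (simp add: cs_def length_nth_blocks)
    moreover have "j < a (qs ! (\<sigma> ! k))"
      using j permutation_facts(2)[OF c(5)[OF *]] by (simp add: a_def)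
    ultimately show ?thesis using k by (metis nth_map)
  qed
  have "map (\<lambda>i. fst (qs ! i)) (map ((!) \<sigma>) \<sigma>0) = map (\<lambda>i. fst (map ((!) qs) \<sigma> ! i)) \<sigma>0"
    using \<sigma>0' by simp
  moreover have "concat (map (\<lambda>i. map ((!) (bs ! i)) (snd (qs ! i))) (map ((!) \<sigma>) \<sigma>0))
     = map ((!) (concat (map ((!) bs) \<sigma>))) (concat (map (\<lambda>i. map ((!) (cs ! i)) (snd (map ((!) qs) \<sigma> ! i))) \<sigma>0))"
    unfolding map_concat map_map
    by (intro arg_cong[of _ _ concat] map_cong refl) (simp add: \<sigma>0' cs)
  ultimately show ?thesis
    by (simp only: eq Sym_simps Sym_compo bs cs_def a_def)
qed

lemma Sym_act_right:
  assumes comp: "composable (Sym P) pp qs"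
    and \<tau>s: "list_all2 (\<lambda>q \<tau>. \<tau> \<in> permutations_of_set {..<arity (Sym P) q}) qs \<tau>s"
    and bs: "bs = blocks (map (arity (Sym P)) qs) [0..<sum_list (map (arity (Sym P)) qs)]"
  shows "compo (Sym P) pp (map2 (act (Sym P)) qs \<tau>s)
    = act (Sym P) (compo (Sym P) pp qs) (concat (map2 (\<lambda>b \<tau>. map ((!) b) \<tau>) bs \<tau>s))"
proof -
  obtain p \<sigma> where eq: "pp = (p, \<sigma>)" by fastforce
  define a where "a = (\<lambda>q :: 'o \<times> nat list. arity P (fst q))"
  note c = Sym_composableD[OF comp[unfolded eq]]
  define qs' where "qs' = map2 (act (Sym P)) qs \<tau>s"
  have len: "length \<tau>s = length qs" using \<tau>s list_all2_lengthD by metis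
  have \<sigma>: "i < length qs" if "i \<in> set \<sigma>" for i
    using that permutation_facts(2)[OF c(2)] c(3) by simp
  have \<tau>: "\<tau>s ! i \<in> permutations_of_set {..<a (qs ! i)}" if "i < length qs" for i
    using list_all2_nthD[OF \<tau>s that] by (simp add: a_def)
  have qs': "qs' ! i = (fst (qs ! i), map ((!) (\<tau>s ! i)) (snd (qs ! i)))" if "i < length qs" for i
    using that len by (cases "qs ! i") (simp add: qs'_def)
  have a': "map a qs' = map a qs"
    using len by (intro nth_equalityI) (simp_all add: qs' a_def, simp_all add: qs'_def)
  have bs: "bs = blocks (map a qs) [0..<sum_list (map a qs)]" by (simp add: bs a_def[abs_def])
  define cs where "cs = map2 (\<lambda>b \<tau>. map ((!) b) \<tau>) bs \<tau>s"
  have ms: "map a qs = map length cs"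
    using len permutation_facts(1)[OF \<tau>] by (auto intro!: nth_equalityI simp: cs_def bs)
  have cs: "concat cs ! (bs ! i ! k) = bs ! i ! (\<tau>s ! i ! k)"
    if i: "i < length qs" and k: "k \<in> set (snd (qs ! i))" for i k
  proof -
    have l: "length cs = length qs" using len by (simp add: cs_def bs)
    have "map ((!) (concat cs)) (bs ! i) = cs ! i"
      unfolding bs by (rule map_nth_concat_block[OF _ ms refl]) (use i l in simp)
    moreover have "length (bs ! i) = a (qs ! i)" using i by (simp add: bs length_nth_blocks)
    moreover have "k < a (qs ! i)" using k permutation_facts(2)[OF c(5)[OF i]] by (simp add: a_def)
    moreover have "cs ! i = map ((!) (bs ! i)) (\<tau>s ! i)" using i len by (simp add: cs_def bs)
    moreover have "length (\<tau>s ! i) = a (qs ! i)" using permutation_facts(1)[OF \<tau>[OF i]] .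
    ultimately show ?thesis by (metis nth_map)
  qed
  have "map (\<lambda>i. fst (qs' ! i)) \<sigma> = map (\<lambda>i. fst (qs ! i)) \<sigma>"
    using \<sigma> by (simp add: qs')
  moreover have "concat (map (\<lambda>i. map ((!) (bs ! i)) (snd (qs' ! i))) \<sigma>)
     = map ((!) (concat cs)) (concat (map (\<lambda>i. map ((!) (bs ! i)) (snd (qs ! i))) \<sigma>))"
    unfolding map_concat map_map
    by (intro arg_cong[of _ _ concat] map_cong refl) (simp add: \<sigma> qs' cs)
  ultimately show ?thesis
    unfolding eq Sym_simps Sym_compo qs'_def[symmetric] cs_def[symmetric] a_def[symmetric] a' bs[symmetric]
    by (simp only: Sym_simps)
qed

lemma symmetric_operad_Sym: "symmetric_operad (Sym P)"
proof
  fix pp assume pp: "pp \<in> opers (Sym P)"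
  obtain p \<sigma> where eq: "pp = (p, \<sigma>)" by fastforce
  have p: "p \<in> opers P" and \<sigma>: "\<sigma> \<in> permutations_of_set {..<length (ins P p)}"
    using pp eq by (auto simp: arity_def)
  note f = permutation_facts[OF \<sigma>]
  have id: "map ((!) [0..<length (ins P p)]) \<sigma> = \<sigma>"
    by (rule map_idI) (simp add: f(2))
  have "set (ins (Sym P) pp) = set (ins P p)"
    using mset_map_nth_permutation[of \<sigma> "unpermute \<sigma> (ins P p)"] map_nth_unpermute[OF \<sigma>] \<sigma>
    by (metis Sym_simps(3) eq length_unpermute mset_eq_setD)
  then show "set (ins (Sym P) pp) \<subseteq> colours (Sym P)" using ins_colours[OF p] by simp
  show "outc (Sym P) pp \<in> colours (Sym P)" using outc_colours[OF p] eq by simp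
  show "compo (Sym P) (ident (Sym P) (outc (Sym P) pp)) [pp] = pp"
    by (simp add: eq Sym_compo arity_def compo_ident_left[OF p] id)
  show "act (Sym P) pp [0..<arity (Sym P) pp] = pp"
    by (simp add: eq arity_def id)
  show "compo (Sym P) pp (map (ident (Sym P)) (ins (Sym P) pp)) = pp"
  proof -
    let ?xs = "unpermute \<sigma> (ins P p)"
    have "set ?xs \<subseteq> colours P" using \<open>set (ins (Sym P) pp) = _\<close> ins_colours[OF p] eq by simp
    then have ar: "map (\<lambda>q. arity P (fst q)) (map (ident (Sym P)) ?xs) = map (\<lambda>_. Suc 0) ?xs"
      by (auto simp: arity_def ins_ident)
    have s: "sum_list (map (\<lambda>_. Suc 0) ?xs) = length (ins P p)" by (simp add: sum_list_triv)
    have b: "blocks (map (\<lambda>_. Suc 0) ?xs) [0..<length (ins P p)] = map (\<lambda>i. [i]) [0..<length (ins P p)]"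
      using blocks_ones[of ?xs 0] by simp
    have "map (\<lambda>i. fst (map (ident (Sym P)) ?xs ! i)) \<sigma> = map (ident P) (map ((!) ?xs) \<sigma>)"
      using f by simp
    moreover have "map (\<lambda>i. map ((!) (map (\<lambda>i. [i]) [0..<length (ins P p)] ! i))
        (snd (map (ident (Sym P)) ?xs ! i))) \<sigma> = map (\<lambda>i. [i]) \<sigma>"
      using f by simp
    moreover have "concat (map (\<lambda>i. [i]) \<sigma>) = \<sigma>" by (induction \<sigma>) simp_all
    ultimately show ?thesis
      unfolding eq Sym_simps Sym_compo ar s b map_nth_unpermute[OF \<sigma>]
      by (simp only: compo_ident_right[OF p])
  qed
  fix \<tau> assume "\<tau> \<in> permutations_of_set {..<arity (Sym P) pp}"
  then have \<tau>: "\<tau> \<in> permutations_of_set {..<length (ins P p)}" by (simp add: eq arity_def)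
  then have \<tau>\<sigma>: "map ((!) \<tau>) \<sigma> \<in> permutations_of_set {..<length (ins P p)}"
    using map_nth_permutation[OF \<sigma>] by simp
  then show "act (Sym P) pp \<tau> \<in> opers (Sym P)" using p eq by (simp add: arity_def)
  show "outc (Sym P) (act (Sym P) pp \<tau>) = outc (Sym P) pp" by (simp add: eq)
  have "map ((!) (unpermute \<tau> (unpermute \<sigma> (ins P p)))) (map ((!) \<tau>) \<sigma>)
     = map ((!) (map ((!) (unpermute \<tau> (unpermute \<sigma> (ins P p)))) \<tau>)) \<sigma>"
    using f permutation_facts[OF \<tau>] by simp
  also have "\<dots> = ins P p"
    using \<sigma> \<tau> by (simp add: map_nth_unpermute)
  finally show "ins (Sym P) (act (Sym P) pp \<tau>) = unpermute \<tau> (ins (Sym P) pp)"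
    unfolding eq Sym_simps by (intro unpermute_eqI[OF \<tau>\<sigma>]) simp_all
  fix \<rho> assume "\<rho> \<in> permutations_of_set {..<arity (Sym P) pp}"
  show "act (Sym P) (act (Sym P) pp \<tau>) \<rho> = act (Sym P) pp (map ((!) \<rho>) \<tau>)"
    using f permutation_facts[OF \<tau>] by (simp add: eq)
next
  fix c assume "c \<in> colours (Sym P)"
  then have c: "c \<in> colours P" by simp
  show "ident (Sym P) c \<in> opers (Sym P)" "outc (Sym P) (ident (Sym P) c) = c"
    using c by (simp_all add: ident_oper outc_ident arity_def ins_ident mem_permutations_lessThan_iff)
  show "ins (Sym P) (ident (Sym P) c) = [c]"
    using c by (simp add: ins_ident unpermute_def)
next
  fix pp qs assume "composable (Sym P) pp qs"
  then show "outc (Sym P) (compo (Sym P) pp qs) = outc (Sym P) pp"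
    using outc_compo[OF Sym_composableD(6)] by (cases pp) (simp add: Sym_compo)
qed (fact Sym_compo_oper Sym_ins_compo Sym_assoc Sym_act_left Sym_act_right)+


lemma operad_morphism_Sym_unit: "operad_morphism P (Sym P) id (Sym_unit P)"
proof -
  have ins: "ins (Sym P) (Sym_unit P p) = ins P p" for p
    by (simp add: Sym_unit_def, rule unpermute_eqI)
       (simp_all add: arity_def mem_permutations_lessThan_iff map_nth)
  have "Sym_unit P (compo P p qs) = compo (Sym P) (Sym_unit P p) (map (Sym_unit P) qs)"
    if c: "composable P p qs" for p qs
  proof -
    have l: "arity P p = length qs" using c by (simp add: composable_def arity_def) (metis length_map)
    have "map (\<lambda>i. fst (map (Sym_unit P) qs ! i)) [0..<length qs] = qs"
      by (rule nth_equalityI) (simp_all add: Sym_unit_def)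
    moreover have "concat (map (\<lambda>i. map ((!) (blocks ms [0..<sum_list ms] ! i)) (snd (map (Sym_unit P) qs ! i))) [0..<length qs])
       = [0..<sum_list ms]" if ms: "ms = map (arity P) qs" for ms
    proof -
      have "map (\<lambda>i. map ((!) (blocks ms [0..<sum_list ms] ! i)) (snd (map (Sym_unit P) qs ! i))) [0..<length qs]
         = blocks ms [0..<sum_list ms]"
      proof (rule nth_equalityI)
        fix i assume "i < length (map (\<lambda>i. map ((!) (blocks ms [0..<sum_list ms] ! i)) (snd (map (Sym_unit P) qs ! i))) [0..<length qs])"
        then have i: "i < length qs" by simp
        then have "length (blocks ms [0..<sum_list ms] ! i) = arity P (qs ! i)"
          by (simp add: length_nth_blocks ms)
        then show "map (\<lambda>i. map ((!) (blocks ms [0..<sum_list ms] ! i)) (snd (map (Sym_unit P) qs ! i))) [0..<length qs] ! i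
            = blocks ms [0..<sum_list ms] ! i"
          using i map_nth[of "blocks ms [0..<sum_list ms] ! i"] by (simp add: Sym_unit_def)
      qed (simp add: ms)
      then show ?thesis by (simp add: concat_blocks)
    qed
    moreover have "map (\<lambda>q. arity P (fst q)) (map (Sym_unit P) qs) = map (arity P) qs"
      by (simp add: Sym_unit_def)
    moreover have "arity P (compo P p qs) = sum_list (map (arity P) qs)"
      by (simp add: arity_def[abs_def] ins_compo[OF c] length_concat o_def)
    ultimately show ?thesis
      unfolding Sym_unit_def[of _ p] Sym_compo l by (simp only: Sym_unit_def)
  qed
  then show ?thesis
    by (auto simp: operad_morphism_def ins)
       (auto simp: Sym_unit_def mem_permutations_lessThan_iff arity_def ins_ident)
qed

text \<open>\<open>Sym\<close> is left adjoint to the forgetful functor, with unit \<open>Sym_unit\<close>.\<close>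

lemma Sym_universal:
  fixes R :: "('d, 'p) sym_operad"
  assumes R: "symmetric_operad R" and f: "operad_morphism P R fc fo"
  shows "\<exists>h. sym_operad_morphism (Sym P) R fc h \<and> (\<forall>p \<in> opers P. h (Sym_unit P p) = fo p) \<and>
    (\<forall>h'. sym_operad_morphism (Sym P) R fc h' \<and> (\<forall>p \<in> opers P. h' (Sym_unit P p) = fo p)
       \<longrightarrow> (\<forall>q \<in> opers (Sym P). h' q = h q))"
proof -
  interpret R: symmetric_operad R by (rule R)
  define h where "h = (\<lambda>(p, \<sigma>). act R (fo p) \<sigma>)"
  have fop: "fo p \<in> opers R" and fins: "ins R (fo p) = map fc (ins P p)"
    and fout: "outc R (fo p) = fc (outc P p)" if "p \<in> opers P" for p
    using f that by (simp_all add: operad_morphism_def)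
  have far: "arity R (fo p) = arity P p" if "p \<in> opers P" for p
    using fins[OF that] by (simp add: arity_def)
  have fcol: "fc c \<in> colours R" if "c \<in> colours P" for c
    using f that by (auto simp: operad_morphism_def)
  have fid: "fo (ident P c) = ident R (fc c)" if "c \<in> colours P" for c
    using f that by (simp add: operad_morphism_def)
  have fcomp: "fo (compo P p qs) = compo R (fo p) (map fo qs)" if "composable P p qs" for p qs
    using f that by (simp add: operad_morphism_def)
  have hop: "h q \<in> opers R" and hins: "ins R (h q) = map fc (ins (Sym P) q)"
    and hout: "outc R (h q) = fc (outc (Sym P) q)"
    and hact: "\<tau> \<in> permutations_of_set {..<arity (Sym P) q} \<Longrightarrow> h (act (Sym P) q \<tau>) = act R (h q) \<tau>"
    if "q \<in> opers (Sym P)" for q \<tau>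
  proof -
    obtain p \<sigma> where q: "q = (p, \<sigma>)" by fastforce
    have p: "p \<in> opers P" and \<sigma>: "\<sigma> \<in> permutations_of_set {..<arity P p}" using that q by auto
    show "h q \<in> opers R" "outc R (h q) = fc (outc (Sym P) q)"
      using p \<sigma> by (simp_all add: q h_def R.act_oper R.outc_act fop far fout)
    have "unpermute \<sigma> (map fc (ins P p)) = map fc (unpermute \<sigma> (ins P p))"
    proof (rule unpermute_eqI)
      have "map ((!) (map fc (unpermute \<sigma> (ins P p)))) \<sigma> = map fc (map ((!) (unpermute \<sigma> (ins P p))) \<sigma>)"
        using permutation_facts(2)[OF \<sigma>] by (simp add: arity_def)
      then show "map ((!) (map fc (unpermute \<sigma> (ins P p)))) \<sigma> = map fc (ins P p)"
        using map_nth_unpermute[of \<sigma> "ins P p"] \<sigma> by (simp only: arity_def)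
    qed (use \<sigma> in \<open>simp_all add: arity_def\<close>)
    then show "ins R (h q) = map fc (ins (Sym P) q)"
      using p \<sigma> by (simp add: q h_def R.ins_act fop far fins)
    assume "\<tau> \<in> permutations_of_set {..<arity (Sym P) q}"
    then show "h (act (Sym P) q \<tau>) = act R (h q) \<tau>"
      using p \<sigma> by (simp add: q h_def R.act_act fop far)
  qed
  have hid: "h (ident (Sym P) c) = ident R (fc c)" if "c \<in> colours P" for c
    using R.act_id[OF R.ident_oper[OF fcol[OF that]]] that
    by (simp add: h_def fid arity_def R.ins_ident fcol)
  have hcomp: "h (compo (Sym P) pp qs) = compo R (h pp) (map h qs)"
    if comp: "composable (Sym P) pp qs" for pp qs
  proof -
    obtain p \<sigma> where pp: "pp = (p, \<sigma>)" by fastforce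
    note c = Sym_composableD[OF comp[unfolded pp]]
    note \<sigma> = permutation_facts[OF c(2)]
    define qs1 where "qs1 = map ((!) qs) \<sigma>"
    define ms where "ms = map (\<lambda>q. arity P (fst q)) qs"
    define bs where "bs = blocks ms [0..<sum_list ms]"
    define C where "C = concat (map ((!) bs) \<sigma>)"
    define p1 where "p1 = Sym_unit P p"
    have p1: "p1 \<in> opers (Sym P)" "arity (Sym P) p1 = arity P p" "act (Sym P) p1 \<sigma> = pp"
      "fst p1 = p" "snd p1 = [0..<arity P p]"
      using c(1) \<sigma> map_nth[of \<sigma>] by (simp_all add: p1_def Sym_unit_def mem_permutations_lessThan_iff pp)
    have ar: "arity R (h q) = arity P (fst q)" if "q \<in> opers (Sym P)" for q
      using hins[OF that] by (cases q) (simp add: arity_def)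
    have qs: "q \<in> opers (Sym P)" if "q \<in> set qs" for q
      using comp that by (auto simp: composable_def)
    have i: "i < length qs" if "i \<in> set \<sigma>" for i using that \<sigma> c(3) by simp
    have qs1: "q \<in> opers (Sym P)" if "q \<in> set qs1" for q
      using that qs i unfolding qs1_def set_map by (metis imageE nth_mem)
    have qs1': "length qs1 = arity P p" "map fst qs1 = map (\<lambda>i. fst (qs ! i)) \<sigma>"
      using \<sigma> by (simp_all add: qs1_def)
    have comp1: "composable (Sym P) p1 qs1"
      using p1 c(6) qs1 unpermute_eqI[of "[0..<arity P p]" "ins P p" "ins P p"] map_nth[of "ins P p"]
      by (cases p1) (auto simp: composable_def mem_permutations_lessThan_iff arity_def qs1_def Sym_outc o_def)
    have left: "compo (Sym P) pp qs = act (Sym P) (compo (Sym P) p1 qs1) C"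
      using Sym_act_left[of p1 \<sigma> qs bs] p1 c(2) comp
      by (simp add: qs1_def C_def bs_def ms_def)
    have Cp: "C \<in> permutations_of_set {..<sum_list ms}"
    proof -
      have "concat (map (\<lambda>i. map ((!) (bs ! i)) (map (\<lambda>m. [0..<m]) ms ! i)) \<sigma>) \<in> permutations_of_set {..<sum_list ms}"
        using c(2,3) by (intro labels_permutation) (simp_all add: ms_def bs_def mem_permutations_lessThan_iff)
      moreover have "map ((!) (bs ! i)) (map (\<lambda>m. [0..<m]) ms ! i) = bs ! i" if "i \<in> set \<sigma>" for i
        using i[OF that] map_nth[of "bs ! i"] by (simp add: ms_def bs_def length_nth_blocks)
      ultimately show ?thesis by (simp add: C_def cong: map_cong)
    qed
    have o1: "compo (Sym P) p1 qs1 \<in> opers (Sym P)" by (rule Sym_compo_oper[OF comp1])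
    have ar1: "arity (Sym P) (compo (Sym P) p1 qs1) = sum_list ms"
    proof -
      have "fst (compo (Sym P) p1 qs1) = fst (compo (Sym P) pp qs)" by (simp add: left)
      also have "\<dots> = compo P p (map (\<lambda>i. fst (qs ! i)) \<sigma>)" by (simp add: pp Sym_compo)
      finally show ?thesis using Sym_arity_compo[OF comp[unfolded pp]] by (simp add: ms_def)
    qed
    have "h (compo (Sym P) pp qs) = act R (h (compo (Sym P) p1 qs1)) C"
      using hact[OF o1, of C] Cp ar1 left by (simp only:)
    also have "h (compo (Sym P) p1 qs1) = compo R (fo p) (map h qs1)"
    proof -
      define ms1 where "ms1 = map (\<lambda>q. arity P (fst q)) qs1"
      define bs1 where "bs1 = blocks ms1 [0..<sum_list ms1]"
      have e1: "map (\<lambda>i. fst (qs1 ! i)) [0..<arity P p] = map fst qs1"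
        using qs1'(1) by (intro nth_equalityI) simp_all
      have e2: "map (\<lambda>i. map ((!) (bs1 ! i)) (snd (qs1 ! i))) [0..<arity P p] = map2 (\<lambda>b \<tau>. map ((!) b) \<tau>) bs1 (map snd qs1)"
        using qs1'(1) by (intro nth_equalityI) (simp_all add: bs1_def ms1_def)
      have e3: "map h qs1 = map2 (act R) (map (\<lambda>q. fo (fst q)) qs1) (map snd qs1)"
        by (simp add: h_def case_prod_unfold zip_map_map zip_same_conv_map o_def)
      have ps: "fst q \<in> opers P" "snd q \<in> permutations_of_set {..<arity P (fst q)}" if "q \<in> set qs1" for q
        using qs1[OF that] by auto
      have ar': "map (arity R) (map (\<lambda>q. fo (fst q)) qs1) = ms1"
        using ps by (simp add: ms1_def far)
      have comp2: "composable P p (map fst qs1)" using c(6) qs1'(2) by simp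
      then have comp3: "composable R (fo p) (map (\<lambda>q. fo (fst q)) qs1)"
      proof -
        have "map (outc R) (map (\<lambda>q. fo (fst q)) qs1) = map fc (map (outc P) (map fst qs1))"
          using ps by (simp add: fout)
        also have "\<dots> = ins R (fo p)" using comp2 c(1) by (simp only: composable_def fins)
        finally show ?thesis using ps c(1) by (auto simp: composable_def fop)
      qed
      have "compo R (fo p) (map h qs1) = act R (compo R (fo p) (map (\<lambda>q. fo (fst q)) qs1)) (concat (map2 (\<lambda>b \<tau>. map ((!) b) \<tau>) bs1 (map snd qs1)))"
        unfolding e3 using ps
        by (intro R.compo_act_right[OF comp3])
           (simp_all only: ar' bs1_def, simp add: list_all2_map1 list_all2_map2 list_all2_same far)
      also have "compo R (fo p) (map (\<lambda>q. fo (fst q)) qs1) = fo (compo P p (map fst qs1))"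
        using fcomp[OF comp2] by (simp add: o_def)
      also have "compo (Sym P) p1 qs1 = (compo P p (map fst qs1), concat (map2 (\<lambda>b \<tau>. map ((!) b) \<tau>) bs1 (map snd qs1)))"
        unfolding p1_def Sym_unit_def Sym_compo e1 using e2 by (simp only: ms1_def bs1_def)
      ultimately show ?thesis by (simp add: h_def)
    qed
    also have "act R (compo R (fo p) (map h qs1)) C = compo R (act R (fo p) \<sigma>) (map h qs)"
    proof -
      have "composable R (act R (fo p) \<sigma>) (map h qs)"
      proof -
        have "map (outc R) (map h qs) = map fc (map (outc (Sym P)) qs)"
          using qs hout by simp
        also have "\<dots> = ins R (h pp)" using comp hins[of pp] by (simp only: composable_def)
        finally show ?thesis using comp hop[of pp] qs hop
          by (auto simp only: composable_def pp h_def case_prod_conv set_map)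
      qed
      moreover have "map (arity R) (map h qs) = ms" using qs ar by (simp add: ms_def)
      ultimately have "compo R (act R (fo p) \<sigma>) (map h qs) = act R (compo R (fo p) (map ((!) (map h qs)) \<sigma>)) C"
        unfolding C_def using c(1,2) by (intro R.compo_act_left) (simp_all only: fop far bs_def)
      moreover have "map ((!) (map h qs)) \<sigma> = map h qs1" using i by (simp add: qs1_def)
      ultimately show ?thesis by simp
    qed
    finally show ?thesis by (simp add: pp h_def)
  qed
  have "h (Sym_unit P p) = fo p" if "p \<in> opers P" for p
    using R.act_id[OF fop[OF that]] that by (simp add: h_def Sym_unit_def far)
  moreover have "sym_operad_morphism (Sym P) R fc h"
    unfolding sym_operad_morphism_def operad_morphism_def
    using fcol hop hins hout hid hcomp hact by (auto simp del: Sym_simps(2-6)) 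
  moreover have "h' q = h q"
    if h': "sym_operad_morphism (Sym P) R fc h'" "\<forall>p \<in> opers P. h' (Sym_unit P p) = fo p"
      and q: "q \<in> opers (Sym P)" for h' q
  proof -
    obtain p \<sigma> where eq: "q = (p, \<sigma>)" by fastforce
    have p: "p \<in> opers P" and \<sigma>: "\<sigma> \<in> permutations_of_set {..<arity P p}" using q eq by auto
    have "q = act (Sym P) (Sym_unit P p) \<sigma>"
      using map_nth[of \<sigma>] permutation_facts(1)[OF \<sigma>] by (simp add: eq Sym_unit_def)
    moreover have "Sym_unit P p \<in> opers (Sym P)"
      using p by (simp add: Sym_unit_def mem_permutations_lessThan_iff)
    moreover have "arity (Sym P) (Sym_unit P p) = arity P p" by (simp add: Sym_unit_def)
    ultimately have "h' q = act R (h' (Sym_unit P p)) \<sigma>"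
      using h'(1) \<sigma> unfolding sym_operad_morphism_def by metis
    then show ?thesis using h'(2) p by (simp add: eq h_def)
  qed
  ultimately show ?thesis by blast
qed

end

end

theory Submission
  imports Defs
begin

text \<open>
  An arrow of \<open>Tw_sOp (Sym P)\<close> is a planar tree with two levels, built from operations of \<open>P\<close>, whose
  leaves carry numbers, stored in a normal form: the inputs of each vertex are permuted so that
  their numbers increase. Forgetting the numbers sends \<open>(p, \<sigma>)\<close> to \<open>p\<close> and an arrow to an arrow of
  \<open>Tw_pOp P\<close>, and this assignment \<open>G\<close> (\<open>forget_labels\<close> on arrows) goes in the direction opposite to
  the comparison functor \<open>F\<close>. Three facts make \<open>F\<close> an equivalence.

  \<^item> The numbers of the leaves, read from left to right, are the permutation that belongs to the
    target (\<open>sTw_cod_Sym\<close>). Hence source, target and underlying planar tree determine an arrow: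
    the target gives the number of every leaf, and the normal form of a vertex can be recovered from
    the numbers at its inputs (\<open>forget_labels_faithful\<close>).
  \<^item> For two numberings \<open>\<sigma>\<close> and \<open>\<tau>\<close> of the same operation \<open>p\<close> there is an arrow from \<open>(p, \<sigma>)\<close> to
    \<open>(p, \<tau>)\<close> over the identity of \<open>p\<close>, which renumbers the inputs (\<open>relabelling\<close>).
  \<^item> \<open>G\<close> is compatible with composition (\<open>forget_labels_cmp\<close>), and \<open>F\<close> is a section of it
    (\<open>Tw_Sym_arrow_props\<close>).

  By the first fact every equation between parallel arrows of \<open>Tw_sOp (Sym P)\<close> can be tested after applying
  \<open>G\<close>. In this way the category axioms, functoriality of \<open>F\<close>, and naturality and invertibility of the
  renumbering arrows all reduce to the planar case; the locales \<open>arrow_lift\<close> and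
  \<open>arrow_lift_section\<close> carry out this reduction. The category axioms of \<open>Tw_pOp P\<close> are
  consequences of associativity of total composition in \<open>P\<close>.

  For \<open>uAs_pl\<close>, an arrow \<open>(q, i; q\<^sub>1, \<dots>, q\<^sub>n)\<close> is a list of numbers, and it encodes the monotone map
  that sends \<open>k\<close> to \<open>i + q\<^sub>1 + \<dots> + q\<^sub>k\<close> (\<open>gap_map\<close>).
\<close>


section \<open>Lifting a category structure along a fully faithful map\<close>

text \<open>
  By itself, \<open>D\<close> is only a graph with identities and composites of the right type. The axioms of a
  category follow in \<open>D\<close> because an arrow is determined by its ends and its image in \<open>C\<close>.
\<close>

locale arrow_lift = base: category C for C :: "('a, 'm) cat" +
  fixes D :: "('b, 'n) cat" and Go :: "'b \<Rightarrow> 'a" and Gm :: "'n \<Rightarrow> 'm"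
  assumes D_dom_ob: "f \<in> Ar D \<Longrightarrow> Dom D f \<in> Ob D"
    and D_cod_ob: "f \<in> Ar D \<Longrightarrow> Cod D f \<in> Ob D"
    and D_idt_ar: "x \<in> Ob D \<Longrightarrow> Idt D x \<in> Ar D"
    and D_dom_idt: "x \<in> Ob D \<Longrightarrow> Dom D (Idt D x) = x"
    and D_cod_idt: "x \<in> Ob D \<Longrightarrow> Cod D (Idt D x) = x"
    and D_cmp_ar: "\<lbrakk>f \<in> Ar D; g \<in> Ar D; Dom D g = Cod D f\<rbrakk> \<Longrightarrow> Cmp D g f \<in> Ar D"
    and D_dom_cmp: "\<lbrakk>f \<in> Ar D; g \<in> Ar D; Dom D g = Cod D f\<rbrakk> \<Longrightarrow> Dom D (Cmp D g f) = Dom D f"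
    and D_cod_cmp: "\<lbrakk>f \<in> Ar D; g \<in> Ar D; Dom D g = Cod D f\<rbrakk> \<Longrightarrow> Cod D (Cmp D g f) = Cod D g"
    and G_ob: "x \<in> Ob D \<Longrightarrow> Go x \<in> Ob C"
    and G_ar: "f \<in> Ar D \<Longrightarrow> Gm f \<in> Ar C"
    and G_dom: "f \<in> Ar D \<Longrightarrow> Dom C (Gm f) = Go (Dom D f)"
    and G_cod: "f \<in> Ar D \<Longrightarrow> Cod C (Gm f) = Go (Cod D f)"
    and G_idt: "x \<in> Ob D \<Longrightarrow> Gm (Idt D x) = Idt C (Go x)"
    and G_cmp: "\<lbrakk>f \<in> Ar D; g \<in> Ar D; Dom D g = Cod D f\<rbrakk> \<Longrightarrow> Gm (Cmp D g f) = Cmp C (Gm g) (Gm f)"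
    and G_faithful: "\<lbrakk>f \<in> Ar D; f' \<in> Ar D; Dom D f = Dom D f'; Cod D f = Cod D f'; Gm f = Gm f'\<rbrakk> \<Longrightarrow> f = f'"
    and vertical: "\<lbrakk>x \<in> Ob D; y \<in> Ob D; Go x = Go y\<rbrakk>
        \<Longrightarrow> \<exists>f \<in> Ar D. Dom D f = x \<and> Cod D f = y \<and> Gm f = Idt C (Go x)"
begin

lemmas D_simps = D_dom_ob D_cod_ob D_idt_ar D_dom_idt D_cod_idt D_cmp_ar D_dom_cmp D_cod_cmp
  G_ob G_ar G_dom G_cod G_idt G_cmp

lemma category_D: "category D"
proof
  fix f assume f: "f \<in> Ar D"
  show "Cmp D f (Idt D (Dom D f)) = f"
    by (rule G_faithful) (use f base.cmp_idt_right[of "Gm f"] in \<open>simp_all add: D_simps\<close>)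
  show "Cmp D (Idt D (Cod D f)) f = f"
    by (rule G_faithful) (use f base.cmp_idt_left[of "Gm f"] in \<open>simp_all add: D_simps\<close>)
next
  fix f g h assume "f \<in> Ar D" "g \<in> Ar D" "h \<in> Ar D" "Dom D g = Cod D f" "Dom D h = Cod D g"
  then show "Cmp D h (Cmp D g f) = Cmp D (Cmp D h g) f"
    by (intro G_faithful) (simp_all add: D_simps base.cmp_assoc)
qed (simp_all add: D_simps)

sublocale total: category D by (rule category_D)

lemma cat_functor_G: "cat_functor D C Go Gm"
  by unfold_locales (simp_all add: D_simps)

text \<open>Two arrows over identities that run in opposite directions are inverse to each other, because
  both composites have the same image as an identity.\<close>

lemma vertical_iso_arrow:
  assumes f: "f \<in> Ar D" "Gm f = Idt C (Go (Dom D f))" and xy: "Go (Dom D f) = Go (Cod D f)"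
  shows "iso_arrow D (Dom D f) (Cod D f) f"
proof -
  obtain g where g: "g \<in> Ar D" "Dom D g = Cod D f" "Cod D g = Dom D f" "Gm g = Idt C (Go (Cod D f))"
    using vertical[of "Cod D f" "Dom D f"] f xy by (auto simp: D_simps)
  have ii: "Cmp C (Idt C (Go x)) (Idt C (Go x)) = Idt C (Go x)" if "x \<in> Ob D" for x
    using base.cmp_idt_right[of "Idt C (Go x)"] that by (simp add: base.idt_ar base.dom_idt D_simps)
  have "Cmp D g f = Idt D (Dom D f)" "Cmp D f g = Idt D (Cod D f)"
    by (rule G_faithful; use f g xy ii in \<open>simp add: D_simps\<close>)+
  then show ?thesis using f g unfolding iso_arrow_def by blast
qed

lemma idt_iso_arrow: "x \<in> Ob C \<Longrightarrow> iso_arrow C x x (Idt C x)"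
  unfolding iso_arrow_def
  by (metis base.cmp_idt_right base.cod_idt base.dom_idt base.idt_ar)

end

text \<open>A strict section \<open>F\<close> of \<open>G\<close> on objects and arrows is automatically a functor, again because
  arrows of \<open>D\<close> are detected by \<open>G\<close>. The composite \<open>F \<circ> G\<close> is then isomorphic to the identity
  through the arrows that lie over identities.\<close>

locale arrow_lift_section = arrow_lift C D Go Gm
  for C :: "('a, 'm) cat" and D :: "('b, 'n) cat" and Go :: "'b \<Rightarrow> 'a" and Gm :: "'n \<Rightarrow> 'm" +
  fixes Fo :: "'a \<Rightarrow> 'b" and Fm :: "'m \<Rightarrow> 'n"
  assumes F_ob: "x \<in> Ob C \<Longrightarrow> Fo x \<in> Ob D"
    and F_ar: "f \<in> Ar C \<Longrightarrow> Fm f \<in> Ar D"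
    and F_dom: "f \<in> Ar C \<Longrightarrow> Dom D (Fm f) = Fo (Dom C f)"
    and F_cod: "f \<in> Ar C \<Longrightarrow> Cod D (Fm f) = Fo (Cod C f)"
    and GF_ob: "x \<in> Ob C \<Longrightarrow> Go (Fo x) = x"
    and GF_ar: "f \<in> Ar C \<Longrightarrow> Gm (Fm f) = f"
begin

lemmas F_simps = F_ob F_ar F_dom F_cod GF_ob GF_ar

lemma cat_functor_F: "cat_functor C D Fo Fm"
proof unfold_locales
  fix x assume "x \<in> Ob C"
  then show "Fm (Idt C x) = Idt D (Fo x)"
    by (intro G_faithful) (simp_all add: D_simps F_simps base.idt_ar base.dom_idt base.cod_idt)
next
  fix f g assume "f \<in> Ar C" "g \<in> Ar C" "Dom C g = Cod C f"
  then show "Fm (Cmp C g f) = Cmp D (Fm g) (Fm f)"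
    by (intro G_faithful) (simp_all add: D_simps F_simps base.cmp_ar base.dom_cmp base.cod_cmp)
qed (simp_all add: F_simps)

lemma natural_iso_GF:
  "natural_iso C C id id (Go \<circ> Fo) (Gm \<circ> Fm) (Idt C)"
  "natural_iso C C (Go \<circ> Fo) (Gm \<circ> Fm) id id (Idt C)"
  by (auto simp: natural_iso_def F_simps idt_iso_arrow base.cmp_idt_left base.cmp_idt_right)

lemma natural_iso_FG:
  "\<exists>\<epsilon>. natural_iso D D (Fo \<circ> Go) (Fm \<circ> Gm) id id \<epsilon>"
  "\<exists>\<eta>. natural_iso D D id id (Fo \<circ> Go) (Fm \<circ> Gm) \<eta>"
proof -
  have "\<exists>\<epsilon>. \<forall>x \<in> Ob D. \<epsilon> x \<in> Ar D \<and> Dom D (\<epsilon> x) = Fo (Go x) \<and> Cod D (\<epsilon> x) = x \<and> Gm (\<epsilon> x) = Idt C (Go x)"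
    using vertical[of "Fo (Go x)" x for x] by (intro bchoice ballI) (auto simp: D_simps F_simps Bex_def)
  then obtain \<epsilon> where \<epsilon>: "\<And>x. x \<in> Ob D \<Longrightarrow>
      \<epsilon> x \<in> Ar D \<and> Dom D (\<epsilon> x) = Fo (Go x) \<and> Cod D (\<epsilon> x) = x \<and> Gm (\<epsilon> x) = Idt C (Go x)" by blast
  have nat: "Cmp D (\<epsilon> (Cod D f)) (Fm (Gm f)) = Cmp D f (\<epsilon> (Dom D f))" if "f \<in> Ar D" for f
    by (rule G_faithful) (use that \<epsilon> base.cmp_idt_left[of "Gm f"] base.cmp_idt_right[of "Gm f"] in
        \<open>simp_all add: D_simps F_simps\<close>)
  have iso: "iso_arrow D (Fo (Go x)) x (\<epsilon> x)" if "x \<in> Ob D" for x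
    using vertical_iso_arrow[of "\<epsilon> x"] \<epsilon>[OF that] that by (simp add: D_simps F_simps)
  show "\<exists>\<epsilon>. natural_iso D D (Fo \<circ> Go) (Fm \<circ> Gm) id id \<epsilon>"
    using iso nat by (auto simp: natural_iso_def)
  have "\<exists>\<eta>. \<forall>x \<in> Ob D. \<eta> x \<in> Ar D \<and> Dom D (\<eta> x) = x \<and> Cod D (\<eta> x) = Fo (Go x) \<and> Gm (\<eta> x) = Idt C (Go x)"
    using vertical[of x "Fo (Go x)" for x] by (intro bchoice ballI) (auto simp: D_simps F_simps Bex_def)
  then obtain \<eta> where \<eta>: "\<And>x. x \<in> Ob D \<Longrightarrow>
      \<eta> x \<in> Ar D \<and> Dom D (\<eta> x) = x \<and> Cod D (\<eta> x) = Fo (Go x) \<and> Gm (\<eta> x) = Idt C (Go x)" by blast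
  have nat: "Cmp D (\<eta> (Cod D f)) f = Cmp D (Fm (Gm f)) (\<eta> (Dom D f))" if "f \<in> Ar D" for f
    by (rule G_faithful) (use that \<eta> base.cmp_idt_left[of "Gm f"] base.cmp_idt_right[of "Gm f"] in
        \<open>simp_all add: D_simps F_simps\<close>)
  have iso: "iso_arrow D x (Fo (Go x)) (\<eta> x)" if "x \<in> Ob D" for x
    using vertical_iso_arrow[of "\<eta> x"] \<eta>[OF that] that by (simp add: D_simps F_simps)
  show "\<exists>\<eta>. natural_iso D D id id (Fo \<circ> Go) (Fm \<circ> Gm) \<eta>"
    using iso nat by (auto simp: natural_iso_def)
qed

lemma equivalence_functor_F: "equivalence_functor C D Fo Fm"
  unfolding equivalence_functor_def
  using cat_functor_F cat_functor_G natural_iso_GF natural_iso_FG by blast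

lemma equivalence_functor_G: "equivalence_functor D C Go Gm"
  unfolding equivalence_functor_def
  using cat_functor_F cat_functor_G natural_iso_GF natural_iso_FG by blast

text \<open>The data can be carried along an isomorphism of the base, since it only enters through
  equations between objects and between arrows.\<close>

lemma arrow_lift_section_compose_isomorphism:
  assumes "isomorphism_functor C C' Ho Hm"
  shows "arrow_lift_section C' D (Ho \<circ> Go) (Hm \<circ> Gm)
     (Fo \<circ> inv_into (Ob C) Ho) (Fm \<circ> inv_into (Ar C) Hm)"
proof -
  have H: "cat_functor C C' Ho Hm" and bo: "bij_betw Ho (Ob C) (Ob C')" and bm: "bij_betw Hm (Ar C) (Ar C')"
    using assms by (simp_all add: isomorphism_functor_def)
  interpret H: cat_functor C C' Ho Hm by (rule H)
  note io = bij_betw_inv_into_left[OF bo] bij_betw_inv_into_right[OF bo]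
    bij_betwE[OF bij_betw_inv_into[OF bo], rule_format]
  note im = bij_betw_inv_into_left[OF bm] bij_betw_inv_into_right[OF bm]
    bij_betwE[OF bij_betw_inv_into[OF bm], rule_format]
  have inj: "x = y" if "Ho x = Ho y" "x \<in> Ob C" "y \<in> Ob C" for x y
    using that io(1) by metis
  have injm: "x = y" if "Hm x = Hm y" "x \<in> Ar C" "y \<in> Ar C" for x y
    using that im(1) by metis
  note Hs = H.map_ob H.map_ar H.map_dom H.map_cod H.map_idt H.map_cmp
  show ?thesis
  proof unfold_locales
    fix f f' assume "f \<in> Ar D" "f' \<in> Ar D" "Dom D f = Dom D f'" "Cod D f = Cod D f'"
      "(Hm \<circ> Gm) f = (Hm \<circ> Gm) f'"
    then show "f = f'" using G_faithful[of f f'] injm[of "Gm f" "Gm f'"] by (simp add: D_simps)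
  next
    fix x y assume "x \<in> Ob D" "y \<in> Ob D" "(Ho \<circ> Go) x = (Ho \<circ> Go) y"
    then show "\<exists>f\<in>Ar D. Dom D f = x \<and> Cod D f = y \<and> (Hm \<circ> Gm) f = Idt C' ((Ho \<circ> Go) x)"
      using vertical[of x y] inj[of "Go x" "Go y"] by (fastforce simp: D_simps Hs)
  next
    fix f assume f: "f \<in> Ar C'"
    have "Dom C (inv_into (Ar C) Hm f) = inv_into (Ob C) Ho (Dom C' f)"
      "Cod C (inv_into (Ar C) Hm f) = inv_into (Ob C) Ho (Cod C' f)"
      using f im io H.map_dom H.map_cod base.dom_ob base.cod_ob by metis+
    then show "Dom D ((Fm \<circ> inv_into (Ar C) Hm) f) = (Fo \<circ> inv_into (Ob C) Ho) (Dom C' f)"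
      "Cod D ((Fm \<circ> inv_into (Ar C) Hm) f) = (Fo \<circ> inv_into (Ob C) Ho) (Cod C' f)"
      using f im by (simp_all add: F_simps)
  qed (use H.target.dom_ob H.target.cod_ob in \<open>simp_all add: D_simps F_simps io im Hs\<close>)
qed

end

section \<open>The planar twisted arrow category\<close>

lemma blocks_concat_append: "blocks (map length xss) (concat xss @ ys) = xss"
  by (induction xss) auto

lemma concat_map_singleton: "concat (map (\<lambda>x. [x]) xs) = xs"
  by (induction xs) auto

context planar_operad
begin

abbreviation idents :: "'c list \<Rightarrow> 'o list" where
  "idents \<equiv> map (ident P)"

lemma composableI:
  "\<lbrakk>p \<in> opers P; set qs \<subseteq> opers P; map (outc P) qs = ins P p\<rbrakk> \<Longrightarrow> composable P p qs"
  by (simp add: composable_def)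

lemma composableD:
  assumes "composable P p qs"
  shows "p \<in> opers P" "set qs \<subseteq> opers P" "map (outc P) qs = ins P p" "length qs = arity P p"
  using assms by (auto simp: composable_def arity_def dest: arg_cong[of _ _ length])

lemma arity_compo: "composable P p qs \<Longrightarrow> arity P (compo P p qs) = sum_list (map (arity P) qs)"
  by (simp add: arity_def[abs_def] ins_compo length_concat o_def)

lemma idents_props:
  assumes "set cs \<subseteq> colours P"
  shows "set (idents cs) \<subseteq> opers P" "map (outc P) (idents cs) = cs"
    "concat (map (ins P) (idents cs)) = cs"
  using assms by (induction cs) (auto simp: ident_oper outc_ident ins_ident)

lemma composable_idents: "p \<in> opers P \<Longrightarrow> composable P p (idents (ins P p))"
  using idents_props[OF ins_colours] by (simp add: composable_def)

lemma composable_ident: "p \<in> opers P \<Longrightarrow> composable P (ident P (outc P p)) [p]"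
  by (simp add: composable_def ident_oper outc_colours ins_ident)

lemma list_all2_composable_blocks:
  assumes "set qs \<subseteq> opers P" "set rs \<subseteq> opers P" "map (outc P) rs = concat (map (ins P) qs)"
  shows "list_all2 (composable P) qs (blocks (map (arity P) qs) rs)"
  using assms
proof (induction qs arbitrary: rs)
  case (Cons q qs)
  have "map (outc P) (take (arity P q) rs) = ins P q"
    "map (outc P) (drop (arity P q) rs) = concat (map (ins P) qs)"
    using Cons.prems(3) by (simp_all add: arity_def flip: take_map drop_map)
  then show ?case
    using Cons.prems Cons.IH[of "drop (arity P q) rs"]
    by (auto simp: composable_def dest: in_set_takeD in_set_dropD)
qed simp

lemma composable_compo:
  assumes "composable P q rs" "list_all2 (composable P) rs wss"
  shows "composable P (compo P q rs) (concat wss)" "composable P q (map2 (compo P) rs wss)"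
proof -
  have "map (outc P) (concat wss) = concat (map (ins P) rs) \<and> set (concat wss) \<subseteq> opers P"
    "map (outc P) (map2 (compo P) rs wss) = map (outc P) rs \<and> set (map2 (compo P) rs wss) \<subseteq> opers P"
    using assms(2) by (induction rule: list_all2_induct) (auto simp: composable_def outc_compo compo_oper)
  then show "composable P (compo P q rs) (concat wss)" "composable P q (map2 (compo P) rs wss)"
    using assms(1) by (simp_all add: composable_def compo_oper ins_compo)
qed

lemma list_all2_composable_lengths:
  "list_all2 (composable P) qs rss \<Longrightarrow> map length rss = map (arity P) qs"
  by (induction rule: list_all2_induct) (auto dest: composableD)

lemma map2_compo_props:
  assumes "list_all2 (composable P) qs rss"
  shows "set (map2 (compo P) qs rss) \<subseteq> opers P"
    "map (outc P) (map2 (compo P) qs rss) = map (outc P) qs"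
    "map (ins P) (map2 (compo P) qs rss) = map (\<lambda>rs. concat (map (ins P) rs)) rss"
    "map (arity P) (map2 (compo P) qs rss) = map (\<lambda>rs. sum_list (map (arity P) rs)) rss"
  using assms by (induction rule: list_all2_induct) (auto simp: compo_oper outc_compo ins_compo arity_compo)

lemma list_all2_composable_singletons:
  "set us \<subseteq> opers P \<Longrightarrow> list_all2 (composable P) (idents (map (outc P) us)) (map (\<lambda>u. [u]) us)"
  "set us \<subseteq> opers P \<Longrightarrow> map2 (compo P) (idents (map (outc P) us)) (map (\<lambda>u. [u]) us) = us"
  by (induction us) (auto simp: composable_ident compo_ident_left)

lemma list_all2_composable_idents:
  "set us \<subseteq> opers P \<Longrightarrow> list_all2 (composable P) us (map (\<lambda>u. idents (ins P u)) us)"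
  "set us \<subseteq> opers P \<Longrightarrow> map2 (compo P) us (map (\<lambda>u. idents (ins P u)) us) = us"
  by (induction us) (auto simp: composable_idents compo_ident_right)

text \<open>
  Associativity with one argument \<open>x\<close> singled out; the arguments on either side of it are usually
  identities or get identities plugged in.
\<close>

lemma compo_assoc_context:
  assumes "composable P q (as @ x # bs)" "list_all2 (composable P) as uss" "composable P x us"
    "list_all2 (composable P) bs vss"
  shows "compo P (compo P q (as @ x # bs)) (concat uss @ us @ concat vss)
    = compo P q (map2 (compo P) as uss @ compo P x us # map2 (compo P) bs vss)"
proof -
  have "list_all2 (composable P) (as @ x # bs) (uss @ us # vss)"
    using assms by (simp add: list_all2_appendI)
  from compo_assoc[OF assms(1) this] show ?thesis
    using list_all2_lengthD[OF assms(2)] by simp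
qed

lemma partial_compo_context:
  "ins P q = A @ c # B \<Longrightarrow> partial_compo P q (length A) x = compo P q (idents A @ x # idents B)"
  by (simp add: partial_compo_def list_update_append)

lemma composable_context:
  assumes "q \<in> opers P" "ins P q = A @ outc P x # B" "x \<in> opers P"
  shows "composable P q (idents A @ x # idents B)"
  using assms ins_colours[of q] idents_props[of A] idents_props[of B] by (simp add: composable_def)

lemma partial_compo_props:
  assumes "q \<in> opers P" "ins P q = A @ outc P x # B" "x \<in> opers P"
  shows "partial_compo P q (length A) x \<in> opers P"
    "ins P (partial_compo P q (length A) x) = A @ ins P x @ B"
    "outc P (partial_compo P q (length A) x) = outc P q"
  using composable_context[OF assms] assms ins_colours[of q] idents_props[of A] idents_props[of B]
  by (simp_all add: partial_compo_context[OF assms(2)] compo_oper outc_compo ins_compo)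

text \<open>
  An identity among the arguments serves as a placeholder: the lower vertex of a composite arrow
  is formed with an identity at the place of the source vertex, which is filled in afterwards.
\<close>

lemma partial_compo_ident_slot:
  assumes q: "composable P q (as @ ident P (outc P x) # bs)" and x: "x \<in> opers P"
  shows "partial_compo P (compo P q (as @ ident P (outc P x) # bs)) (sum_list (map (arity P) as)) x
    = compo P q (as @ x # bs)"
proof -
  have ab: "set as \<subseteq> opers P" "set bs \<subseteq> opers P" using composableD[OF q] by simp_all
  have i: "ins P (compo P q (as @ ident P (outc P x) # bs))
      = concat (map (ins P) as) @ outc P x # concat (map (ins P) bs)"
    by (simp add: ins_compo[OF q] ins_ident outc_colours x)
  have l: "sum_list (map (arity P) as) = length (concat (map (ins P) as))"
    by (simp add: length_concat arity_def[abs_def] o_def)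
  have e: "idents (concat (map (ins P) us)) = concat (map (\<lambda>u. idents (ins P u)) us)" for us
    by (simp add: map_concat o_def)
  have "compo P (compo P q (as @ ident P (outc P x) # bs))
      (concat (map (\<lambda>u. idents (ins P u)) as) @ [x] @ concat (map (\<lambda>u. idents (ins P u)) bs))
    = compo P q (as @ x # bs)"
    by (subst compo_assoc_context[OF q list_all2_composable_idents(1)[OF ab(1)]
          composable_ident[OF x] list_all2_composable_idents(1)[OF ab(2)]])
      (simp add: list_all2_composable_idents ab compo_ident_left x)
  then show ?thesis by (simp only: l partial_compo_context[OF i] e append.simps)
qed

lemma partial_compo_compo:
  assumes r: "r \<in> opers P" "ins P r = A @ outc P u # B" and u: "composable P u us"
    and vA: "set vA \<subseteq> opers P" "map (outc P) vA = A" and vB: "set vB \<subseteq> opers P" "map (outc P) vB = B"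
  shows "compo P (partial_compo P r (length A) u) (vA @ us @ vB) = compo P r (vA @ compo P u us # vB)"
proof -
  note c = composable_context[OF r composableD(1)[OF u], folded vA(2) vB(2)]
  show ?thesis
    unfolding partial_compo_context[OF r(2)]
    using compo_assoc_context[OF c list_all2_composable_singletons(1)[OF vA(1)] u
          list_all2_composable_singletons(1)[OF vB(1)]]
    by (simp add: concat_map_singleton
        list_all2_composable_singletons vA vB del: map_map flip: vA(2) vB(2))
qed

lemma partial_compo_partial_compo:
  assumes r: "r \<in> opers P" "ins P r = A @ outc P u # B"
    and u: "u \<in> opers P" "ins P u = A' @ outc P x # B'" and x: "x \<in> opers P"
  shows "partial_compo P (partial_compo P r (length A) u) (length A + length A') x
    = partial_compo P r (length A) (partial_compo P u (length A') x)"
proof -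
  have col: "set A \<subseteq> colours P" "set B \<subseteq> colours P" using ins_colours[OF r(1)] r(2) by auto
  have i: "ins P (partial_compo P r (length A) u) = (A @ A') @ outc P x # (B' @ B)"
    using partial_compo_props(2)[OF r u(1)] u(2) by simp
  have "partial_compo P (partial_compo P r (length A) u) (length A + length A') x
    = compo P (partial_compo P r (length A) u) (idents A @ (idents A' @ x # idents B') @ idents B)"
    using partial_compo_context[OF i] by simp
  also have "\<dots> = compo P r (idents A @ compo P u (idents A' @ x # idents B') # idents B)"
    by (rule partial_compo_compo[OF r composable_context[OF u x]]) (use col idents_props in simp_all)
  also have "\<dots> = partial_compo P r (length A) (partial_compo P u (length A') x)"
    by (simp add: partial_compo_context[OF r(2)] partial_compo_context[OF u(2)])
  finally show ?thesis .
qed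

lemma pTw_arrowsE:
  assumes "f \<in> pTw_arrows P"
  obtains p q A B qs where "f = (p, q, length A, qs)" "composable P p qs" "q \<in> opers P"
    "ins P q = A @ outc P p # B"
proof -
  obtain p q i qs where f: "f = (p, q, i, qs)" "composable P p qs" "q \<in> opers P"
    "i < length (ins P q)" "ins P q ! i = outc P p"
    using assms by (auto simp: pTw_arrows_def arity_def)
  show ?thesis
    using that[of p q "take i (ins P q)" qs "drop (Suc i) (ins P q)"] f
      id_take_nth_drop[of i "ins P q"] by (simp add: min_def)
qed

lemma pTw_arrowsI:
  "\<lbrakk>composable P p qs; q \<in> opers P; ins P q = A @ outc P p # B; i = length A\<rbrakk> \<Longrightarrow> (p, q, i, qs) \<in> pTw_arrows P"
  by (simp add: pTw_arrows_def arity_def)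

lemma pTw_cod_context:
  assumes "composable P p qs" "q \<in> opers P" "ins P q = A @ outc P p # B" "t = pTw_cod P (p, q, length A, qs)"
  shows "t \<in> opers P" "ins P t = A @ concat (map (ins P) qs) @ B" "outc P t = outc P q"
    "t = partial_compo P q (length A) (compo P p qs)"
  using partial_compo_props[of q A "compo P p qs" B] assms
  by (simp_all add: pTw_cod_def compo_oper outc_compo ins_compo)

text \<open>
  The inputs of the target of an arrow fall into those left of the source vertex, those above it,
  and those right of it; operations plugged into the target are grouped accordingly.
\<close>

lemma composable_cod_split:
  assumes "composable P t rs" "ins P t = A @ concat (map (ins P) qs) @ B" "set qs \<subseteq> opers P"
  obtains rA rss rB where "rs = rA @ concat rss @ rB" "set rA \<subseteq> opers P" "set rB \<subseteq> opers P"
    "map (outc P) rA = A" "map (outc P) rB = B" "list_all2 (composable P) qs rss"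
proof -
  note c = composableD[OF assms(1)]
  obtain rA rN where rN: "rs = rA @ rN" "map (outc P) rA = A" "map (outc P) rN = concat (map (ins P) qs) @ B"
    using c(3) unfolding assms(2) by (metis map_eq_append_conv)
  then obtain rM rB where rs: "rs = rA @ rM @ rB" "map (outc P) rA = A"
    "map (outc P) rM = concat (map (ins P) qs)" "map (outc P) rB = B"
    by (metis map_eq_append_conv)
  have "length rM = length (concat (map (ins P) qs))" using arg_cong[OF rs(3), of length] by simp
  then have "length rM = sum_list (map (arity P) qs)"
    by (simp add: length_concat arity_def[abs_def] o_def)
  then have "concat (blocks (map (arity P) qs) rM) = rM" by (rule concat_blocks)
  moreover have "list_all2 (composable P) qs (blocks (map (arity P) qs) rM)"
    using rs c(2) assms(3) by (intro list_all2_composable_blocks) simp_all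
  ultimately show ?thesis using that[of rA "blocks (map (arity P) qs) rM" rB] rs c(2) by simp
qed

lemma pTw_cmp_blocks:
  assumes "length rA = i" "map length rss = map (arity P) qs"
  shows "pTw_cmp P (t, r, j, rA @ concat rss @ rB) (p, q, i, qs) =
     (p, partial_compo P r j (compo P q (rA @ ident P (outc P p) # rB)),
      j + sum_list (map (arity P) rA), map2 (compo P) qs rss)"
proof -
  have "sum_list (map (arity P) qs) = length (concat rss)"
    by (simp add: length_concat flip: assms(2))
  then show ?thesis
    by (simp add: pTw_cmp_def blocks_concat_append flip: assms)
qed

lemma pTw_cmp_split:
  assumes "map (outc P) rA = A" "list_all2 (composable P) qs rss"
  shows "pTw_cmp P (t, r, j, rA @ concat rss @ rB) (p, q, length A, qs) =
     (p, partial_compo P r j (compo P q (rA @ ident P (outc P p) # rB)),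
      j + sum_list (map (arity P) rA), map2 (compo P) qs rss)"
  using pTw_cmp_blocks[of rA "length A" rss qs] assms list_all2_composable_lengths by auto

lemma compo_cod:
  assumes f: "composable P p qs" "q \<in> opers P" "ins P q = A @ outc P p # B"
    and rs: "set rA \<subseteq> opers P" "set rB \<subseteq> opers P"
    "map (outc P) rA = A" "map (outc P) rB = B" "list_all2 (composable P) qs rss"
  shows "compo P (pTw_cod P (p, q, length A, qs)) (rA @ concat rss @ rB)
    = compo P q (rA @ compo P p (map2 (compo P) qs rss) # rB)"
proof -
  note 1 = composable_compo(1)[OF f(1) rs(5)]
  have 2: "compo P (partial_compo P q (length A) (compo P p qs)) (rA @ concat rss @ rB)
    = compo P q (rA @ compo P (compo P p qs) (concat rss) # rB)"
    by (rule partial_compo_compo[OF f(2) _ 1]) (use f rs in \<open>simp_all add: outc_compo\<close>)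
  show ?thesis unfolding pTw_cod_context(4)[OF f refl] 2 compo_assoc[OF f(1) rs(5)] ..
qed

lemma pTw_cmp_props:
  assumes f: "f \<in> pTw_arrows P" and g: "g \<in> pTw_arrows P" and gf: "fst g = pTw_cod P f"
  shows "pTw_cmp P g f \<in> pTw_arrows P" "pTw_cod P (pTw_cmp P g f) = pTw_cod P g"
proof -
  obtain p q A B qs where f: "f = (p, q, length A, qs)" "composable P p qs" "q \<in> opers P"
    "ins P q = A @ outc P p # B" using f by (rule pTw_arrowsE)
  obtain t r J K rs where g: "g = (t, r, length J, rs)" "composable P t rs" "r \<in> opers P"
    "ins P r = J @ outc P t # K" using g by (rule pTw_arrowsE)
  have t: "t = pTw_cod P (p, q, length A, qs)" using gf f(1) g(1) by simp
  note tp = pTw_cod_context[OF f(2-4) t]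
  obtain rA rss rB where rs: "rs = rA @ concat rss @ rB" "set rA \<subseteq> opers P" "set rB \<subseteq> opers P"
    "map (outc P) rA = A" "map (outc P) rB = B" "list_all2 (composable P) qs rss"
    using composable_cod_split[OF g(2) tp(2) composableD(2)[OF f(2)]] .
  define u where "u = compo P q (rA @ ident P (outc P p) # rB)"
  have cm: "pTw_cmp P g f = (p, partial_compo P r (length J) u,
      length J + sum_list (map (arity P) rA), map2 (compo P) qs rss)"
    unfolding f(1) g(1) rs(1) pTw_cmp_split[OF rs(4,6)] by (simp only: u_def)
  have p: "p \<in> opers P" and oc: "outc P p \<in> colours P" using composableD[OF f(2)] outc_colours by auto
  have cu: "composable P q (rA @ ident P (outc P p) # rB)"
    using f rs oc by (simp add: composable_def ident_oper outc_ident)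
  have u: "u \<in> opers P" "outc P u = outc P q"
    "ins P u = concat (map (ins P) rA) @ outc P p # concat (map (ins P) rB)"
    using cu by (simp_all add: u_def compo_oper outc_compo ins_compo ins_ident oc)
  have k: "sum_list (map (arity P) rA) = length (concat (map (ins P) rA))"
    by (simp add: length_concat arity_def[abs_def] o_def)
  have cp: "composable P p (map2 (compo P) qs rss)"
    using map2_compo_props[OF rs(6)] composableD[OF f(2)] by (simp add: composable_def)
  have r: "ins P r = J @ outc P u # K" using g(4) u(2) tp(3) by simp
  note ru = partial_compo_props[OF g(3) r u(1)]
  show "pTw_cmp P g f \<in> pTw_arrows P"
    unfolding cm k
    by (rule pTw_arrowsI[OF cp ru(1), where A = "J @ concat (map (ins P) rA)" and B = "concat (map (ins P) rB) @ K"])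
      (simp_all add: ru(2) u(3))
  define x where "x = compo P p (map2 (compo P) qs rss)"
  have x: "x \<in> opers P" "outc P x = outc P p" using cp by (simp_all add: x_def compo_oper outc_compo)
  have "pTw_cod P (pTw_cmp P g f) = partial_compo P (partial_compo P r (length J) u) (length J + length (concat (map (ins P) rA))) x"
    unfolding cm k by (simp add: pTw_cod_def x_def)
  also have "\<dots> = partial_compo P r (length J) (partial_compo P u (length (concat (map (ins P) rA))) x)"
    by (rule partial_compo_partial_compo[OF g(3) r u(1) _ x(1)]) (simp add: u(3) x(2))
  also have "partial_compo P u (length (concat (map (ins P) rA))) x = compo P q (rA @ x # rB)"
    using partial_compo_ident_slot[of q rA x rB] cu x by (simp only: u_def k x(2))
  also have "\<dots> = compo P t rs"
    unfolding rs(1) t x_def by (rule compo_cod[symmetric]) (use f rs in simp_all)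
  finally show "pTw_cod P (pTw_cmp P g f) = pTw_cod P g" by (simp add: g(1) pTw_cod_def)
qed

lemma map2_compo_assoc:
  assumes "list_all2 (composable P) qs rss" "list_all2 (list_all2 (composable P)) rss wsss"
  shows "list_all2 (composable P) (map2 (compo P) qs rss) (map concat wsss)"
    "list_all2 (composable P) qs (map2 (map2 (compo P)) rss wsss)"
    "map2 (compo P) (map2 (compo P) qs rss) (map concat wsss)
       = map2 (compo P) qs (map2 (map2 (compo P)) rss wsss)"
  using assms
proof (induction qs rss arbitrary: wsss rule: list_all2_induct)
  case (Cons q qs rs rss)
  { case 1 then show ?case using Cons by (auto simp: list_all2_Cons1 composable_compo) }
  { case 2 then show ?case using Cons by (auto simp: list_all2_Cons1 composable_compo) }
  { case 3 then show ?case using Cons by (auto simp: list_all2_Cons1 compo_assoc) }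
qed simp_all

lemma list_all2_concat_split:
  assumes "list_all2 R (concat xss) ys"
  obtains yss where "ys = concat yss" "list_all2 (list_all2 R) xss yss"
  using assms
proof (induction xss arbitrary: ys thesis)
  case (Cons xs xss)
  obtain us vs where us: "ys = us @ vs" "list_all2 R xs us" "list_all2 R (concat xss) vs"
    using Cons.prems(2) by (auto simp: list_all2_append1)
  obtain yss where "vs = concat yss" "list_all2 (list_all2 R) xss yss"
    using Cons.IH[OF _ us(3)] by blast
  then show ?case using Cons.prems(1)[of "us # yss"] us by simp
qed simp

lemma map2_concat:
  "list_all2 (\<lambda>xs ys. length xs = length ys) xss yss
    \<Longrightarrow> map2 f (concat xss) (concat yss) = concat (map2 (map2 f) xss yss)"
  by (induction rule: list_all2_induct) auto

text \<open>
  All components agree by associativity in \<open>P\<close>, once the upper vertices of the last arrow are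
  grouped by the vertices of the first two arrows into which they are plugged.
\<close>

lemma pTw_cmp_assoc:
  assumes f: "f \<in> pTw_arrows P" and g: "g \<in> pTw_arrows P" and h: "h \<in> pTw_arrows P"
    and gf: "fst g = pTw_cod P f" and hg: "fst h = pTw_cod P g"
  shows "pTw_cmp P h (pTw_cmp P g f) = pTw_cmp P (pTw_cmp P h g) f"
proof -
  obtain p q A B qs where f: "f = (p, q, length A, qs)" "composable P p qs" "q \<in> opers P"
    "ins P q = A @ outc P p # B" using f by (rule pTw_arrowsE)
  obtain t r J K rs where g: "g = (t, r, length J, rs)" "composable P t rs" "r \<in> opers P"
    "ins P r = J @ outc P t # K" using g by (rule pTw_arrowsE)
  obtain s k L M ws where h: "h = (s, k, length L, ws)" "composable P s ws" "k \<in> opers P"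
    "ins P k = L @ outc P s # M" using h by (rule pTw_arrowsE)
  have t: "t = pTw_cod P (p, q, length A, qs)" using gf f(1) g(1) by simp
  have s: "s = pTw_cod P (t, r, length J, rs)" using hg h(1) g(1) by simp
  note tp = pTw_cod_context[OF f(2-4) t]
  note sp = pTw_cod_context[OF g(2-4) s]
  obtain rA rss rB where rs: "rs = rA @ concat rss @ rB" "set rA \<subseteq> opers P" "set rB \<subseteq> opers P"
    "map (outc P) rA = A" "map (outc P) rB = B" "list_all2 (composable P) qs rss"
    using composable_cod_split[OF g(2) tp(2) composableD(2)[OF f(2)]] .
  obtain wA wss wB where ws: "ws = wA @ concat wss @ wB" "set wA \<subseteq> opers P" "set wB \<subseteq> opers P"
    "map (outc P) wA = J" "map (outc P) wB = K" "list_all2 (composable P) rs wss"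
    using composable_cod_split[OF h(2) sp(2) composableD(2)[OF g(2)]] .
  obtain vA vM vB where v: "wss = vA @ vM @ vB" "list_all2 (composable P) rA vA"
    "list_all2 (composable P) (concat rss) vM" "list_all2 (composable P) rB vB"
    using ws(6) unfolding rs(1) by (auto simp: list_all2_append1)
  obtain vss where vss: "vM = concat vss" "list_all2 (list_all2 (composable P)) rss vss"
    using list_all2_concat_split[OF v(3)] .
  note as = map2_compo_assoc[OF rs(6) vss(2)]
  have p: "p \<in> opers P" and oc: "outc P p \<in> colours P" using composableD[OF f(2)] outc_colours by auto
  have ot: "outc P t \<in> colours P" using tp(3) outc_colours[OF f(3)] by simp
  define u where "u = compo P q (rA @ ident P (outc P p) # rB)"
  have cu: "composable P q (rA @ ident P (outc P p) # rB)"
    using f rs oc by (simp add: composable_def ident_oper outc_ident)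
  have u: "u \<in> opers P" "outc P u = outc P t"
    "ins P u = concat (map (ins P) rA) @ outc P p # concat (map (ins P) rB)"
    using cu by (simp_all add: u_def compo_oper outc_compo ins_compo ins_ident oc tp(3))
  have r: "ins P r = J @ outc P u # K" using g(4) u(2) by simp
  \<comment> \<open>Both bracketings lead to the lower vertex \<open>k \<circ> r(wA, z, wB)\<close>, where \<open>z\<close> collects the part of
    the composite next to the source vertex.\<close>
  define z where "z = compo P q (map2 (compo P) rA vA @ ident P (outc P p) # map2 (compo P) rB vB)"
  have cz: "composable P q (map2 (compo P) rA vA @ ident P (outc P p) # map2 (compo P) rB vB)"
    using f(3,4) rs map2_compo_props[OF v(2)] map2_compo_props[OF v(4)] oc
    by (simp add: composable_def ident_oper outc_ident)
  have z: "z \<in> opers P" "outc P z = outc P t"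
    using cz by (simp_all add: z_def compo_oper outc_compo tp(3))
  define y where "y = compo P r (wA @ ident P (outc P z) # wB)"
  have cy: "composable P r (wA @ ident P (outc P z) # wB)"
    using g ws z ot by (simp add: composable_def ident_oper outc_ident)
  have y: "y \<in> opers P" "outc P y = outc P r"
    "ins P y = concat (map (ins P) wA) @ outc P z # concat (map (ins P) wB)"
    using cy ot by (simp_all add: y_def compo_oper outc_compo ins_compo ins_ident z)
  have la: "sum_list (map (arity P) us) = length (concat (map (ins P) us))" for us
    by (simp add: length_concat arity_def[abs_def] o_def)
  have cxu: "composable P u (concat vA @ [ident P (outc P p)] @ concat vB)"
    and uz: "compo P u (concat vA @ [ident P (outc P p)] @ concat vB) = z"
  proof -
    have "list_all2 (composable P) (rA @ ident P (outc P p) # rB) (vA @ [ident P (outc P p)] # vB)"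
      using v(2,4) composable_ident[OF ident_oper[OF oc]]
      by (simp add: list_all2_appendI outc_ident oc)
    from composable_compo(1)[OF cu this]
    show "composable P u (concat vA @ [ident P (outc P p)] @ concat vB)" by (simp add: u_def)
    have "composable P (ident P (outc P p)) [ident P (outc P p)]"
      using composable_ident[OF ident_oper[OF oc]] by (simp add: outc_ident oc)
    from compo_assoc_context[OF cu v(2) this v(4)]
    show "compo P u (concat vA @ [ident P (outc P p)] @ concat vB) = z"
      using compo_ident_left[OF ident_oper[OF oc]] by (simp add: u_def z_def outc_ident oc)
  qed
  have "pTw_cmp P g f = (p, partial_compo P r (length J) u, length (J @ concat (map (ins P) rA)),
      map2 (compo P) qs rss)"
    unfolding f(1) g(1) rs(1) pTw_cmp_split[OF rs(4,6)] by (simp only: u_def la length_append)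
  then have 1: "pTw_cmp P h (pTw_cmp P g f) = (p,
      partial_compo P k (length L) (compo P (partial_compo P r (length J) u)
         ((wA @ concat vA) @ ident P (outc P p) # (concat vB @ wB))),
      length L + sum_list (map (arity P) (wA @ concat vA)),
      map2 (compo P) (map2 (compo P) qs rss) (map concat vss))"
  proof -
    have "map (outc P) (concat vA) = concat (map (ins P) rA)"
      using v(2) by (induction rule: list_all2_induct) (auto simp: composable_def)
    then have e: "map (outc P) (wA @ concat vA) = J @ concat (map (ins P) rA)" using ws by simp
    have cc: "concat (map concat vss) = concat (concat vss)" by (induction vss) auto
    show ?thesis using pTw_cmp_split[OF e as(1), of s k "length L" "concat vB @ wB"]
      \<open>pTw_cmp P g f = _\<close>
      by (simp add: h(1) ws(1) v(1) vss(1) cc)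
  qed
  have 2: "pTw_cmp P (pTw_cmp P h g) f = (p,
      partial_compo P (partial_compo P k (length L) y) (length L + sum_list (map (arity P) wA)) z,
      length L + sum_list (map (arity P) wA) + sum_list (map (arity P) (map2 (compo P) rA vA)),
      map2 (compo P) qs (map2 (map2 (compo P)) rss vss))"
  proof -
    have l: "length rA = length vA" "length (concat rss) = length (concat vss)"
      using v(2,3) vss(1) by (auto dest: list_all2_lengthD)
    have "list_all2 (\<lambda>xs ys. length xs = length ys) rss vss"
      using vss(2) by (rule list_all2_mono) (rule list_all2_lengthD)
    from map2_concat[OF this, of "compo P"] l
    have e: "map2 (compo P) rs wss = map2 (compo P) rA vA @ concat (map2 (map2 (compo P)) rss vss) @ map2 (compo P) rB vB"
      by (simp add: rs(1) v(1) vss(1))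
    have hg: "pTw_cmp P h g = (t, partial_compo P k (length L) y, length L + sum_list (map (arity P) wA),
        map2 (compo P) rs wss)"
      unfolding h(1) g(1) ws(1) pTw_cmp_split[OF ws(4,6)] by (simp only: y_def z(2))
    have "map (outc P) (map2 (compo P) rA vA) = A" using map2_compo_props[OF v(2)] rs(4) by simp
    from pTw_cmp_split[OF this as(2)] show ?thesis
      unfolding hg e f(1) z_def by simp
  qed
  have "compo P (partial_compo P r (length J) u) ((wA @ concat vA) @ ident P (outc P p) # (concat vB @ wB))
      = compo P (partial_compo P r (length J) u) (wA @ (concat vA @ [ident P (outc P p)] @ concat vB) @ wB)"
    by simp
  also have "\<dots> = compo P r (wA @ z # wB)"
    using partial_compo_compo[OF g(3) r cxu ws(2,4,3,5)] by (simp only: uz)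
  also have "\<dots> = partial_compo P y (sum_list (map (arity P) wA)) z"
    unfolding y_def by (rule partial_compo_ident_slot[OF cy z(1), symmetric])
  finally have 3: "compo P (partial_compo P r (length J) u) ((wA @ concat vA) @ ident P (outc P p) # (concat vB @ wB))
    = partial_compo P y (sum_list (map (arity P) wA)) z" .
  have k: "ins P k = L @ outc P y # M" using h(4) y(2) sp(3) by simp
  have 4: "partial_compo P (partial_compo P k (length L) y) (length L + sum_list (map (arity P) wA)) z
    = partial_compo P k (length L) (partial_compo P y (sum_list (map (arity P) wA)) z)"
    unfolding la by (rule partial_compo_partial_compo[OF h(3) k y(1) y(3) z(1)])
  have 5: "sum_list (map (arity P) (concat vA)) = sum_list (map (arity P) (map2 (compo P) rA vA))"
    unfolding map2_compo_props(4)[OF v(2)] by (induction vA) simp_all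
  show ?thesis unfolding 1 2 3 4 using 5 as(3) by simp
qed

lemma pTw_idt_props:
  assumes "p \<in> opers P" "e = (p, ident P (outc P p), 0, idents (ins P p))"
  shows "e \<in> pTw_arrows P" "pTw_cod P e = p"
proof -
  note c = composable_idents[OF assms(1)] ident_oper[OF outc_colours[OF assms(1)]]
    ins_ident[OF outc_colours[OF assms(1)]]
  then show "e \<in> pTw_arrows P" by (simp add: pTw_arrows_def assms(2) arity_def)
  show "pTw_cod P e = p"
    using partial_compo_context[of "ident P (outc P p)" "[]" "outc P p" "[]" p] c assms(1)
    by (simp add: assms(2) pTw_cod_def compo_ident_right compo_ident_left)
qed

lemma pTw_cmp_idt:
  assumes f: "f \<in> pTw_arrows P"
  shows "pTw_cmp P f (fst f, ident P (outc P (fst f)), 0, idents (ins P (fst f))) = f"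
    "pTw_cmp P (pTw_cod P f, ident P (outc P (pTw_cod P f)), 0, idents (ins P (pTw_cod P f))) f = f"
proof -
  obtain p q A B qs where f: "f = (p, q, length A, qs)" "composable P p qs" "q \<in> opers P"
    "ins P q = A @ outc P p # B" using f by (rule pTw_arrowsE)
  define t where "t = pTw_cod P (p, q, length A, qs)"
  note tp = pTw_cod_context[OF f(2-4) t_def]
  note c = composableD[OF f(2)] outc_colours[OF composableD(1)[OF f(2)]]
  have i: "compo P q (idents A @ ident P (outc P p) # idents B) = q"
    using compo_ident_right[OF f(3)] f(4) by simp
  have I: "compo P (ident P (outc P p)) [ident P (outc P p)] = ident P (outc P p)"
    using compo_ident_left[OF ident_oper[OF c(5)]] by (simp add: outc_ident c(5))
  have "pTw_cmp P (p, q, length A, [] @ concat (map (\<lambda>u. [u]) qs) @ []) (p, ident P (outc P p), length [], idents (map (outc P) qs))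
    = (p, q, length A, qs)"
    using pTw_cmp_split[OF _ list_all2_composable_singletons(1)[OF c(2)],
        of "[]" "[]" p q "length A" "[]" p "ident P (outc P p)"]
    by (simp add: list_all2_composable_singletons(2) c(2) I partial_compo_context[OF f(4)] i del: map_map)
  then show "pTw_cmp P f (fst f, ident P (outc P (fst f)), 0, idents (ins P (fst f))) = f"
    by (simp add: f(1) concat_map_singleton c(3) del: map_map)
  have col: "set A \<subseteq> colours P" "set B \<subseteq> colours P" using ins_colours[OF f(3)] f(4) by auto
  have "idents (ins P t) = idents A @ concat (map (\<lambda>u. idents (ins P u)) qs) @ idents B"
    by (simp add: tp(2) map_concat o_def)
  moreover have "pTw_cmp P (t, ident P (outc P t), 0, idents A @ concat (map (\<lambda>u. idents (ins P u)) qs) @ idents B) (p, q, length A, qs)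
    = (p, q, length A, qs)"
  proof -
    have "sum_list (map (arity P) (idents A)) = length A"
      using arg_cong[OF idents_props(3)[OF col(1)], of length]
      by (simp add: length_concat arity_def[abs_def] o_def)
    moreover have "partial_compo P (ident P (outc P t)) 0 q = q"
      using partial_compo_context[of "ident P (outc P q)" "[]" "outc P q" "[]" q] f(3)
      by (simp add: tp(3) ins_ident outc_colours compo_ident_left)
    ultimately show ?thesis
      by (subst pTw_cmp_split[OF idents_props(2)[OF col(1)] list_all2_composable_idents(1)[OF c(2)]])
        (simp add: list_all2_composable_idents(2) c(2) i)
  qed
  ultimately show "pTw_cmp P (pTw_cod P f, ident P (outc P (pTw_cod P f)), 0, idents (ins P (pTw_cod P f))) f = f"
    by (simp add: f(1) flip: t_def)
qed

lemma category_Tw_pOp: "category (Tw_pOp P)"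
proof -
  have 1: "fst f \<in> opers P" "pTw_cod P f \<in> opers P" if f: "f \<in> pTw_arrows P" for f
  proof -
    obtain p q A B qs where f: "f = (p, q, length A, qs)" "composable P p qs" "q \<in> opers P"
      "ins P q = A @ outc P p # B" using f by (rule pTw_arrowsE)
    show "fst f \<in> opers P" "pTw_cod P f \<in> opers P"
      using f pTw_cod_context(1)[OF f(2-4) refl] composableD(1)[OF f(2)] by simp_all
  qed
  have 2: "fst (pTw_cmp P g f) = fst f" for f g
    by (cases f; cases g) (simp add: pTw_cmp_def Let_def)
  show ?thesis
    by (rule category.intro)
      (simp_all add: Tw_pOp_def 1 2 pTw_cmp_props pTw_cmp_assoc pTw_idt_props[OF _ refl] pTw_cmp_idt)
qed

end

section \<open>The simplex category\<close>

lemma category_Delta: "category Delta"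
proof (rule category.intro, goal_cases)
  case (6 f g)
  then show ?case
    by (auto simp: Delta_def compose_def mono_on_def PiE_iff extensional_def Pi_iff)
next
  case (9 f)
  then show ?case by (auto simp: Delta_def compose_def fun_eq_iff PiE_iff extensional_def)
next
  case (10 f)
  then show ?case by (auto simp: Delta_def compose_def fun_eq_iff PiE_iff extensional_def)
next
  case (11 f g h)
  then show ?case by (auto simp: Delta_def compose_def fun_eq_iff PiE_iff extensional_def)
qed (auto simp: Delta_def mono_on_def compose_def)

lemma uAs_pl_simps [simp]:
  "opers uAs_pl = UNIV" "outc uAs_pl = (\<lambda>p. ())" "arity uAs_pl = (\<lambda>p. p)" "compo uAs_pl p qs = sum_list qs"
  "ident uAs_pl c = 1" "ins uAs_pl p = replicate p ()"
  by (simp_all add: uAs_pl_def arity_def fun_eq_iff)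

lemma composable_uAs_pl: "composable uAs_pl p qs \<longleftrightarrow> length qs = p"
  by (auto simp: composable_def map_replicate_const dest: arg_cong[of _ _ length])

lemma partial_compo_uAs_pl: "i < q \<Longrightarrow> partial_compo uAs_pl q i p = q - 1 + p"
  by (simp add: partial_compo_def sum_list_update sum_list_replicate)

lemma pTw_arrows_uAs_pl: "(p, q, i, qs) \<in> pTw_arrows uAs_pl \<longleftrightarrow> length qs = p \<and> i < q"
  by (auto simp: pTw_arrows_def composable_uAs_pl)

lemma pTw_cod_uAs_pl: "i < q \<Longrightarrow> pTw_cod uAs_pl (p, q, i, qs) = q - 1 + sum_list qs"
  by (simp add: pTw_cod_def partial_compo_uAs_pl)

text \<open>
  For \<open>uAs_pl\<close> the upper vertices of a composite arrow have the block sums as arities, so this is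
  the composition law for the partial sums that define a monotone map.
\<close>

lemma sum_list_take_blocks:
  fixes xs :: "nat list"
  shows "sum_list (take k (map sum_list (blocks ms xs))) = sum_list (take (sum_list (take k ms)) xs)"
proof (induction ms xs arbitrary: k rule: blocks.induct)
  case (2 m ms xs)
  then show ?case by (cases k) (simp_all add: take_add)
qed simp

text \<open>
  The distinguished input \<open>i\<close> of the lower vertex is the value at 0, and the arities of the upper
  vertices are the differences of successive values.
\<close>

definition gap_map :: "nat pl_arrow \<Rightarrow> nat \<times> nat \<times> (nat \<Rightarrow> nat)" where
  "gap_map = (\<lambda>(p, q, i, qs). (p, q - 1 + sum_list qs, \<lambda>k\<in>{..p}. i + sum_list (take k qs)))"

definition gaps :: "nat \<times> nat \<times> (nat \<Rightarrow> nat) \<Rightarrow> nat pl_arrow" where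
  "gaps = (\<lambda>(m, n, f). (m, n - f m + 1 + f 0, f 0, map (\<lambda>k. f (Suc k) - f k) [0..<m]))"

lemma gap_map_arrow:
  assumes "f \<in> pTw_arrows uAs_pl"
  shows "gap_map f \<in> Ar Delta"
proof -
  obtain p q i qs where f: "f = (p, q, i, qs)" "length qs = p" "i < q"
    using assms by (cases f) (auto simp: pTw_arrows_uAs_pl)
  have mono: "sum_list (take k qs) \<le> sum_list (take l qs)" if "k \<le> l" for k l
    using take_add[of k "l - k" qs] that by simp
  have "i + sum_list (take k qs) \<le> q - 1 + sum_list qs" for k
    using mono[of k "max k p"] f(2,3) by simp
  then show ?thesis
    using mono by (auto simp: f Delta_def gap_map_def mono_on_def)
qed

lemma gap_map_cmp:
  assumes "f \<in> pTw_arrows uAs_pl" "g \<in> pTw_arrows uAs_pl" "fst g = pTw_cod uAs_pl f"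
  shows "gap_map (pTw_cmp uAs_pl g f) = Cmp Delta (gap_map g) (gap_map f)"
proof -
  obtain p q i qs where f: "f = (p, q, i, qs)" "length qs = p" "i < q"
    using assms by (cases f) (auto simp: pTw_arrows_uAs_pl)
  obtain t r j rs where g: "g = (t, r, j, rs)" "length rs = t" "j < r"
    using assms by (cases g) (auto simp: pTw_arrows_uAs_pl)
  have t: "t = q - 1 + sum_list qs" using assms(3) f g by (simp add: pTw_cod_uAs_pl)
  define v where "v = partial_compo uAs_pl r j (sum_list (take i rs @ [1] @ drop (i + sum_list qs) rs))"
  define us where "us = map sum_list (blocks qs (drop i rs))"
  have "map2 (compo uAs_pl) qs (blocks qs (drop i rs)) = us"
    by (intro nth_equalityI) (simp_all add: us_def)
  then have cm: "pTw_cmp uAs_pl g f = (p, v, j + sum_list (take i rs), us)"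
    by (simp add: f(1) g(1) pTw_cmp_def v_def Let_def)
  have in_range: "i + sum_list (take k qs) \<le> t" for k
  proof -
    have "sum_list (take k qs) \<le> sum_list qs" by (metis append_take_drop_id le_add1 sum_list_append)
    then show ?thesis using f(3) t by simp
  qed
  have "j + sum_list (take i rs) + sum_list (take k us) = j + sum_list (take (i + sum_list (take k qs)) rs)" for k
    unfolding us_def sum_list_take_blocks take_add by simp
  moreover have "v - 1 + sum_list us = r - 1 + sum_list rs"
  proof -
    have "sum_list us = sum_list (take (sum_list qs) (drop i rs))"
      using sum_list_take_blocks[of "length qs" qs "drop i rs"] by (simp add: us_def)
    moreover have "sum_list rs = sum_list (take i rs) + sum_list (take (sum_list qs) (drop i rs)) + sum_list (drop (i + sum_list qs) rs)"
      by (metis append_take_drop_id sum_list_append take_add)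
    ultimately show ?thesis using g(3) by (simp add: v_def partial_compo_uAs_pl)
  qed
  ultimately show ?thesis
    unfolding cm using in_range by (auto simp: gap_map_def f(1) g(1) Delta_def compose_def restrict_def fun_eq_iff)
qed

lemma gaps_gap_map:
  assumes "f \<in> pTw_arrows uAs_pl"
  shows "gaps (gap_map f) = f"
proof -
  obtain p q i qs where f: "f = (p, q, i, qs)" "length qs = p" "i < q"
    using assms by (cases f) (auto simp: pTw_arrows_uAs_pl)
  have "map (\<lambda>k. i + sum_list (take (Suc k) qs) - (i + sum_list (take k qs))) [0..<p] = qs"
    using f(2) by (intro nth_equalityI) (simp_all add: take_Suc_conv_app_nth)
  moreover have "map (\<lambda>k. (\<lambda>k\<in>{..p}. i + sum_list (take k qs)) (Suc k) - (\<lambda>k\<in>{..p}. i + sum_list (take k qs)) k) [0..<p]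
      = map (\<lambda>k. i + sum_list (take (Suc k) qs) - (i + sum_list (take k qs))) [0..<p]"
    by (intro map_cong) auto
  ultimately have "map (\<lambda>k. (\<lambda>k\<in>{..p}. i + sum_list (take k qs)) (Suc k) - (\<lambda>k\<in>{..p}. i + sum_list (take k qs)) k) [0..<p] = qs"
    by (simp only:)
  then show ?thesis using f unfolding gaps_def gap_map_def by simp
qed

lemma gap_map_gaps:
  assumes "h \<in> Ar Delta"
  shows "gaps h \<in> pTw_arrows uAs_pl" "gap_map (gaps h) = h"
proof -
  obtain m n f where h: "h = (m, n, f)" "f \<in> {..m} \<rightarrow>\<^sub>E {..n}" "mono_on {..m} f"
    using assms by (auto simp: Delta_def)
  have tel: "f 0 + sum_list (take k (map (\<lambda>k. f (Suc k) - f k) [0..<m])) = f k" if "k \<le> m" for k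
    using that
  proof (induction k)
    case (Suc k)
    have "f k \<le> f (Suc k)" using Suc.prems h(3) by (auto simp: mono_on_def)
    then show ?case using Suc by (simp add: take_Suc_conv_app_nth)
  qed simp
  show "gaps h \<in> pTw_arrows uAs_pl" by (simp add: h(1) gaps_def pTw_arrows_uAs_pl)
  have "f m \<le> n" using h(2) by auto
  moreover have "(\<lambda>k\<in>{..m}. f 0 + sum_list (take k (map (\<lambda>k. f (Suc k) - f k) [0..<m]))) = f"
    using tel h(2) by (auto simp: fun_eq_iff PiE_iff extensional_def)
  ultimately show "gap_map (gaps h) = h" using tel[of m] by (simp add: h(1) gaps_def gap_map_def)
qed

lemma isomorphism_functor_gap_map:
  "isomorphism_functor (Tw_pOp uAs_pl) Delta (\<lambda>n. n) gap_map"
proof -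
  interpret S: category "Tw_pOp uAs_pl"
    by (rule planar_operad.category_Tw_pOp[OF planar_operad_uAs_pl])
  interpret T: category Delta by (rule category_Delta)
  have "cat_functor (Tw_pOp uAs_pl) Delta (\<lambda>n. n) gap_map"
  proof unfold_locales
    fix f assume f: "f \<in> Ar (Tw_pOp uAs_pl)"
    then show "gap_map f \<in> Ar Delta" by (simp add: Tw_pOp_def gap_map_arrow)
    show "Dom Delta (gap_map f) = Dom (Tw_pOp uAs_pl) f"
      "Cod Delta (gap_map f) = Cod (Tw_pOp uAs_pl) f"
      using f by (cases f; simp add: Tw_pOp_def gap_map_def Delta_def pTw_arrows_uAs_pl pTw_cod_uAs_pl)+
  next
    fix p
    have "map (ident uAs_pl) (replicate p ()) = replicate p 1" by (simp add: map_replicate_const)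
    then show "gap_map (Idt (Tw_pOp uAs_pl) p) = Idt Delta p"
      by (auto simp: Tw_pOp_def gap_map_def Delta_def fun_eq_iff sum_list_replicate min_def)
  qed (auto simp: Tw_pOp_def gap_map_cmp, simp add: Delta_def)
  moreover have "bij_betw gap_map (Ar (Tw_pOp uAs_pl)) (Ar Delta)"
    by (rule bij_betw_byWitness[where f' = gaps])
      (auto simp: Tw_pOp_def gaps_gap_map gap_map_gaps gap_map_arrow)
  ultimately show ?thesis by (simp add: isomorphism_functor_def Tw_pOp_def Delta_def bij_betw_def)
qed

section \<open>Composition in the symmetric twisted arrow category\<close>

lemma length_ranks [simp]: "length (ranks l) = length l"
  by (simp add: ranks_def)

lemma length_filter_less_nth_sorted:
  assumes "sorted_wrt (<) (s :: nat list)" "k < length s"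
  shows "length (filter (\<lambda>y. y < s ! k) s) = k"
proof -
  have "{i. i < length s \<and> s ! i < s ! k} = {..<k}"
  proof (intro set_eqI iffI)
    fix i assume "i \<in> {i. i < length s \<and> s ! i < s ! k}"
    then show "i \<in> {..<k}"
      using sorted_wrt_nth_less[OF assms(1), of k i] by (cases i k rule: linorder_cases) auto
  qed (use assms sorted_wrt_nth_less[OF assms(1)] in auto)
  then show ?thesis by (simp add: length_filter_conv_card)
qed

lemma strict_sorted_sort: "distinct l \<Longrightarrow> sorted_wrt (<) (sort (l :: nat list))"
  by (simp add: strict_sorted_iff)

text \<open>Normalization: permuting inputs by \<open>ranks l\<close> and numbering them by \<open>sort l\<close> restores the labels \<open>l\<close>.\<close>

lemma map_nth_sort_ranks:
  assumes "distinct l"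
  shows "map ((!) (sort l)) (ranks l) = l"
proof -
  have "sort l ! length (filter (\<lambda>y. y < x) l) = x" if x: "x \<in> set l" for x
  proof -
    obtain k where k: "k < length (sort l)" "sort l ! k = x"
      using x in_set_conv_nth[of x "sort l"] by auto
    have "mset (filter (\<lambda>y. y < x) (sort l)) = mset (filter (\<lambda>y. y < x) l)" by simp
    then have "length (filter (\<lambda>y. y < x) (sort l)) = length (filter (\<lambda>y. y < x) l)"
      by (rule mset_eq_length)
    then show ?thesis
      using length_filter_less_nth_sorted[OF strict_sorted_sort[OF assms] k(1)] k(2) by simp
  qed
  then show ?thesis by (simp add: ranks_def map_idI)
qed

lemma ranks_permutation:
  assumes "distinct l"
  shows "ranks l \<in> permutations_of_set {..<length l}"
proof (rule permutations_of_setI)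
  have "distinct (map ((!) (sort l)) (ranks l))" using assms by (simp add: map_nth_sort_ranks)
  then show d: "distinct (ranks l)" by (simp add: distinct_map)
  have "set (ranks l) \<subseteq> {..<length l}"
    by (auto simp: ranks_def intro: length_filter_less)
  moreover have "card (set (ranks l)) = card {..<length l}" using distinct_card[OF d] by simp
  ultimately show "set (ranks l) = {..<length l}" by (intro card_subset_eq) auto
qed

lemma permutation_Cons_Suc:
  "0 # map Suc \<sigma> \<in> permutations_of_set {..<Suc n}" if "\<sigma> \<in> permutations_of_set {..<n}"
proof -
  have "[0..<Suc n] = 0 # map Suc [0..<n]" by (subst map_Suc_upt) (rule upt_conv_Cons, simp)
  then show ?thesis using that by (simp add: mem_permutations_lessThan_iff del: upt_Suc)
qed

lemma mset_concat_map_nth_permutation: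
  "\<sigma> \<in> permutations_of_set {..<length xss} \<Longrightarrow> mset (concat (map ((!) xss) \<sigma>)) = mset (concat xss)"
  using arg_cong[OF mset_map_nth_permutation[of \<sigma> xss], of "image_mset mset"]
  by (intro mset_concat_cong) (simp add: image_mset.compositionality)

context symmetric_operad
begin

lemma nth_ins_act:
  assumes "p \<in> opers R" "\<sigma> \<in> permutations_of_set {..<arity R p}"
  shows "map ((!) (ins R (act R p \<sigma>))) \<sigma> = ins R p"
  using map_nth_unpermute[of \<sigma> "ins R p"] assms by (simp add: ins_act arity_def)

lemma arity_act:
  "\<lbrakk>p \<in> opers R; \<sigma> \<in> permutations_of_set {..<arity R p}\<rbrakk> \<Longrightarrow> arity R (act R p \<sigma>) = arity R p"
  by (simp add: arity_def ins_act)

lemma sTw_arrowsE: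
  assumes "f \<in> sTw_arrows R"
  obtains p q us low up where "f = (p, q, us, low, up)" "composable R p us" "q \<in> opers R"
    "ins R q = outc R p # tl (ins R q)" "arity R q = Suc (length low)" "map length up = map (arity R) us"
    "\<forall>l \<in> set (low # up). sorted_wrt (<) l"
    "concat up @ low \<in> permutations_of_set {..<length (concat up @ low)}"
proof -
  obtain p q us low up where f: "f = (p, q, us, low, up)" by (cases f) auto
  have "ins R q \<noteq> []" "ins R q ! 0 = outc R p" using assms by (auto simp: f sTw_arrows_def arity_def)
  then have "ins R q = outc R p # tl (ins R q)" by (cases "ins R q") auto
  moreover have "composable R p us" "q \<in> opers R" "arity R q = Suc (length low)"
    "map length up = map (arity R) us" "\<forall>l \<in> set (low # up). sorted_wrt (<) l"
    "concat up @ low \<in> permutations_of_set {..<length (concat up @ low)}"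
    using assms unfolding f sTw_arrows_def mem_Collect_eq case_prod_conv by auto
  ultimately show ?thesis using that f by blast
qed

lemma sTw_cod_props:
  assumes "composable R p us" "q \<in> opers R" "ins R q = outc R p # B" "arity R q = Suc (length low)"
    "map length up = map (arity R) us" "concat up @ low \<in> permutations_of_set {..<length (concat up @ low)}"
    "t = sTw_cod R (p, q, us, low, up)"
  shows "t \<in> opers R" "outc R t = outc R q" "arity R t = length (concat up @ low)"
    "map ((!) (ins R t)) (concat up @ low) = concat (map (ins R) us) @ B"
proof -
  define x where "x = compo R p us"
  have x: "x \<in> opers R" "outc R x = outc R p" "ins R x = concat (map (ins R) us)"
    using assms(1) by (simp_all add: x_def compo_oper outc_compo ins_compo)
  note y = partial_compo_props[of q "[]" x B, simplified, OF assms(2) _ x(1)]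
  have "length (concat (map (ins R) us)) = length (concat up)"
    using assms(5) by (simp add: length_concat arity_def[abs_def] o_def)
  then have a: "arity R (partial_compo R q 0 x) = length (concat up @ low)"
    using y(2) assms(3,4) x by (simp add: arity_def)
  have t: "t = act R (partial_compo R q 0 x) (concat up @ low)"
    by (simp add: assms(7) sTw_cod_def x_def)
  have \<sigma>: "concat up @ low \<in> permutations_of_set {..<arity R (partial_compo R q 0 x)}"
    using assms(6) a by simp
  show "t \<in> opers R" "outc R t = outc R q" "arity R t = length (concat up @ low)"
    "map ((!) (ins R t)) (concat up @ low) = concat (map (ins R) us) @ B"
    using y assms(3) x \<sigma> a nth_ins_act[OF _ \<sigma>]
    by (simp_all add: t act_oper outc_act arity_act del: map_append)
qed

text \<open>
  The number carried by a leaf says which of the operations \<open>rs\<close> is grafted there, so the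
  colours fit at every vertex of the first arrow.
\<close>

lemma composable_sTw_cod:
  assumes "composable R t rs" "arity R t = length (concat up @ low)"
    "concat up @ low \<in> permutations_of_set {..<length (concat up @ low)}"
    "map ((!) (ins R t)) (concat up @ low) = concat (map (ins R) us) @ B"
    "map length up = map (arity R) us"
  shows "map (\<lambda>j. outc R (rs ! j)) low = B"
    "\<And>i. i < length us \<Longrightarrow> map (\<lambda>j. outc R (rs ! j)) (up ! i) = ins R (us ! i)"
    "\<And>j. j \<in> set (concat up @ low) \<Longrightarrow> j < length rs"
proof -
  note c = composableD[OF assms(1)]
  show j: "\<And>j. j \<in> set (concat up @ low) \<Longrightarrow> j < length rs"
    using permutation_facts(2)[OF assms(3)] c(4) assms(2) by auto
  have e0: "map (\<lambda>j. outc R (rs ! j)) (concat up @ low) = map ((!) (ins R t)) (concat up @ low)"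
    by (intro map_cong refl) (use j in \<open>simp flip: c(3)\<close>)
  have e: "map (\<lambda>j. outc R (rs ! j)) (concat up) @ map (\<lambda>j. outc R (rs ! j)) low = concat (map (ins R) us) @ B"
    using e0[unfolded assms(4)] by (simp only: map_append)
  have l: "map length up = map length (map (ins R) us)" using assms(5) by (simp add: arity_def[abs_def] o_def)
  then have "length (map (\<lambda>j. outc R (rs ! j)) (concat up)) = length (concat (map (ins R) us))"
    by (simp only: length_concat length_map)
  note e' = iffD1[OF append_eq_append_conv, OF disjI1[OF this] e]
  then show "map (\<lambda>j. outc R (rs ! j)) low = B" by (rule conjunct2)
  have "map (map (\<lambda>j. outc R (rs ! j))) up
      = blocks (map length (map (map (\<lambda>j. outc R (rs ! j))) up)) (concat (map (map (\<lambda>j. outc R (rs ! j))) up))"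
    by (rule blocks_concat[symmetric])
  also have "map length (map (map (\<lambda>j. outc R (rs ! j))) up) = map length (map (ins R) us)"
    unfolding l[symmetric] by simp
  also have "concat (map (map (\<lambda>j. outc R (rs ! j))) up) = concat (map (ins R) us)"
    using conjunct1[OF e'] by (simp only: map_concat)
  also have "blocks (map length (map (ins R) us)) (concat (map (ins R) us)) = map (ins R) us"
    by (rule blocks_concat)
  finally have mm: "map (map (\<lambda>j. outc R (rs ! j))) up = map (ins R) us" .
  show "map (\<lambda>j. outc R (rs ! j)) (up ! i) = ins R (us ! i)" if "i < length us" for i
    using that arg_cong[OF mm, of "\<lambda>l. l ! i"] map_eq_imp_length_eq[OF assms(5)] by simp
qed

text \<open>
  Composites are again in normal form because \<open>ranks\<close> and \<open>sort\<close> are applied to duplicate-free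
  lists: the labels of all vertices together form one permutation.
\<close>

lemma sTw_cmp_arrow:
  assumes f: "f \<in> sTw_arrows R" and g: "g \<in> sTw_arrows R" and gf: "fst g = sTw_cod R f"
  shows "sTw_cmp R g f \<in> sTw_arrows R"
proof -
  obtain p q us low up where f: "f = (p, q, us, low, up)" "composable R p us" "q \<in> opers R"
    "ins R q = outc R p # tl (ins R q)" "arity R q = Suc (length low)" "map length up = map (arity R) us"
    "concat up @ low \<in> permutations_of_set {..<length (concat up @ low)}"
    using f by (rule sTw_arrowsE)
  obtain t r rs low' up' where g: "g = (t, r, rs, low', up')" "composable R t rs" "r \<in> opers R"
    "ins R r = outc R t # tl (ins R r)" "arity R r = Suc (length low')" "map length up' = map (arity R) rs"
    "concat up' @ low' \<in> permutations_of_set {..<length (concat up' @ low')}"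
    using g by (rule sTw_arrowsE)
  have t: "t = sTw_cod R (p, q, us, low, up)" using gf f(1) g(1) by simp
  note tp = sTw_cod_props[OF f(2-7) t]
  note rp = composable_sTw_cod[OF g(2) tp(3) f(7) tp(4) f(6)]
  note c = composableD[OF f(2)] and d = composableD[OF g(2)]
  have lup: "length up = length us" using map_eq_imp_length_eq[OF f(6)] .
  have lup': "length up' = length rs" using map_eq_imp_length_eq[OF g(6)] .
  have lj: "length (up' ! j) = arity R (rs ! j)" if "j < length rs" for j
    using that lup' arg_cong[OF g(6), of "\<lambda>l. l ! j"] by simp
  have lcat: "length (concat (map ((!) up') l)) = sum_list (map (arity R) (map ((!) rs) l))"
    if "set l \<subseteq> {..<length rs}" for l
    using that by (induction l) (simp_all add: lj)
  define v where "v = partial_compo R r 0 (compo R q (ident R (outc R p) # map ((!) rs) low))"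
  define vl where "vl = concat (map ((!) up') low) @ low'"
  define ws where "ws = map2 (\<lambda>q l. compo R q (map ((!) rs) l)) us up"
  define wls where "wls = map (\<lambda>l. concat (map ((!) up') l)) up"
  have cm: "sTw_cmp R g f = (p, act R v (0 # map Suc (ranks vl)), map2 (\<lambda>u l. act R u (ranks l)) ws wls,
      sort vl, map sort wls)"
    by (simp add: f(1) g(1) sTw_cmp_def v_def vl_def ws_def wls_def Let_def)
  have "concat wls = concat (map ((!) up') (concat up))"
    unfolding wls_def by (induction up) auto
  then have "mset (concat wls @ vl) = mset (concat (map ((!) up') (concat up @ low)) @ low')"
    by (simp add: vl_def)
  also have "\<dots> = mset (concat up' @ low')"
    using mset_concat_map_nth_permutation[of "concat up @ low" up'] f(7) tp(3) d(4) lup' by simp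
  finally have ms: "mset (concat wls @ vl) = mset (concat up' @ low')" .
  then have dist: "distinct (concat wls @ vl)"
    using permutation_facts(3)[OF g(7)] mset_eq_imp_distinct_iff[OF ms] by simp
  then have dist: "distinct vl" "\<And>l. l \<in> set wls \<Longrightarrow> distinct l" by (auto simp: distinct_concat_iff)
  have "mset (concat (map sort wls)) = mset (concat wls)"
    by (rule mset_concat_cong) (simp add: o_def)
  then have ms': "mset (concat (map sort wls) @ sort vl) = mset (concat up' @ low')" using ms by simp
  have perm: "concat (map sort wls) @ sort vl \<in> permutations_of_set {..<length (concat (map sort wls) @ sort vl)}"
    using g(7) by (simp only: mem_permutations_lessThan_iff ms' mset_eq_length[OF ms'])
  have oc: "outc R p \<in> colours R" using outc_colours[OF c(1)] .
  have slow: "set low \<subseteq> {..<length rs}" using rp(3) by auto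
  have op: "set (map ((!) rs) l) \<subseteq> opers R" if "set l \<subseteq> {..<length rs}" for l
    using that d(2) by (auto simp: subset_iff)
  have cx: "composable R q (ident R (outc R p) # map ((!) rs) low)"
  proof (rule composableI[OF f(3)])
    show "map (outc R) (ident R (outc R p) # map ((!) rs) low) = ins R q"
      using rp(1) oc by (subst f(4)) (simp add: outc_ident o_def)
  qed (use op[OF slow] oc ident_oper in auto)
  define x where "x = compo R q (ident R (outc R p) # map ((!) rs) low)"
  have x: "x \<in> opers R" "outc R x = outc R t" "ins R x = outc R p # concat (map (ins R) (map ((!) rs) low))"
    using cx oc by (simp_all add: x_def compo_oper outc_compo ins_compo ins_ident tp(2))
  have rx: "ins R r = outc R x # tl (ins R r)" using g(4) by (simp only: x(2))
  have v: "v \<in> opers R" "ins R v = ins R x @ tl (ins R r)"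
    using partial_compo_props[of r "[]" x "tl (ins R r)", simplified, OF g(3) rx x(1)]
    by (simp_all add: v_def x_def)
  have "length (tl (ins R r)) = length low'" using g(5) by (simp add: arity_def)
  moreover have "length (concat (map (ins R) (map ((!) rs) low))) = length (concat (map ((!) up') low))"
    unfolding lcat[OF slow] by (simp add: length_concat arity_def[abs_def] o_def)
  ultimately have av: "arity R v = Suc (length vl)"
    by (simp add: arity_def v(2) x(3) vl_def)
  have \<rho>: "0 # map Suc (ranks vl) \<in> permutations_of_set {..<arity R v}"
    unfolding av by (intro permutation_Cons_Suc ranks_permutation dist)
  have "ins R (act R v (0 # map Suc (ranks vl))) ! 0 = outc R p"
    using nth_ins_act[OF v(1) \<rho>] by (simp add: v(2) x(3))
  have w: "composable R (us ! i) (map ((!) rs) (up ! i))" "length (wls ! i) = arity R (ws ! i)"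
    "ws ! i = compo R (us ! i) (map ((!) rs) (up ! i))"
    if i: "i < length us" for i
  proof -
    have s: "set (up ! i) \<subseteq> {..<length rs}"
    proof -
      have "up ! i \<in> set up" using i lup by simp
      then have "set (up ! i) \<subseteq> set (concat up @ low)" by auto
      then show ?thesis using rp(3) by (meson lessThan_iff subset_iff)
    qed
    show cw: "composable R (us ! i) (map ((!) rs) (up ! i))"
      using rp(2)[OF i] c(2) i op[OF s] by (auto intro!: composableI simp: o_def)
    show ws: "ws ! i = compo R (us ! i) (map ((!) rs) (up ! i))" using i lup by (simp add: ws_def)
    show "length (wls ! i) = arity R (ws ! i)"
      unfolding ws arity_compo[OF cw] lcat[OF s, symmetric] using i lup by (simp add: wls_def)
  qed
  have lw: "length ws = length us" "length wls = length us" using lup by (simp_all add: ws_def wls_def)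
  define ws' where "ws' = map2 (\<lambda>u l. act R u (ranks l)) ws wls"
  have w': "ws' ! i \<in> opers R" "outc R (ws' ! i) = outc R (us ! i)" "arity R (ws' ! i) = length (wls ! i)"
    if i: "i < length us" for i
  proof -
    have "ranks (wls ! i) \<in> permutations_of_set {..<arity R (ws ! i)}"
      using ranks_permutation[OF dist(2)[of "wls ! i"]] i lw w(2) by simp
    moreover have "ws ! i \<in> opers R" "outc R (ws ! i) = outc R (us ! i)"
      using w[OF i] by (simp_all add: compo_oper outc_compo)
    ultimately show "ws' ! i \<in> opers R" "outc R (ws' ! i) = outc R (us ! i)" "arity R (ws' ! i) = length (wls ! i)"
      using i lw w(2) by (simp_all add: ws'_def act_oper outc_act arity_act)
  qed
  have lw': "length ws' = length us" using lw by (simp add: ws'_def)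
  have "map (outc R) ws' = map (outc R) us" using lw' w' by (intro nth_equalityI) simp_all
  moreover have "set ws' \<subseteq> opers R" using lw' w' by (auto simp: in_set_conv_nth)
  ultimately have "composable R p ws'" using c by (simp add: composable_def)
  moreover have "map length (map sort wls) = map (arity R) ws'"
    using lw lw' w' by (intro nth_equalityI) simp_all
  moreover have "\<forall>l \<in> set (sort vl # map sort wls). sorted_wrt (<) l"
    using dist by (auto intro: strict_sorted_sort)
  ultimately show ?thesis
    unfolding cm ws'_def[symmetric] using \<open>ins R (act R v _) ! 0 = _\<close> perm v(1) \<rho> av
    by (simp add: sTw_arrows_def act_oper arity_act)
qed

end

section \<open>Labelled planar trees\<close>

text \<open>
  An operation \<open>(p, \<rho>)\<close> of \<open>Sym P\<close> with labels \<open>l\<close> at its inputs is the same as the planar operation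
  \<open>p\<close> with labels at its leaves; \<open>leaf_labels\<close> lists the latter from left to right.
\<close>

definition leaf_labels :: "'o \<times> nat list \<Rightarrow> 'a list \<Rightarrow> 'a list" where
  "leaf_labels u l = map ((!) l) (snd u)"

text \<open>
  In the normal form the distinguished input of the lower vertex \<open>(q, \<rho>)\<close> has number 0, so its
  planar position is the position of 0 in \<open>\<rho>\<close>; the upper vertices are listed in the planar order
  given by \<open>\<sigma>\<close>.
\<close>

definition forget_labels :: "('o \<times> nat list) sym_arrow \<Rightarrow> 'o pl_arrow" where
  "forget_labels = (\<lambda>((p, \<sigma>), (q, \<rho>), us, low, up).
     (p, q, length (takeWhile (\<lambda>x. x \<noteq> 0) \<rho>), map (\<lambda>j. fst (us ! j)) \<sigma>))"

lemma takeWhile_nonzero: "takeWhile (\<lambda>x. x \<noteq> 0) (map Suc a @ 0 # b) = map Suc a"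
  by (induction a) auto

lemma length_takeWhile_nonzero:
  "length (takeWhile (\<lambda>x. 0 < x) (map Suc a @ 0 # b)) = length a"
  using takeWhile_nonzero[of a b] by simp

lemma forget_labels_split:
  "forget_labels ((p, \<sigma>), (q, map Suc a @ 0 # map Suc b), us, low, up)
    = (p, q, length a, map (\<lambda>j. fst (us ! j)) \<sigma>)"
  by (simp add: forget_labels_def length_takeWhile_nonzero)

lemma zero_split_unique:
  assumes "map Suc a @ 0 # map Suc b = map Suc a' @ 0 # map Suc b'"
  shows "a = a'" "b = b'"
proof -
  have "map Suc a = map Suc a'"
    using arg_cong[OF assms, of "takeWhile (\<lambda>x. x \<noteq> 0)"] by (simp only: takeWhile_nonzero)
  then show "a = a'" by simp
  then show "b = b'" using assms by simp
qed

lemma permutation_split_zero: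
  assumes "\<rho> \<in> permutations_of_set {..<Suc n}"
  obtains a b where "\<rho> = map Suc a @ 0 # map Suc b" "a @ b \<in> permutations_of_set {..<n}"
proof -
  note r = permutation_facts[OF assms]
  have "0 \<in> set \<rho>" using r by simp
  then obtain x y where xy: "\<rho> = x @ 0 # y" by (meson split_list)
  define a b where "a = map (\<lambda>x. x - 1) x" and "b = map (\<lambda>x. x - 1) y"
  have "0 \<notin> set x \<union> set y" using r(3) xy by auto
  then have S: "Suc (z - 1) = z" if "z \<in> set x \<union> set y" for z
    using that by (cases z) auto
  have ab: "map Suc a = x" "map Suc b = y"
    unfolding a_def b_def map_map comp_def by (rule map_idI, rule S, simp)+
  have "distinct (map Suc (a @ b))" using r(3) by (simp add: xy ab)
  then have d: "distinct (a @ b)" by (simp only: distinct_map)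
  have "Suc ` set (a @ b) = set (map Suc (a @ b))" by (simp only: set_map)
  also have "\<dots> = set x \<union> set y" by (simp only: map_append ab set_append)
  also have "\<dots> = {..<Suc n} - {0}"
    unfolding r(2)[symmetric] using r(3) unfolding xy by auto
  also have "\<dots> = Suc ` {..<n}" unfolding lessThan_Suc_eq_insert_0 by auto
  finally have "set (a @ b) = {..<n}" by (simp only: inj_image_eq_iff[OF inj_Suc])
  then show ?thesis using that[OF _ permutations_of_setI[OF _ d]] xy ab by blast
qed

lemma length_leaf_labels [simp]: "length (leaf_labels u l) = length (snd u)"
  by (simp add: leaf_labels_def)

lemma leaf_labels_map:
  "set (snd u) \<subseteq> {..<length l} \<Longrightarrow> leaf_labels u (map h l) = map h (leaf_labels u l)"
  by (auto simp: leaf_labels_def subset_iff)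

lemma leaf_labels_Sym_unit: "length l = arity P p \<Longrightarrow> leaf_labels (Sym_unit P p) l = l"
  using map_nth[of l] by (simp add: leaf_labels_def Sym_unit_def)

lemma snd_act_Sym: "snd (act (Sym P) u \<tau>) = leaf_labels u \<tau>"
  by (cases u) (simp add: leaf_labels_def)

lemma leaf_labels_act:
  assumes "set (snd u) \<subseteq> {..<length \<tau>}"
  shows "leaf_labels (act (Sym P) u \<tau>) l = leaf_labels u (map ((!) l) \<tau>)"
proof -
  have "leaf_labels (act (Sym P) u \<tau>) l = map ((!) l) (leaf_labels u \<tau>)"
    by (simp only: leaf_labels_def[of "act (Sym P) u \<tau>"] snd_act_Sym)
  then show ?thesis using assms by (auto simp: leaf_labels_def subset_iff)
qed

text \<open>Normalizing a vertex does not affect the labelled planar operation.\<close>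

lemma leaf_labels_act_ranks:
  assumes "set (snd u) \<subseteq> {..<length l}" "distinct l"
  shows "leaf_labels (act (Sym P) u (ranks l)) (sort l) = leaf_labels u l"
  using assms by (simp add: leaf_labels_act map_nth_sort_ranks)

text \<open>
  Conversely, an increasing list is determined by its set of entries, and then the permutation is
  determined by the position of each entry: the normal form of a vertex can be recovered from
  its planar labelling.
\<close>

lemma leaf_labels_inj:
  fixes l l' :: "nat list"
  assumes "snd u \<in> permutations_of_set {..<n}" "snd u' \<in> permutations_of_set {..<n}" "fst u = fst u'"
    and "sorted_wrt (<) l" "sorted_wrt (<) l'" "length l = n" "length l' = n"
    and eq: "leaf_labels u l = leaf_labels u' l'"
  shows "u = u'" "l = l'"
proof -
  note s = permutation_facts[OF assms(1)] and s' = permutation_facts[OF assms(2)]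
  have "set (leaf_labels u l) = set l" "set (leaf_labels u' l') = set l'"
    unfolding leaf_labels_def
    using assms mset_eq_setD[OF mset_map_nth_permutation[of "snd u" l]]
      mset_eq_setD[OF mset_map_nth_permutation[of "snd u'" l']] by simp_all
  then have "set l = set l'" by (simp only: eq)
  then show l: "l = l'" using assms(4,5) by (auto simp: strict_sorted_iff intro: sorted_distinct_set_unique)
  have d: "distinct l" using assms(4) by (simp add: strict_sorted_iff)
  have "snd u = snd u'"
  proof (rule nth_equalityI)
    fix i assume "i < length (snd u)"
    then have i: "i < length (snd u)" "i < length (snd u')" using s(1) s'(1) by simp_all
    then have "snd u ! i \<in> set (snd u)" "snd u' ! i \<in> set (snd u')" by simp_all
    then have "snd u ! i < length l" "snd u' ! i < length l"
      unfolding s(2) s'(2) assms(6) by simp_all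
    note i = i this
    then show "snd u ! i = snd u' ! i"
      using arg_cong[OF eq, of "\<lambda>x. x ! i"] d l by (simp add: leaf_labels_def nth_eq_iff_index_eq)
  qed (use s s' in simp)
  then show "u = u'" using assms(3) by (simp add: prod_eq_iff)
qed

context
  fixes P :: "('c, 'o) operad"
  assumes P: "planar_operad P"
begin

interpretation planar_operad P by (rule P)
interpretation S: symmetric_operad "Sym P" by (rule symmetric_operad_Sym[OF P])

lemma set_snd_composable:
  assumes "composable (Sym P) pp qs" "i < length qs"
  shows "set (snd (qs ! i)) = {..<arity P (fst (qs ! i))}"
  using permutation_facts(2)[OF Sym_composableD(5)[OF P, of "fst pp" "snd pp" qs]] assms by simp

text \<open>
  Labels of composites are computed leaf by leaf: block permutations disappear when
  operations of \<open>Sym P\<close> are treated as labelled planar operations.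
\<close>

lemma leaf_labels_compo:
  assumes c: "composable (Sym P) (p, \<sigma>) qs" and ls: "map length ls = map (\<lambda>q. arity P (fst q)) qs"
  shows "leaf_labels (compo (Sym P) (p, \<sigma>) qs) (concat ls) = concat (map (\<lambda>i. leaf_labels (qs ! i) (ls ! i)) \<sigma>)"
proof -
  note d = Sym_composableD[OF P c]
  define ms where "ms = map (\<lambda>q. arity P (fst q)) qs"
  define B where "B = blocks ms [0..<sum_list ms]"
  have ll: "length ls = length qs" using map_eq_imp_length_eq[OF ls] .
  have "map ((!) (concat ls)) (map ((!) (B ! i)) (snd (qs ! i))) = leaf_labels (qs ! i) (ls ! i)"
    if "i \<in> set \<sigma>" for i
  proof -
    have i: "i < length qs" using that permutation_facts(2)[OF d(2)] d(3) by simp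
    have "length (B ! i) = arity P (fst (qs ! i))" using i by (simp add: B_def ms_def length_nth_blocks)
    then have "map ((!) (concat ls)) (map ((!) (B ! i)) (snd (qs ! i)))
        = map ((!) (map ((!) (concat ls)) (B ! i))) (snd (qs ! i))"
      using set_snd_composable[OF c i] by simp
    moreover have "map ((!) (concat ls)) (B ! i) = ls ! i"
      unfolding B_def by (rule map_nth_concat_block) (use i ll ls in \<open>simp_all add: ms_def\<close>)
    ultimately show ?thesis by (simp add: leaf_labels_def)
  qed
  then have "map (\<lambda>i. map ((!) (concat ls)) (map ((!) (B ! i)) (snd (qs ! i)))) \<sigma>
      = map (\<lambda>i. leaf_labels (qs ! i) (ls ! i)) \<sigma>" by simp
  then show ?thesis
    by (simp only: leaf_labels_def[of "(_, _)"] Sym_compo ms_def[symmetric] B_def[symmetric]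
        snd_conv map_concat map_map o_def)
qed

text \<open>
  For a lower vertex, \<open>x\<close> is plugged into the first input, which sits between the inputs listed in
  \<open>a\<close> and those listed in \<open>b\<close> in the planar order.
\<close>

lemma lower_compo:
  assumes c: "composable (Sym P) (q, map Suc a @ 0 # map Suc b) (x # ys)"
  shows "fst (compo (Sym P) (q, map Suc a @ 0 # map Suc b) (x # ys))
      = compo P q (map (\<lambda>i. fst (ys ! i)) a @ fst x # map (\<lambda>i. fst (ys ! i)) b)"
    and "map length (l # ls) = map (\<lambda>q. arity P (fst q)) (x # ys) \<Longrightarrow>
      leaf_labels (compo (Sym P) (q, map Suc a @ 0 # map Suc b) (x # ys)) (concat (l # ls))
      = concat (map (\<lambda>i. leaf_labels (ys ! i) (ls ! i)) a) @ leaf_labels x l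
        @ concat (map (\<lambda>i. leaf_labels (ys ! i) (ls ! i)) b)"
  using leaf_labels_compo[OF c, of "l # ls"] by (simp_all add: Sym_compo o_def)

lemma sTw_Sym_arrowsE:
  assumes "f \<in> sTw_arrows (Sym P)"
  obtains p \<sigma> q a b us low up T where
    "f = ((p, \<sigma>), (q, map Suc a @ 0 # map Suc b), us, low, up)"
    "composable (Sym P) (p, \<sigma>) us" "(q, map Suc a @ 0 # map Suc b) \<in> opers (Sym P)"
    "arity P q = Suc (length low)" "map length up = map (\<lambda>u. arity P (fst u)) us"
    "\<forall>l \<in> set (low # up). sorted_wrt (<) l"
    "concat up @ low \<in> permutations_of_set {..<length (concat up @ low)}"
    "a @ b \<in> permutations_of_set {..<length low}"
    "ins (Sym P) (q, map Suc a @ 0 # map Suc b) = outc P p # T"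
    "ins P q = map ((!) T) a @ outc P p # map ((!) T) b"
proof -
  obtain pp qq us low up where f: "f = (pp, qq, us, low, up)" "composable (Sym P) pp us" "qq \<in> opers (Sym P)"
    "ins (Sym P) qq = outc (Sym P) pp # tl (ins (Sym P) qq)" "arity (Sym P) qq = Suc (length low)"
    "map length up = map (arity (Sym P)) us" "\<forall>l \<in> set (low # up). sorted_wrt (<) l"
    "concat up @ low \<in> permutations_of_set {..<length (concat up @ low)}"
    using assms by (rule S.sTw_arrowsE) (rule that)
  obtain p \<sigma> q \<rho> where pq: "pp = (p, \<sigma>)" "qq = (q, \<rho>)" by (cases pp, cases qq)
  define T where "T = tl (ins (Sym P) qq)"
  have T: "ins (Sym P) qq = outc P p # T"
    using f(4) unfolding T_def[symmetric] pq(1) Sym_simps(4) .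
  have ar: "arity P q = Suc (length low)" using f(5) pq by simp
  have \<rho>: "\<rho> \<in> permutations_of_set {..<Suc (length low)}" using f(3) pq ar by simp
  obtain a b where ab: "\<rho> = map Suc a @ 0 # map Suc b" "a @ b \<in> permutations_of_set {..<length low}"
    using permutation_split_zero[OF \<rho>] .
  have "map ((!) (ins (Sym P) qq)) \<rho> = ins P q"
    using map_nth_unpermute[of \<rho> "ins P q"] \<rho> ar by (simp add: pq arity_def)
  then have ip: "ins P q = map ((!) T) a @ outc P p # map ((!) T) b"
    by (simp add: T ab(1) o_def)
  have lup: "map length up = map (\<lambda>u. arity P (fst u)) us" using f(6) by simp
  show ?thesis
    by (rule that[OF f(1)[unfolded pq ab(1)] f(2)[unfolded pq] f(3)[unfolded pq ab(1)] ar lup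
          f(7,8) ab(2) T[unfolded pq ab(1)] ip])
qed

text \<open>
  The target of an arrow is the composite of its planar tree together with the numbers of the
  leaves, read from left to right.
\<close>

lemma sTw_cod_Sym:
  assumes f: "f \<in> sTw_arrows (Sym P)" "f = ((p, \<sigma>), (q, map Suc a @ 0 # map Suc b), us, low, up)"
  shows "forget_labels f \<in> pTw_arrows P"
    and "sTw_cod (Sym P) f = (pTw_cod P (forget_labels f),
      map ((!) low) a @ concat (map (\<lambda>j. leaf_labels (us ! j) (up ! j)) \<sigma>) @ map ((!) low) b)"
proof -
  let ?q = "(q, map Suc a @ 0 # map Suc b)"
  obtain T where g: "composable (Sym P) (p, \<sigma>) us" "?q \<in> opers (Sym P)"
    "arity P q = Suc (length low)" "map length up = map (\<lambda>u. arity P (fst u)) us"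
    "a @ b \<in> permutations_of_set {..<length low}"
    and i: "ins (Sym P) ?q = outc P p # T" "ins P q = map ((!) T) a @ outc P p # map ((!) T) b"
    using f(1)
  proof (rule sTw_Sym_arrowsE, goal_cases)
    case (1 p' \<sigma>' q' a' b' us' low' up' T)
    have "a' = a" "b' = b" using 1(2) zero_split_unique[of a' b' a b] by (simp_all add: f(2))
    then show ?case using 1(1)[of T] 1(2-) by (simp add: f(2))
  qed
  note d = Sym_composableD[OF P g(1)]
  define x where "x = compo (Sym P) (p, \<sigma>) us"
  have x: "x \<in> opers (Sym P)" "outc (Sym P) x = outc P p" "fst x = compo P p (map (\<lambda>j. fst (us ! j)) \<sigma>)"
    using S.compo_oper[OF g(1)] S.outc_compo[OF g(1)] by (simp_all only: x_def Sym_compo fst_conv Sym_simps(4))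
  have xl: "leaf_labels x (concat up) = concat (map (\<lambda>j. leaf_labels (us ! j) (up ! j)) \<sigma>)"
    unfolding x_def by (rule leaf_labels_compo[OF g(1,4)])
  have fl: "forget_labels f = (p, q, length (map ((!) T) a), map (\<lambda>j. fst (us ! j)) \<sigma>)"
    by (simp add: f(2) forget_labels_split)
  have q: "q \<in> opers P" using g(2) by simp
  show "forget_labels f \<in> pTw_arrows P" unfolding fl by (rule pTw_arrowsI[OF d(6) q i(2) refl])
  have y: "partial_compo (Sym P) ?q 0 x = compo (Sym P) ?q (x # map (ident (Sym P)) T)"
    using S.partial_compo_context[of ?q "[]" "outc P p" T x] i(1) by simp
  have cy: "composable (Sym P) ?q (x # map (ident (Sym P)) T)"
    using S.composable_context[of ?q "[]" x T] g(2) x i(1) by (simp del: Sym_simps)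
  have lT: "length T = length low"
    using arg_cong[OF i(1), of length] g(3) by (simp add: arity_def)
  have ab: "i < length low" if "i \<in> set a \<union> set b" for i
    using permutation_facts(2)[OF g(5)] that by auto
  have T: "set T \<subseteq> colours P"
    using S.ins_colours[OF g(2)] unfolding i(1) by simp
  have colT: "T ! i \<in> colours P" if "i < length low" for i
    using T that lT nth_mem[of i T] by auto
  have ax: "arity P (fst x) = length (concat up)"
    using Sym_arity_compo[OF P g(1)] by (simp add: x(3) length_concat g(4))
  have "leaf_labels (compo (Sym P) ?q (x # map (ident (Sym P)) T)) (concat (concat up # map (\<lambda>k. [k]) low))
    = concat (map (\<lambda>i. leaf_labels (map (ident (Sym P)) T ! i) (map (\<lambda>k. [k]) low ! i)) a) @ leaf_labels x (concat up)
      @ concat (map (\<lambda>i. leaf_labels (map (ident (Sym P)) T ! i) (map (\<lambda>k. [k]) low ! i)) b)"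
  proof (rule lower_compo(2)[OF cy])
    have "map (\<lambda>q. arity P (fst q)) (map (ident (Sym P)) T) = map length (map (\<lambda>k. [k]) low)"
      using lT colT by (intro nth_equalityI) (simp_all add: arity_def ins_ident)
    then show "map length (concat up # map (\<lambda>k. [k]) low) = map (\<lambda>q. arity P (fst q)) (x # map (ident (Sym P)) T)"
      by (simp only: list.map ax)
  qed
  also have "map (\<lambda>i. leaf_labels (map (ident (Sym P)) T ! i) (map (\<lambda>k. [k]) low ! i)) a = map (\<lambda>i. [low ! i]) a"
    using ab lT by (intro map_cong refl) (simp add: leaf_labels_def)
  also have "map (\<lambda>i. leaf_labels (map (ident (Sym P)) T ! i) (map (\<lambda>k. [k]) low ! i)) b = map (\<lambda>i. [low ! i]) b"
    using ab lT by (intro map_cong refl) (simp add: leaf_labels_def)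
  finally have *: "leaf_labels (compo (Sym P) ?q (x # map (ident (Sym P)) T)) (concat (concat up # map (\<lambda>k. [k]) low))
    = concat (map (\<lambda>i. [low ! i]) a) @ leaf_labels x (concat up) @ concat (map (\<lambda>i. [low ! i]) b)" .
  have 1: "leaf_labels (partial_compo (Sym P) ?q 0 x) (concat up @ low)
    = map ((!) low) a @ concat (map (\<lambda>j. leaf_labels (us ! j) (up ! j)) \<sigma>) @ map ((!) low) b"
  proof -
    have "concat (map (\<lambda>i. [low ! i]) is) = map ((!) low) is" for "is" by (induction "is") simp_all
    moreover have "concat (concat up # map (\<lambda>k. [k]) low) = concat up @ low"
      by (simp only: concat.simps concat_map_singleton)
    ultimately show ?thesis using * by (simp only: y xl)
  qed
  have e: "map (\<lambda>i. fst (map (ident (Sym P)) T ! i)) a = idents (map ((!) T) a)"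
    "map (\<lambda>i. fst (map (ident (Sym P)) T ! i)) b = idents (map ((!) T) b)"
    using ab lT by simp_all
  have 2: "fst (partial_compo (Sym P) ?q 0 x) = pTw_cod P (forget_labels f)"
    by (simp only: y lower_compo(1)[OF cy] e fl pTw_cod_def case_prod_conv x(3)
        partial_compo_context[OF i(2)])
  have "sTw_cod (Sym P) f = act (Sym P) (partial_compo (Sym P) ?q 0 x) (concat up @ low)"
    by (simp add: f(2) sTw_cod_def x_def)
  then show "sTw_cod (Sym P) f = (pTw_cod P (forget_labels f),
      map ((!) low) a @ concat (map (\<lambda>j. leaf_labels (us ! j) (up ! j)) \<sigma>) @ map ((!) low) b)"
    using 1 2 by (simp add: prod_eq_iff snd_act_Sym)
qed

subsection \<open>Forgetting the labels\<close>

text \<open>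
  Equal targets mean equal labels at all leaves. Since the planar trees agree as well, the labels
  can be cut into the pieces that belong to the vertices, and \<open>leaf_labels_inj\<close> applies to each of
  them.
\<close>

lemma forget_labels_faithful:
  assumes f: "f \<in> sTw_arrows (Sym P)" and f': "f' \<in> sTw_arrows (Sym P)"
    and "fst f = fst f'" "sTw_cod (Sym P) f = sTw_cod (Sym P) f'" "forget_labels f = forget_labels f'"
  shows "f = f'"
proof -
  obtain p \<sigma> q a b us low up T where g: "f = ((p, \<sigma>), (q, map Suc a @ 0 # map Suc b), us, low, up)"
    "composable (Sym P) (p, \<sigma>) us" "(q, map Suc a @ 0 # map Suc b) \<in> opers (Sym P)"
    "arity P q = Suc (length low)" "map length up = map (\<lambda>u. arity P (fst u)) us"
    "\<forall>l \<in> set (low # up). sorted_wrt (<) l"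
    "concat up @ low \<in> permutations_of_set {..<length (concat up @ low)}"
    "a @ b \<in> permutations_of_set {..<length low}"
    using f by (rule sTw_Sym_arrowsE) (rule that)
  obtain p' \<sigma>' q' a' b' us' low' up' T' where g': "f' = ((p', \<sigma>'), (q', map Suc a' @ 0 # map Suc b'), us', low', up')"
    "composable (Sym P) (p', \<sigma>') us'" "(q', map Suc a' @ 0 # map Suc b') \<in> opers (Sym P)"
    "arity P q' = Suc (length low')" "map length up' = map (\<lambda>u. arity P (fst u)) us'"
    "\<forall>l \<in> set (low' # up'). sorted_wrt (<) l"
    "concat up' @ low' \<in> permutations_of_set {..<length (concat up' @ low')}"
    "a' @ b' \<in> permutations_of_set {..<length low'}"
    using f' by (rule sTw_Sym_arrowsE) (rule that)
  have eq: "p' = p" "\<sigma>' = \<sigma>" "q' = q" "length a' = length a" "map (\<lambda>j. fst (us' ! j)) \<sigma> = map (\<lambda>j. fst (us ! j)) \<sigma>"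
    using assms(3,5) by (auto simp: g(1) g'(1) forget_labels_split)
  note d = Sym_composableD[OF P g(2)] and d' = Sym_composableD[OF P g'(2)[unfolded eq]]
  have fst_us: "fst (us' ! j) = fst (us ! j)" if "j < length us" for j
    using eq(5) that permutation_facts(2)[OF d(2)] d(3) by simp
  have ll: "length low' = length low" using g(4) g'(4) eq by simp
  have "length (a @ b) = length low" "length (a' @ b') = length low"
    using permutation_facts(1)[OF g(8)] permutation_facts(1)[OF g'(8)] ll by simp_all
  then have lb: "length b' = length b" using eq(4) by simp
  define W where "W = (\<lambda>(us :: ('o \<times> nat list) list) up j. leaf_labels (us ! j) (up ! j) :: nat list)"
  have len: "length (W us up j) = length (W us' up' j)" if "j \<in> set \<sigma>" for j
  proof -
    have j: "j < length us" "j < length us'" using that permutation_facts(2)[OF d(2)] d(3) d'(3) by simp_all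
    show ?thesis
      using permutation_facts(1)[OF d(5)[OF j(1)]] permutation_facts(1)[OF d'(5)[OF j(2)]] fst_us[OF j(1)]
      by (simp add: W_def)
  qed
  have "map ((!) low) a @ concat (map (W us up) \<sigma>) @ map ((!) low) b
    = map ((!) low') a' @ concat (map (W us' up') \<sigma>) @ map ((!) low') b'"
    using assms(4) sTw_cod_Sym(2)[OF f g(1)] sTw_cod_Sym(2)[OF f' g'(1)] by (simp add: eq W_def)
  moreover have "length (concat (map (W us up) \<sigma>)) = length (concat (map (W us' up') \<sigma>))"
    using len by (simp add: length_concat o_def cong: map_cong)
  ultimately have lab: "map ((!) low) a = map ((!) low') a'" "map ((!) low) b = map ((!) low') b'"
    "concat (map (W us up) \<sigma>) = concat (map (W us' up') \<sigma>)"
    using eq(4) lb by simp_all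
  have "map (W us up) \<sigma> = map (W us' up') \<sigma>"
  proof -
    have l: "map length (map (W us up) \<sigma>) = map length (map (W us' up') \<sigma>)" using len by simp
    have "map (W us up) \<sigma> = blocks (map length (map (W us up) \<sigma>)) (concat (map (W us up) \<sigma>))"
      by (rule blocks_concat[symmetric])
    also have "\<dots> = map (W us' up') \<sigma>" unfolding l lab(3) by (rule blocks_concat)
    finally show ?thesis .
  qed
  then have W: "W us up j = W us' up' j" if "j < length us" for j
    using that permutation_facts(2)[OF d(2)] d(3) by simp
  have lu: "length up = length us" "length up' = length us" "length us' = length us"
    using map_eq_imp_length_eq[OF g(5)] map_eq_imp_length_eq[OF g'(5)] d(3) d'(3) by simp_all
  have "us ! j = us' ! j \<and> up ! j = up' ! j" if j: "j < length us" for j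
  proof -
    have j': "j < length us'" using j lu by simp
    have l: "length (up ! j) = arity P (fst (us ! j))" "length (up' ! j) = arity P (fst (us ! j))"
      using arg_cong[OF g(5), of "\<lambda>l. l ! j"] arg_cong[OF g'(5), of "\<lambda>l. l ! j"] j lu fst_us by simp_all
    have s: "sorted_wrt (<) (up ! j)" "sorted_wrt (<) (up' ! j)" using g(6) g'(6) j lu by simp_all
    have e: "leaf_labels (us ! j) (up ! j) = leaf_labels (us' ! j) (up' ! j)"
      using W[OF j] by (simp add: W_def)
    show ?thesis
      using leaf_labels_inj[OF d(5)[OF j] d'(5)[OF j', unfolded fst_us[OF j]] fst_us[OF j, symmetric] s l e] ..
  qed
  then have us: "us = us'" "up = up'" using lu by (auto intro!: nth_equalityI)
  \<comment> \<open>Without its distinguished input, the lower vertex is numbered like an upper one.\<close>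
  have e: "leaf_labels ((), a @ b) low = leaf_labels ((), a' @ b') low'"
    using lab by (simp add: leaf_labels_def)
  have s: "sorted_wrt (<) low" "sorted_wrt (<) low'" using g(6) g'(6) by simp_all
  have "((), a @ b) = ((), a' @ b')" "low = low'"
    by (rule leaf_labels_inj[OF _ _ _ s refl ll e]; use g(8) g'(8) ll in simp)+
  then have "a = a'" "b = b'" "low = low'" using eq(4) by simp_all
  then show ?thesis unfolding g(1) g'(1) us eq by simp
qed

text \<open>
  By \<open>sTw_cod_Sym\<close> the numbers at the leaves of the first arrow, in planar order, form the
  permutation \<open>\<tau>\<close> of the middle object, by which the upper vertices of the second arrow are brought
  into planar order. Therefore the operations that symmetric composition selects by their
  numbers are those that planar composition selects by their positions.
\<close>

lemma forget_labels_cmp: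
  assumes f: "f \<in> sTw_arrows (Sym P)" and g: "g \<in> sTw_arrows (Sym P)" and gf: "fst g = sTw_cod (Sym P) f"
  shows "forget_labels (sTw_cmp (Sym P) g f) = pTw_cmp P (forget_labels g) (forget_labels f)"
    and "sTw_cod (Sym P) (sTw_cmp (Sym P) g f) = sTw_cod (Sym P) g"
proof -
  note cmp_arrow = S.sTw_cmp_arrow[OF f g gf]
  obtain p \<sigma> q a b us low up T where f1: "f = ((p, \<sigma>), (q, map Suc a @ 0 # map Suc b), us, low, up)"
    "composable (Sym P) (p, \<sigma>) us" "(q, map Suc a @ 0 # map Suc b) \<in> opers (Sym P)"
    "arity P q = Suc (length low)" "map length up = map (\<lambda>u. arity P (fst u)) us"
    "\<forall>l \<in> set (low # up). sorted_wrt (<) l"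
    "concat up @ low \<in> permutations_of_set {..<length (concat up @ low)}"
    "a @ b \<in> permutations_of_set {..<length low}"
    "ins (Sym P) (q, map Suc a @ 0 # map Suc b) = outc P p # T"
    "ins P q = map ((!) T) a @ outc P p # map ((!) T) b"
    using f by (rule sTw_Sym_arrowsE) (rule that)
  obtain t \<tau> r a' b' rs low' up' T' where g1: "g = ((t, \<tau>), (r, map Suc a' @ 0 # map Suc b'), rs, low', up')"
    "composable (Sym P) (t, \<tau>) rs" "(r, map Suc a' @ 0 # map Suc b') \<in> opers (Sym P)"
    "arity P r = Suc (length low')" "map length up' = map (\<lambda>u. arity P (fst u)) rs"
    "\<forall>l \<in> set (low' # up'). sorted_wrt (<) l"
    "concat up' @ low' \<in> permutations_of_set {..<length (concat up' @ low')}"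
    "a' @ b' \<in> permutations_of_set {..<length low'}"
    "ins (Sym P) (r, map Suc a' @ 0 # map Suc b') = outc P t # T'"
    "ins P r = map ((!) T') a' @ outc P t # map ((!) T') b'"
    using g by (rule sTw_Sym_arrowsE) (rule that)
  let ?q = "(q, map Suc a @ 0 # map Suc b)" and ?r = "(r, map Suc a' @ 0 # map Suc b')"
  define La Lb U where "La = map ((!) low) a" and "Lb = map ((!) low) b"
    and "U = (\<lambda>j. leaf_labels (us ! j) (up ! j))"
  have "(t, \<tau>) = (pTw_cod P (forget_labels f), La @ concat (map U \<sigma>) @ Lb)"
    using gf sTw_cod_Sym(2)[OF f f1(1)] by (simp add: g1(1) La_def Lb_def U_def)
  then have \<tau>: "\<tau> = La @ concat (map U \<sigma>) @ Lb" by simp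
  note d = Sym_composableD[OF P f1(2)] and d' = Sym_composableD[OF P g1(2)]
  \<comment> \<open>An operation of the second arrow is grafted onto the leaf that carries its number, so the
    middle object, being composable with \<open>rs\<close>, makes the colours fit at each vertex.\<close>
  have t: "(t, \<tau>) = sTw_cod (Sym P) ((p, \<sigma>), ?q, us, low, up)"
    using gf unfolding f1(1) g1(1) fst_conv .
  have mup: "map length up = map (arity (Sym P)) us" using f1(5) by simp
  have outp: "outc (Sym P) (p, \<sigma>) = outc P p" by simp
  have aq: "arity (Sym P) ?q = Suc (length low)" using f1(4) by simp
  note tp = S.sTw_cod_props[OF f1(2,3) f1(9)[folded outp] aq mup f1(7) t]
  note rp = S.composable_sTw_cod[OF g1(2) tp(3) f1(7) tp(4) mup]
  have lup: "length up = length us" and lup': "length up' = length rs"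
    using map_eq_imp_length_eq[OF f1(5)] map_eq_imp_length_eq[OF g1(5)] .
  have up_len: "length (up ! j) = arity P (fst (us ! j))" if "j < length us" for j
    using arg_cong[OF f1(5), of "\<lambda>l. l ! j"] that lup by simp
  have up'_len: "length (up' ! j) = arity P (fst (rs ! j))" if "j < length rs" for j
    using arg_cong[OF g1(5), of "\<lambda>l. l ! j"] that lup' by simp
  have snd_rs: "set (snd (rs ! j)) = {..<length (up' ! j)}" if "j < length rs" for j
    using set_snd_composable[OF g1(2) that] up'_len[OF that] by simp
  have snd_us: "set (snd (us ! j)) = {..<length (up ! j)}" if "j < length us" for j
    using set_snd_composable[OF f1(2) that] up_len[OF that] by simp
  have low_rs: "j < length rs" if "j \<in> set low" for j
    by (rule rp(3)) (use that in simp)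
  have up_rs: "k < length rs" if "j < length us" "k \<in> set (up ! j)" for j k
  proof -
    have "up ! j \<in> set up" using that lup by simp
    then have "k \<in> set (concat up @ low)" using that by auto
    then show ?thesis by (rule rp(3))
  qed
  have rs_oper: "rs ! j \<in> opers (Sym P)" if "j < length rs" for j
    using S.composableD(2)[OF g1(2)] nth_mem[OF that] by (rule subsetD)
  have a_low: "i < length low" if "i \<in> set a \<union> set b" for i
    using permutation_facts(2)[OF f1(8)] that by auto
  have a_low': "i < length low'" if "i \<in> set a' \<union> set b'" for i
    using permutation_facts(2)[OF g1(8)] that by auto
  have oc: "outc P p \<in> colours P" using outc_colours[OF d(1)] .
  define W where "W = (\<lambda>j. leaf_labels (rs ! j) (up' ! j))"
  define R where "R = (\<lambda>j. fst (rs ! j))"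
  have lenW: "length (W j) = arity P (R j)" if "j < length rs" for j
    using permutation_facts(1)[OF d'(5)[OF that]] by (simp add: W_def R_def)
  \<comment> \<open>The lower vertex of the composite, before its inputs are put in order. The number 0 marks
    the distinguished input and the other numbers are shifted by one.\<close>
  define x where "x = compo (Sym P) ?q (ident (Sym P) (outc P p) # map ((!) rs) low)"
  have cx: "composable (Sym P) ?q (ident (Sym P) (outc P p) # map ((!) rs) low)"
  proof (rule S.composableI[OF f1(3)])
    show "set (ident (Sym P) (outc P p) # map ((!) rs) low) \<subseteq> opers (Sym P)"
      using S.ident_oper[of "outc P p"] oc rs_oper low_rs by (auto simp del: Sym_simps(2,5) simp: Sym_simps(1))
    show "map (outc (Sym P)) (ident (Sym P) (outc P p) # map ((!) rs) low) = ins (Sym P) ?q"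
      unfolding f1(9) rp(1)[symmetric] by (simp add: outc_ident oc)
  qed
  have x: "x \<in> opers (Sym P)" "outc (Sym P) x = outc P t"
    using S.compo_oper[OF cx] S.outc_compo[OF cx] tp(2) by (simp_all only: x_def Sym_simps(4))
  define vlow where "vlow = concat (map ((!) up') low)"
  define vl where "vl = vlow @ low'"
  have vlow_len: "length vlow = sum_list (map (\<lambda>j. arity P (fst (rs ! j))) low)"
    using low_rs up'_len by (simp add: vlow_def length_concat o_def cong: map_cong)
  have ax: "arity P (fst x) = Suc (length vlow)"
    using S.arity_compo[OF cx] oc by (simp add: x_def vlow_len arity_def[of P "ident P _"] ins_ident o_def)
  have fst_x: "fst x = compo P q (map R La @ ident P (outc P p) # map R Lb)"
    unfolding x_def lower_compo(1)[OF cx] using a_low by (simp add: La_def Lb_def R_def o_def cong: map_cong)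
  have lab_x: "leaf_labels x (0 # map Suc vlow) = map Suc (concat (map W La)) @ 0 # map Suc (concat (map W Lb))"
  proof -
    have "leaf_labels x (concat ([0] # map (\<lambda>j. map Suc (up' ! j)) low))
      = concat (map (\<lambda>i. leaf_labels (map ((!) rs) low ! i) (map (\<lambda>j. map Suc (up' ! j)) low ! i)) a)
        @ leaf_labels (ident (Sym P) (outc P p)) [0]
        @ concat (map (\<lambda>i. leaf_labels (map ((!) rs) low ! i) (map (\<lambda>j. map Suc (up' ! j)) low ! i)) b)"
      unfolding x_def
      by (rule lower_compo(2)[OF cx]) (use low_rs up'_len oc in \<open>simp add: arity_def ins_ident\<close>)
    also have "concat ([0] # map (\<lambda>j. map Suc (up' ! j)) low) = 0 # map Suc vlow"
      by (simp add: vlow_def map_concat o_def)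
    also have "map (\<lambda>i. leaf_labels (map ((!) rs) low ! i) (map (\<lambda>j. map Suc (up' ! j)) low ! i)) a = map (\<lambda>i. map Suc (W (low ! i))) a"
      using a_low low_rs snd_rs by (intro map_cong refl) (simp add: W_def leaf_labels_map)
    also have "map (\<lambda>i. leaf_labels (map ((!) rs) low ! i) (map (\<lambda>j. map Suc (up' ! j)) low ! i)) b = map (\<lambda>i. map Suc (W (low ! i))) b"
      using a_low low_rs snd_rs by (intro map_cong refl) (simp add: W_def leaf_labels_map)
    finally show ?thesis
      by (simp add: La_def Lb_def map_concat o_def leaf_labels_def)
  qed
  define v where "v = partial_compo (Sym P) ?r 0 x"
  have rx: "ins (Sym P) ?r = outc (Sym P) x # T'" using g1(9) by (simp only: x(2))
  have cv: "composable (Sym P) ?r (x # map (ident (Sym P)) T')"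
    using S.composable_context[of ?r "[]" x T'] g1(3) x(1) rx by (simp del: Sym_simps)
  have v: "v = compo (Sym P) ?r (x # map (ident (Sym P)) T')"
    using S.partial_compo_context[of ?r "[]" "outc (Sym P) x" T' x] rx by (simp add: v_def del: Sym_simps)
  have lT': "length T' = length low'"
    using arg_cong[OF g1(9), of length] g1(4) by (simp add: arity_def)
  have colT': "T' ! i \<in> colours P" if "i < length low'" for i
  proof -
    have "set T' \<subseteq> colours P" using S.ins_colours[OF g1(3)] unfolding g1(9) by simp
    then show ?thesis using that lT' nth_mem[of i T'] by auto
  qed
  have aT': "map (\<lambda>q. arity P (fst q)) (map (ident (Sym P)) T') = map length (map (\<lambda>k. [Suc k]) low')"
    using lT' colT' by (intro nth_equalityI) (simp_all add: arity_def ins_ident)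
  have av: "arity P (fst v) = Suc (length vl)"
  proof -
    have "sum_list (map (\<lambda>q. arity P (fst q)) (map (ident (Sym P)) T')) = length low'"
      unfolding aT' by (simp add: o_def sum_list_triv)
    then show ?thesis using S.arity_compo[OF cv] ax by (simp add: v vl_def)
  qed
  have fst_v: "fst v = partial_compo P r (length a') (fst x)"
  proof -
    have e: "map (\<lambda>i. fst (map (ident (Sym P)) T' ! i)) a' = idents (map ((!) T') a')"
      "map (\<lambda>i. fst (map (ident (Sym P)) T' ! i)) b' = idents (map ((!) T') b')"
      using a_low' lT' by simp_all
    show ?thesis
      using partial_compo_context[OF g1(10), of "fst x"] by (simp only: v lower_compo(1)[OF cv] e length_map)
  qed
  have lab_v: "leaf_labels v (0 # map Suc vl) = map Suc (map ((!) low') a' @ concat (map W La))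
      @ 0 # map Suc (concat (map W Lb) @ map ((!) low') b')"
  proof -
    have "leaf_labels v (concat ((0 # map Suc vlow) # map (\<lambda>k. [Suc k]) low'))
      = concat (map (\<lambda>i. leaf_labels (map (ident (Sym P)) T' ! i) (map (\<lambda>k. [Suc k]) low' ! i)) a')
        @ leaf_labels x (0 # map Suc vlow)
        @ concat (map (\<lambda>i. leaf_labels (map (ident (Sym P)) T' ! i) (map (\<lambda>k. [Suc k]) low' ! i)) b')"
      unfolding v by (rule lower_compo(2)[OF cv]) (simp only: list.map aT' ax length_Cons length_map)
    also have "map (\<lambda>i. leaf_labels (map (ident (Sym P)) T' ! i) (map (\<lambda>k. [Suc k]) low' ! i)) a' = map (\<lambda>i. [Suc (low' ! i)]) a'"
      using a_low' lT' by (intro map_cong refl) (simp add: leaf_labels_def)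
    also have "map (\<lambda>i. leaf_labels (map (ident (Sym P)) T' ! i) (map (\<lambda>k. [Suc k]) low' ! i)) b' = map (\<lambda>i. [Suc (low' ! i)]) b'"
      using a_low' lT' by (intro map_cong refl) (simp add: leaf_labels_def)
    also have "concat ((0 # map Suc vlow) # map (\<lambda>k. [Suc k]) low') = 0 # map Suc vl"
    proof -
      have "concat (map (\<lambda>k. [Suc k]) ks) = map Suc ks" for ks by (induction ks) simp_all
      then show ?thesis by (simp add: vl_def)
    qed
    finally have *: "leaf_labels v (0 # map Suc vl) = concat (map (\<lambda>i. [Suc (low' ! i)]) a')
        @ leaf_labels x (0 # map Suc vlow) @ concat (map (\<lambda>i. [Suc (low' ! i)]) b')" .
    have "concat (map (\<lambda>i. [Suc (low' ! i)]) ks) = map Suc (map ((!) low') ks)" for ks by (induction ks) simp_all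
    then show ?thesis using * by (simp add: lab_x)
  qed
  have "snd v \<in> permutations_of_set {..<Suc (length vl)}"
    using S.compo_oper[OF cv] unfolding v[symmetric] by (cases v) (use av in auto)
  then obtain e e' where e: "snd v = map Suc e @ 0 # map Suc e'" "e @ e' \<in> permutations_of_set {..<length vl}"
    by (rule permutation_split_zero)
  have e_vl: "i < length vl" if "i \<in> set e \<union> set e'" for i
    using permutation_facts(2)[OF e(2)] that by auto
  have lab_v': "leaf_labels v (0 # map Suc l) = map Suc (map ((!) l) e) @ 0 # map Suc (map ((!) l) e')"
    if "length l = length vl" for l
    using e_vl that by (simp add: leaf_labels_def e(1))
  note e_lab = zero_split_unique[OF lab_v[unfolded lab_v'[OF refl]]]
  \<comment> \<open>An upper vertex of the composite is \<open>us ! j\<close> with the operations numbered by \<open>up ! j\<close> plugged in,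
    brought into normal form; in planar order these operations are those numbered by \<open>U j\<close>.\<close>
  define ws where "ws = map2 (\<lambda>q l. compo (Sym P) q (map ((!) rs) l)) us up"
  define wls where "wls = map (\<lambda>l. concat (map ((!) up') l)) up"
  define us' where "us' = map2 (\<lambda>u l. act (Sym P) u (ranks l)) ws wls"
  define c c' where "c = map ((!) (ranks vl)) e" and "c' = map ((!) (ranks vl)) e'"
  have "act (Sym P) v (0 # map Suc (ranks vl)) = (fst v, map Suc c @ 0 # map Suc c')"
    using lab_v'[of "ranks vl"] by (simp add: prod_eq_iff snd_act_Sym c_def c'_def)
  then have cm: "sTw_cmp (Sym P) g f = ((p, \<sigma>), (fst v, map Suc c @ 0 # map Suc c'), us', sort vl, map sort wls)"
    by (simp only: f1(1) g1(1) sTw_cmp_def case_prod_conv Let_def v_def x_def vl_def vlow_def ws_def wls_def us'_def Sym_simps(4))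
  \<comment> \<open>The sorted lists of labels are strictly increasing since the composite is in normal form, so
    the labels were distinct before sorting.\<close>
  have "\<forall>l \<in> set (sort vl # map sort wls). sorted_wrt (<) l"
    using cmp_arrow unfolding cm sTw_arrows_def mem_Collect_eq case_prod_conv by blast
  then have dist: "distinct vl" "\<And>l. l \<in> set wls \<Longrightarrow> distinct l" by (auto simp: strict_sorted_iff)
  have c_lab: "map ((!) (sort vl)) c = map ((!) vl) e" "map ((!) (sort vl)) c' = map ((!) vl) e'"
  proof -
    have "sort vl ! (ranks vl ! i) = vl ! i" if "i < length vl" for i
      using arg_cong[OF map_nth_sort_ranks[OF dist(1)], of "\<lambda>l. l ! i"] that by simp
    then show "map ((!) (sort vl)) c = map ((!) vl) e" "map ((!) (sort vl)) c' = map ((!) vl) e'"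
      using e_vl by (simp_all add: c_def c'_def)
  qed
  have upper: "fst (us' ! j) = compo P (fst (us ! j)) (map R (U j))"
      "leaf_labels (us' ! j) (map sort wls ! j) = concat (map W (U j))"
      "length (U j) = arity P (fst (us ! j))" "\<And>k. k \<in> set (U j) \<Longrightarrow> k < length rs"
    if j: "j \<in> set \<sigma>" for j
  proof -
    have j: "j < length us" using j permutation_facts(2)[OF d(2)] d(3) by simp
    have U: "U j = map (\<lambda>i. up ! j ! i) (snd (us ! j))" by (simp add: U_def leaf_labels_def)
    show "length (U j) = arity P (fst (us ! j))"
      using permutation_facts(1)[OF d(5)[OF j]] by (simp add: U_def)
    show "k < length rs" if "k \<in> set (U j)" for k
      using that snd_us[OF j] up_rs[OF j] by (auto simp: U)
    have us_j: "us ! j \<in> opers (Sym P)" using S.composableD(2)[OF f1(2)] nth_mem[OF j] by (rule subsetD)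
    have cw: "composable (Sym P) (us ! j) (map ((!) rs) (up ! j))"
    proof (rule S.composableI[OF us_j])
      show "set (map ((!) rs) (up ! j)) \<subseteq> opers (Sym P)"
        using rs_oper up_rs[OF j] by (auto simp del: Sym_simps)
      show "map (outc (Sym P)) (map ((!) rs) (up ! j)) = ins (Sym P) (us ! j)"
        unfolding map_map comp_def by (rule rp(2)[OF j])
    qed
    have ws_j: "ws ! j = compo (Sym P) (us ! j) (map ((!) rs) (up ! j))"
      and wls_j: "wls ! j = concat (map ((!) up') (up ! j))"
      and us'_j: "us' ! j = act (Sym P) (ws ! j) (ranks (wls ! j))"
      using j lup by (simp_all add: ws_def wls_def us'_def)
    show "fst (us' ! j) = compo P (fst (us ! j)) (map R (U j))"
    proof -
      have "map (\<lambda>i. fst (map ((!) rs) (up ! j) ! i)) (snd (us ! j)) = map R (U j)"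
        using snd_us[OF j] by (simp add: U R_def)
      then show ?thesis by (cases "us ! j") (simp add: us'_j ws_j Sym_compo)
    qed
    have "length (wls ! j) = sum_list (map (\<lambda>k. arity P (fst (rs ! k))) (up ! j))"
      using up_rs[OF j] up'_len by (simp add: wls_j length_concat o_def cong: map_cong)
    then have aw: "arity P (fst (ws ! j)) = length (wls ! j)"
      using S.arity_compo[OF cw] by (simp add: ws_j o_def)
    have "snd (ws ! j) \<in> permutations_of_set {..<length (wls ! j)}"
      using S.compo_oper[OF cw] unfolding ws_j[symmetric] by (cases "ws ! j") (use aw in auto)
    then have "set (snd (ws ! j)) \<subseteq> {..<length (wls ! j)}" by (simp add: permutation_facts)
    then have "leaf_labels (us' ! j) (sort (wls ! j)) = leaf_labels (ws ! j) (wls ! j)"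
      unfolding us'_j using dist(2)[of "wls ! j"] j lup by (intro leaf_labels_act_ranks) (simp_all add: wls_def)
    also have "\<dots> = concat (map (\<lambda>i. leaf_labels (map ((!) rs) (up ! j) ! i) (map ((!) up') (up ! j) ! i)) (snd (us ! j)))"
    proof -
      have "composable (Sym P) (fst (us ! j), snd (us ! j)) (map ((!) rs) (up ! j))"
        using cw by (simp only: prod.collapse)
      from leaf_labels_compo[OF this, of "map ((!) up') (up ! j)"] show ?thesis
        unfolding ws_j wls_j prod.collapse using up_rs[OF j] up'_len by simp
    qed
    also have "\<dots> = concat (map W (U j))"
      unfolding U W_def map_map comp_def
      by (intro arg_cong[of _ _ concat] map_cong refl) (use snd_us[OF j] in simp)
    finally show "leaf_labels (us' ! j) (map sort wls ! j) = concat (map W (U j))"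
      using j lup by (simp add: wls_def)
  qed
  have fh: "forget_labels (sTw_cmp (Sym P) g f) = (p, fst v, length c, map (\<lambda>j. fst (us' ! j)) \<sigma>)"
    unfolding cm by (rule forget_labels_split)
  have La_rs: "j < length rs" if "j \<in> set La" for j
    using that a_low low_rs by (auto simp: La_def)
  have "length c = length (map ((!) low') a' @ concat (map W La))"
    using arg_cong[OF e_lab(1), of length] by (simp add: c_def)
  also have "\<dots> = length a' + sum_list (map (arity P) (map R La))"
    using La_rs lenW by (simp add: length_concat o_def cong: map_cong)
  finally have lc: "length c = length a' + sum_list (map (arity P) (map R La))" .
  have "pTw_cmp P (t, r, length a', map R La @ concat (map (\<lambda>j. map R (U j)) \<sigma>) @ map R Lb)
      (p, q, length a, map (\<lambda>j. fst (us ! j)) \<sigma>)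
    = (p, fst v, length c, map2 (compo P) (map (\<lambda>j. fst (us ! j)) \<sigma>) (map (\<lambda>j. map R (U j)) \<sigma>))"
    unfolding lc fst_v fst_x
    by (rule pTw_cmp_blocks) (use upper(3) in \<open>simp_all add: La_def\<close>)
  also have "map2 (compo P) (map (\<lambda>j. fst (us ! j)) \<sigma>) (map (\<lambda>j. map R (U j)) \<sigma>) = map (\<lambda>j. fst (us' ! j)) \<sigma>"
    using upper(1) by (simp add: zip_map_map zip_same_conv_map)
  also have "map R La @ concat (map (\<lambda>j. map R (U j)) \<sigma>) @ map R Lb = map R \<tau>"
    by (simp add: \<tau> map_concat o_def)
  finally show 1: "forget_labels (sTw_cmp (Sym P) g f) = pTw_cmp P (forget_labels g) (forget_labels f)"
    unfolding fh by (simp add: f1(1) g1(1) forget_labels_split R_def)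
  have "snd (sTw_cod (Sym P) (sTw_cmp (Sym P) g f))
     = map ((!) vl) e @ concat (map (\<lambda>j. concat (map W (U j))) \<sigma>) @ map ((!) vl) e'"
    using sTw_cod_Sym(2)[OF cmp_arrow cm] upper(2) by (simp add: c_lab cong: map_cong)
  also have "\<dots> = map ((!) low') a' @ concat (map W \<tau>) @ map ((!) low') b'"
  proof -
    have "concat (map (\<lambda>j. concat (map W (U j))) ks) = concat (map W (concat (map U ks)))" for ks
      by (induction ks) simp_all
    then show ?thesis by (simp add: e_lab \<tau>)
  qed
  also have "\<dots> = snd (sTw_cod (Sym P) g)"
    using sTw_cod_Sym(2)[OF g g1(1)] by (simp add: W_def[abs_def])
  finally have 2: "snd (sTw_cod (Sym P) (sTw_cmp (Sym P) g f)) = snd (sTw_cod (Sym P) g)" .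
  have "fst (forget_labels g) = pTw_cod P (forget_labels f)"
    using gf sTw_cod_Sym(2)[OF f f1(1)] by (simp add: g1(1) forget_labels_split)
  then have "pTw_cod P (forget_labels (sTw_cmp (Sym P) g f)) = pTw_cod P (forget_labels g)"
    unfolding 1 using sTw_cod_Sym(1)[OF f f1(1)] sTw_cod_Sym(1)[OF g g1(1)] by (intro pTw_cmp_props(2))
  then have "fst (sTw_cod (Sym P) (sTw_cmp (Sym P) g f)) = fst (sTw_cod (Sym P) g)"
    using sTw_cod_Sym(2)[OF cmp_arrow cm] sTw_cod_Sym(2)[OF g g1(1)] by simp
  then show "sTw_cod (Sym P) (sTw_cmp (Sym P) g f) = sTw_cod (Sym P) g"
    using 2 by (simp add: prod_eq_iff)
qed

section \<open>The equivalence\<close>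


text \<open>
  For \<open>\<tau> = \<sigma>\<close> the arrow \<open>e\<close> is an identity; in general it is an isomorphism which shows that every
  object is isomorphic to one in the image of the comparison functor.
\<close>

lemma relabelling:
  assumes p: "(p, \<sigma>) \<in> opers (Sym P)" and \<tau>: "\<tau> \<in> permutations_of_set {..<arity P p}"
    and e: "e = ((p, \<sigma>), ident (Sym P) (outc P p), map (ident (Sym P)) (ins (Sym P) (p, \<sigma>)), [],
      map (\<lambda>x. [x]) (unpermute \<sigma> \<tau>))"
  shows "e \<in> sTw_arrows (Sym P)" "sTw_cod (Sym P) e = (p, \<tau>)"
    "forget_labels e = (p, ident P (outc P p), 0, idents (ins P p))"
proof -
  have \<sigma>: "\<sigma> \<in> permutations_of_set {..<arity P p}" and "p \<in> opers P" using p by auto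
  note c = S.composable_idents[OF p] and oc = outc_colours[OF \<open>p \<in> opers P\<close>]
  note s = permutation_facts[OF \<sigma>]
  have l\<tau>: "length \<tau> = arity P p" using permutation_facts(1)[OF \<tau>] .
  have lins: "length (ins (Sym P) (p, \<sigma>)) = arity P p" by (simp add: arity_def)
  have col: "ins (Sym P) (p, \<sigma>) ! j \<in> colours P" if "j < arity P p" for j
  proof -
    have "set (ins (Sym P) (p, \<sigma>)) \<subseteq> colours P" using S.ins_colours[OF p] by simp
    then show ?thesis using that nth_mem[of j "ins (Sym P) (p, \<sigma>)"] lins by auto
  qed
  have u: "map ((!) (unpermute \<sigma> \<tau>)) \<sigma> = \<tau>" using \<sigma> l\<tau> by (intro map_nth_unpermute) simp
  have "mset (unpermute \<sigma> \<tau>) = mset \<tau>"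
    using mset_map_nth_permutation[of \<sigma> "unpermute \<sigma> \<tau>"] \<sigma> l\<tau> u by simp
  then have perm: "unpermute \<sigma> \<tau> \<in> permutations_of_set {..<length (unpermute \<sigma> \<tau>)}"
    using \<tau> l\<tau> by (simp add: mem_permutations_lessThan_iff)
  have "map length (map (\<lambda>x. [x]) (unpermute \<sigma> \<tau>))
      = map (arity (Sym P)) (map (ident (Sym P)) (ins (Sym P) (p, \<sigma>)))"
    using l\<tau> lins col by (intro nth_equalityI) (simp_all add: arity_def[of P "ident P _"] ins_ident del: Sym_simps(3))
  then show ar: "e \<in> sTw_arrows (Sym P)"
    using c perm oc S.ident_oper[of "outc P p"] S.ins_ident[of "outc P p"]
    by (auto simp: e sTw_arrows_def concat_map_singleton arity_def ins_ident simp del: Sym_simps(2,3))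
  have e': "e = ((p, \<sigma>), (ident P (outc P p), map Suc [] @ 0 # map Suc []),
      map (ident (Sym P)) (ins (Sym P) (p, \<sigma>)), [], map (\<lambda>x. [x]) (unpermute \<sigma> \<tau>))"
    by (simp add: e)
  have "map (\<lambda>j. fst (map (ident (Sym P)) (ins (Sym P) (p, \<sigma>)) ! j)) \<sigma> = idents (map ((!) (ins (Sym P) (p, \<sigma>))) \<sigma>)"
    using s(2) lins by (simp del: Sym_simps(3))
  also have "map ((!) (ins (Sym P) (p, \<sigma>))) \<sigma> = ins P p"
    using \<sigma> by (simp add: arity_def map_nth_unpermute)
  finally have fl: "map (\<lambda>j. fst (map (ident (Sym P)) (ins (Sym P) (p, \<sigma>)) ! j)) \<sigma> = idents (ins P p)" .
  show fe: "forget_labels e = (p, ident P (outc P p), 0, idents (ins P p))"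
    unfolding e' forget_labels_split fl by simp
  have "map (\<lambda>j. leaf_labels (map (ident (Sym P)) (ins (Sym P) (p, \<sigma>)) ! j) (map (\<lambda>x. [x]) (unpermute \<sigma> \<tau>) ! j)) \<sigma>
      = map (\<lambda>x. [x]) (map ((!) (unpermute \<sigma> \<tau>)) \<sigma>)"
    using s(2) l\<tau> lins by (simp add: leaf_labels_def del: Sym_simps(3))
  then show "sTw_cod (Sym P) e = (p, \<tau>)"
    unfolding sTw_cod_Sym(2)[OF ar e'] fe pTw_idt_props(2)[OF \<open>p \<in> opers P\<close> refl]
    by (simp only: u concat_map_singleton list.map append_Nil append_Nil2)
qed

lemma Sym_unit_props:
  assumes "p \<in> opers P"
  shows "Sym_unit P p \<in> opers (Sym P)" "ins (Sym P) (Sym_unit P p) = ins P p"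
    "outc (Sym P) (Sym_unit P p) = outc P p"
  using operad_morphism_Sym_unit[OF P] assms unfolding operad_morphism_def by (simp_all add: Sym_unit_def)

lemma Tw_Sym_arrow_props:
  assumes "f \<in> pTw_arrows P"
  shows "Tw_Sym_arrow P f \<in> sTw_arrows (Sym P)" "forget_labels (Tw_Sym_arrow P f) = f"
    "sTw_cod (Sym P) (Tw_Sym_arrow P f) = Sym_unit P (pTw_cod P f)"
proof -
  obtain p q A B qs where f: "f = (p, q, length A, qs)" "composable P p qs" "q \<in> opers P"
    "ins P q = A @ outc P p # B" using assms by (rule pTw_arrowsE)
  note c = composableD[OF f(2)]
  define i where "i = length A"
  define ms where "ms = map (arity P) qs"
  define s where "s = sum_list ms"
  define k where "k = i + length B"
  have m: "arity P q = Suc k" using f(4) by (simp add: arity_def k_def i_def)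
  define \<rho> where "\<rho> = map Suc [0..<i] @ 0 # map Suc [i..<k]"
  define low where "low = [0..<i] @ [i + s..<k + s]"
  define up where "up = blocks ms [i..<i + s]"
  have \<rho>: "\<rho> \<in> permutations_of_set {..<arity P q}"
  proof -
    have "[0..<i] @ [i..<k] = [0..<k]" using upt_add_eq_append[of 0 i "length B"] by (simp add: k_def)
    then have "[0..<Suc k] = 0 # map Suc ([0..<i] @ [i..<k])"
      by (simp add: map_Suc_upt upt_conv_Cons del: upt_Suc map_append)
    then show ?thesis unfolding m mem_permutations_lessThan_iff by (simp add: \<rho>_def del: upt_Suc)
  qed
  have act: "act (Sym P) (Sym_unit P q) ([1..<Suc i] @ [0] @ [Suc i..<arity P q]) = (q, \<rho>)"
  proof -
    have e: "[1..<Suc i] @ [0] @ [Suc i..<arity P q] = \<rho>" by (simp add: \<rho>_def map_Suc_upt m del: upt_Suc)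
    have "map ((!) \<rho>) [0..<arity P q] = \<rho>" using map_nth[of \<rho>] permutation_facts(1)[OF \<rho>] by simp
    then show ?thesis unfolding e by (simp add: Sym_unit_def)
  qed
  have F: "Tw_Sym_arrow P f = (Sym_unit P p, (q, \<rho>), map (Sym_unit P) qs, low, up)"
    unfolding f(1) Tw_Sym_arrow_def by (simp only: case_prod_conv Let_def i_def[symmetric] act)
      (simp add: ms_def s_def low_def up_def m)
  have q: "(q, \<rho>) \<in> opers (Sym P)" using f(3) \<rho> by simp
  have cs: "composable (Sym P) (Sym_unit P p) (map (Sym_unit P) qs)"
  proof (rule S.composableI)
    show "set (map (Sym_unit P) qs) \<subseteq> opers (Sym P)"
      using c(2) Sym_unit_props(1) unfolding set_map by blast
    have "map (outc (Sym P)) (map (Sym_unit P) qs) = map (outc P) qs" by (simp add: Sym_unit_def)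
    then show "map (outc (Sym P)) (map (Sym_unit P) qs) = ins (Sym P) (Sym_unit P p)"
      using c(1,3) Sym_unit_props(2) by simp
  qed (use c Sym_unit_props in blast)
  have cup: "concat up = [i..<i + s]" unfolding up_def by (rule concat_blocks) (simp add: s_def)
  have lup: "map length up = map (arity (Sym P)) (map (Sym_unit P) qs)"
    unfolding up_def by (subst map_length_blocks) (simp_all add: s_def ms_def Sym_unit_def)
  \<comment> \<open>In planar order the leaves are numbered consecutively, which is why the target is in the image
    of \<open>Sym_unit\<close>.\<close>
  have order: "[0..<i] @ [i..<i + s] @ [i + s..<k + s] = [0..<k + s]"
    using upt_add_eq_append[of 0 i s] upt_add_eq_append[of 0 "i + s" "k - i"] by (simp add: k_def ac_simps)
  have perm: "concat up @ low \<in> permutations_of_set {..<length (concat up @ low)}"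
  proof -
    have "mset (concat up @ low) = mset ([0..<i] @ [i..<i + s] @ [i + s..<k + s])"
      by (simp add: cup low_def)
    then have ms: "mset (concat up @ low) = mset [0..<k + s]" unfolding order .
    have "length (concat up @ low) = k + s" using mset_eq_length[OF ms] by simp
    then show ?thesis using ms by (simp only: mem_permutations_lessThan_iff)
  qed
  have sorted: "sorted_wrt (<) l" if "l \<in> set (low # up)" for l
  proof -
    have "sorted_wrt (<) low" by (auto simp: low_def sorted_wrt_append)
    moreover have "sorted_wrt (<) l" if l: "l \<in> set up" for l
    proof -
      obtain xs ys where "up = xs @ l # ys" using split_list[OF l] by blast
      then have "concat up = concat xs @ l @ concat ys" by simp
      moreover have "sorted_wrt (<) (concat up)" by (simp add: cup)
      ultimately show ?thesis by (simp add: sorted_wrt_append)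
    qed
    ultimately show ?thesis using that by auto
  qed
  have "ins (Sym P) (q, \<rho>) ! 0 = outc P p"
  proof -
    have "map ((!) (ins (Sym P) (q, \<rho>))) \<rho> = ins P q"
      using \<rho> by (simp add: arity_def map_nth_unpermute)
    from arg_cong[OF this, of "\<lambda>l. l ! i"] show ?thesis by (simp add: \<rho>_def f(4) i_def nth_append)
  qed
  moreover have "length low = k" by (simp add: low_def k_def)
  ultimately show ar: "Tw_Sym_arrow P f \<in> sTw_arrows (Sym P)"
    unfolding F sTw_arrows_def mem_Collect_eq case_prod_conv
    using cs q lup sorted perm m Sym_unit_props(3)[OF c(1)] by simp
  note F' = F[unfolded Sym_unit_def[of P p] \<rho>_def]
  have sel: "map ((!) (qs)) [0..<arity P p] = qs" using map_nth[of qs] c(4) by simp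
  have "map (\<lambda>j. fst (map (Sym_unit P) qs ! j)) [0..<arity P p] = map ((!) qs) [0..<arity P p]"
    using c(4) by (simp add: Sym_unit_def)
  note fl = this[unfolded sel]
  show fF: "forget_labels (Tw_Sym_arrow P f) = f"
    unfolding F' forget_labels_split fl by (simp add: f(1) i_def)
  have "map (\<lambda>j. leaf_labels (map (Sym_unit P) qs ! j) (up ! j)) [0..<arity P p] = map ((!) up) [0..<arity P p]"
  proof (intro map_cong refl)
    fix j assume "j \<in> set [0..<arity P p]"
    then have j: "j < length qs" using c(4) by simp
    then have "length (up ! j) = arity P (qs ! j)" unfolding up_def by (subst length_nth_blocks) (simp_all add: s_def ms_def)
    then show "leaf_labels (map (Sym_unit P) qs ! j) (up ! j) = up ! j" using j by (simp add: leaf_labels_Sym_unit)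
  qed
  also have "\<dots> = up" using map_nth[of up] c(4) by (simp add: up_def ms_def)
  finally have U: "concat (map (\<lambda>j. leaf_labels (map (Sym_unit P) qs ! j) (up ! j)) [0..<arity P p]) = [i..<i + s]"
    by (simp add: cup)
  have L: "map ((!) low) [0..<i] = [0..<i]" "map ((!) low) [i..<k] = [i + s..<k + s]"
    by (auto simp: low_def nth_append k_def intro!: nth_equalityI)
  have "arity P (pTw_cod P f) = k + s"
    using pTw_cod_context(2)[OF f(2-4) refl]
    by (simp add: f(1) arity_def[abs_def] length_concat k_def i_def s_def ms_def o_def)
  then show "sTw_cod (Sym P) (Tw_Sym_arrow P f) = Sym_unit P (pTw_cod P f)"
    unfolding sTw_cod_Sym(2)[OF ar F'] fF U L order by (simp add: Sym_unit_def)
qed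

lemma fst_forget_labels: "f \<in> sTw_arrows (Sym P) \<Longrightarrow> fst (forget_labels f) = fst (fst f)"
  by (simp add: forget_labels_def split: prod.split)

lemma sTw_dom_cod_Sym:
  assumes f: "f \<in> sTw_arrows (Sym P)"
  shows "fst f \<in> opers (Sym P)" "sTw_cod (Sym P) f \<in> opers (Sym P)"
    "forget_labels f \<in> pTw_arrows P" "pTw_cod P (forget_labels f) = fst (sTw_cod (Sym P) f)"
proof -
  obtain pp q us low up where g: "f = (pp, q, us, low, up)" "composable (Sym P) pp us" "q \<in> opers (Sym P)"
    "ins (Sym P) q = outc (Sym P) pp # tl (ins (Sym P) q)" "arity (Sym P) q = Suc (length low)"
    "map length up = map (arity (Sym P)) us" "\<forall>l \<in> set (low # up). sorted_wrt (<) l"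
    "concat up @ low \<in> permutations_of_set {..<length (concat up @ low)}"
    using f by (rule S.sTw_arrowsE) (rule that)
  show "fst f \<in> opers (Sym P)" "sTw_cod (Sym P) f \<in> opers (Sym P)"
    using S.composableD(1)[OF g(2)] S.sTw_cod_props(1)[OF g(2-6,8) refl] by (simp_all only: g(1) fst_conv)
  obtain p \<sigma> q a b us low up T where "f = ((p, \<sigma>), (q, map Suc a @ 0 # map Suc b), us, low, up)"
    using f by (rule sTw_Sym_arrowsE) (rule that)
  from sTw_cod_Sym[OF f this]
  show "forget_labels f \<in> pTw_arrows P" "pTw_cod P (forget_labels f) = fst (sTw_cod (Sym P) f)" by simp_all
qed

lemma fst_sTw_cmp: "fst (sTw_cmp R g f) = fst f"
  by (cases f; cases g) (simp add: sTw_cmp_def Let_def)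

lemma fst_Tw_Sym_arrow: "fst (Tw_Sym_arrow P f) = Sym_unit P (fst f)"
  by (cases f) (simp add: Tw_Sym_arrow_def Let_def)

lemma fst_oper: "x \<in> opers (Sym P) \<Longrightarrow> fst x \<in> opers P"
  by (cases x) simp

lemma arrow_lift_section_Sym:
  "arrow_lift_section (Tw_pOp P) (Tw_sOp (Sym P)) fst forget_labels (Sym_unit P) (Tw_Sym_arrow P)"
proof -
  have idt: "(x, ident (Sym P) (outc (Sym P) x), map (ident (Sym P)) (ins (Sym P) x), [],
      map (\<lambda>k. [k]) [0..<arity (Sym P) x]) = e"
    if "x = (p, \<sigma>)" "x \<in> opers (Sym P)" and e: "e = ((p, \<sigma>), ident (Sym P) (outc P p),
      map (ident (Sym P)) (ins (Sym P) (p, \<sigma>)), [], map (\<lambda>x. [x]) (unpermute \<sigma> \<sigma>))" for x p \<sigma> e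
  proof -
    have \<sigma>: "\<sigma> \<in> permutations_of_set {..<arity P p}" using that(1,2) by simp
    have "map ((!) [0..<arity P p]) \<sigma> = \<sigma>"
      by (rule map_idI) (use permutation_facts(2)[OF \<sigma>] in simp)
    then have "unpermute \<sigma> \<sigma> = [0..<arity P p]"
      using \<sigma> permutation_facts(1)[OF \<sigma>] by (intro unpermute_eqI) simp_all
    then show ?thesis by (simp only: that(1) e Sym_simps(4) Sym_arity fst_conv)
  qed
  have idt_props: "e \<in> sTw_arrows (Sym P)" "sTw_cod (Sym P) e = x"
      "forget_labels e = (fst x, ident P (outc P (fst x)), 0, idents (ins P (fst x)))"
    if x: "x \<in> opers (Sym P)" and e: "e = (x, ident (Sym P) (outc (Sym P) x), map (ident (Sym P)) (ins (Sym P) x), [],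
      map (\<lambda>k. [k]) [0..<arity (Sym P) x])" for x e
  proof -
    obtain p \<sigma> where p: "x = (p, \<sigma>)" by fastforce
    have \<sigma>: "\<sigma> \<in> permutations_of_set {..<arity P p}" using x p by simp
    note r = relabelling[OF x[unfolded p] \<sigma> refl, folded idt[OF p x refl], folded e]
    show "e \<in> sTw_arrows (Sym P)" "sTw_cod (Sym P) e = x"
      "forget_labels e = (fst x, ident P (outc P (fst x)), 0, idents (ins P (fst x)))"
      using r by (simp_all only: p fst_conv)
  qed
  have vertical: "\<exists>f \<in> sTw_arrows (Sym P). fst f = x \<and> sTw_cod (Sym P) f = y \<and>
      forget_labels f = (fst x, ident P (outc P (fst x)), 0, idents (ins P (fst x)))"
    if x: "x \<in> opers (Sym P)" and y: "y \<in> opers (Sym P)" and xy: "fst x = fst y" for x y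
  proof -
    obtain p \<sigma> \<tau> where p: "x = (p, \<sigma>)" "y = (p, \<tau>)" using xy by (cases x; cases y) simp
    have "\<tau> \<in> permutations_of_set {..<arity P p}" using y p by simp
    from relabelling[OF x[unfolded p] this refl] show ?thesis unfolding p fst_conv by (intro bexI conjI) auto
  qed
  show ?thesis
  proof (intro arrow_lift_section.intro arrow_lift.intro arrow_lift_axioms.intro
      arrow_lift_section_axioms.intro category_Tw_pOp, goal_cases)
    case (15 f f')
    then show ?case by (intro forget_labels_faithful) (simp_all add: Tw_sOp_def)
  next
    case (16 x y)
    then show ?case using vertical[of x y] by (simp add: Tw_sOp_def Tw_pOp_def)
  qed (simp_all add: Tw_sOp_def Tw_pOp_def sTw_dom_cod_Sym idt_props[OF _ refl] forget_labels_cmp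
      S.sTw_cmp_arrow Sym_unit_props(1) Tw_Sym_arrow_props fst_sTw_cmp fst_forget_labels
      fst_Tw_Sym_arrow fst_oper del: Sym_simps Sym_arity, simp add: Sym_unit_def)
qed

end

theorem proposition2p29:
  shows "(\<forall>P :: ('c, 'o) operad. planar_operad P \<longrightarrow>
            equivalence_functor (Tw_pOp P) (Tw_sOp (Sym P)) (Sym_unit P) (Tw_Sym_arrow P))
       \<and> (\<exists>Fm. isomorphism_functor (Tw_pOp uAs_pl) Delta (\<lambda>n. n) Fm)
       \<and> equivalent_categories (Tw_sOp uAs) (Tw_pOp uAs_pl)
       \<and> equivalent_categories (Tw_sOp uAs) Delta"
proof (intro conjI allI impI)
  fix P :: "('c, 'o) operad"
  assume "planar_operad P"
  then show "equivalence_functor (Tw_pOp P) (Tw_sOp (Sym P)) (Sym_unit P) (Tw_Sym_arrow P)"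
    by (rule arrow_lift_section.equivalence_functor_F[OF arrow_lift_section_Sym])
next
  show "\<exists>Fm. isomorphism_functor (Tw_pOp uAs_pl) Delta (\<lambda>n. n) Fm"
    using isomorphism_functor_gap_map by blast
  note lift = arrow_lift_section_Sym[OF planar_operad_uAs_pl, folded uAs_def]
  show "equivalent_categories (Tw_sOp uAs) (Tw_pOp uAs_pl)"
    unfolding equivalent_categories_def
    using arrow_lift_section.equivalence_functor_G[OF lift] by blast
  show "equivalent_categories (Tw_sOp uAs) Delta"
    unfolding equivalent_categories_def
    using arrow_lift_section.equivalence_functor_G[OF
        arrow_lift_section.arrow_lift_section_compose_isomorphism[OF lift isomorphism_functor_gap_map]] by blast
qed

end
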